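(* Let $d\ge 1$ and let $\theta:\mathbb R^d\to[0,\infty)$ be a radially decreasing measurable function with $\lim_{\|\xi\|\to\infty}\theta(\xi)=0$. Put $$I=\int_{\|\xi\|\ge 1}\frac{\theta(\xi)}{\|\xi\|^{d}}\,d\xi .$$ (a) Let $f\in L^p(\mathbb R^d)$ for some $p\in[1,2]$, and suppose that either $$\int_{\mathbb R^d}\frac{|\widehat f(\xi)|^q\,e^{q\theta(\xi)\|\xi\|}}{(1+\|\xi\|)^N}\,d\xi<\infty$$ for some $q\in[1,\infty)$ and some $N\ge 0$, or $$|\widehat f(\xi)|\le C\,|P(\xi)|\,e^{-\theta(\xi)\|\xi\|}\quad\text{for almost every }\xi\in\mathbb R^d,$$ where $C>0$ is a constant and $P$ is a polynomial. If $f$ vanishes (almost everywhere) on a nonempty open subset of $\mathbb R^d$ and $I=\infty$, then $f=0$ almost everywhere on $\mathbb R^d$. (b) If $I<\infty$, then for $q\in[1,\infty)$ and $N\ge 0$ there exists a nonzero $f\in C_c^\infty(\mathbb R^d)$ satisfying $\int_{\mathbb R^d}\frac{|\widehat f(\xi)|^q e^{q\theta(\xi)\|\xi\|}}{(1+\|\xi\|)^N}\,d\xi<\infty$, and (in the case $q=\infty$) there exists a nonzero $f\in C_c^\infty(\mathbb R^d)$ satisfying $|\widehat f(\xi)|\le C|P(\xi)|e^{-\theta(\xi)\|\xi\|}$ for almost every $\xi$, for some constant $C$ and polynomial $P$.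
   Context: The Fourier transform of $f\in L^1(\mathbb R^d)$ is $\widehat f(\xi)=\int_{\mathbb R^d}f(x)e^{-2\pi i x\cdot\xi}\,dx$, extended to $L^p(\mathbb R^d)$, $1<p\le 2$, in the usual way. A function $\theta$ on $\mathbb R^d$ is radially decreasing if it is radial and $\theta(x)\le\theta(y)$ whenever $\|x\|\ge\|y\|$; $\|\cdot\|$ is the Euclidean norm. *)

theory Defs
  imports "HOL-Analysis.Analysis"
begin

coinductive smooth_fun :: "('a::euclidean_space \<Rightarrow> complex) \<Rightarrow> bool" where
  "(\<forall>x. f differentiable (at x)) \<Longrightarrow>
   (\<forall>b\<in>Basis. smooth_fun (\<lambda>x. frechet_derivative f (at x) b)) \<Longrightarrow> smooth_fun f"

definition test_function :: "('a::euclidean_space \<Rightarrow> complex) \<Rightarrow> bool" where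
  "test_function f \<longleftrightarrow> smooth_fun f \<and> compact (closure {x. f x \<noteq> 0})"

definition fourier :: "('a::euclidean_space \<Rightarrow> complex) \<Rightarrow> 'a \<Rightarrow> complex" where
  "fourier f \<xi> = (\<integral>x. f x * exp (- (2 * pi * \<i>) * complex_of_real (x \<bullet> \<xi>)) \<partial>lborel)"

definition Lp :: "real \<Rightarrow> ('a::euclidean_space \<Rightarrow> complex) \<Rightarrow> bool" where
  "Lp p f \<longleftrightarrow> f \<in> borel_measurable lborel \<and> (\<integral>\<^sup>+x. ennreal (norm (f x) powr p) \<partial>lborel) < \<infinity>"

text \<open>g is (a representative of) the Fourier transform of f, in the sense of
  distributions: g is locally integrable and the multiplication formula
  holds against all test functions. For f in L^p, 1 \<le> p \<le> 2, this
  determines g a.e. and agrees with the usual extension of the Fourier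
  transform to L^p.\<close>
definition fourier_transform_of ::
  "('a::euclidean_space \<Rightarrow> complex) \<Rightarrow> ('a \<Rightarrow> complex) \<Rightarrow> bool" where
  "fourier_transform_of f g \<longleftrightarrow>
     g \<in> borel_measurable lborel \<and>
     (\<forall>K. compact K \<longrightarrow> set_integrable lborel K g) \<and>
     (\<forall>\<phi>. test_function \<phi> \<longrightarrow>
        (\<integral>x. f x * fourier \<phi> x \<partial>lborel) = (\<integral>\<xi>. g \<xi> * \<phi> \<xi> \<partial>lborel))"

inductive poly_fun :: "('a::euclidean_space \<Rightarrow> complex) \<Rightarrow> bool" where
  const: "poly_fun (\<lambda>x. c)"
| coord: "b \<in> Basis \<Longrightarrow> poly_fun (\<lambda>x. complex_of_real (x \<bullet> b))"
| add: "poly_fun P \<Longrightarrow> poly_fun Q \<Longrightarrow> poly_fun (\<lambda>x. P x + Q x)"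
| mult: "poly_fun P \<Longrightarrow> poly_fun Q \<Longrightarrow> poly_fun (\<lambda>x. P x * Q x)"

definition radially_decreasing :: "('a::euclidean_space \<Rightarrow> real) \<Rightarrow> bool" where
  "radially_decreasing \<theta> \<longleftrightarrow> (\<forall>x y. norm x \<ge> norm y \<longrightarrow> \<theta> x \<le> \<theta> y)"

end

theory Submission
  imports Defs "HOL-Probability.Probability" "HOL-Real_Asymp.Real_Asymp"
begin

text \<open>In dyadic form, with \<open>\<theta> \<xi> = \<Theta> (norm \<xi>)\<close>, the integral \<open>I\<close> is finite iff \<open>\<Sum>k. \<Theta> (2 ^ k)\<close> converges.

  If it converges, averaging a bump successively over intervals of lengths comparable to
  \<open>\<Theta> n / n\<close> gives a smooth compactly supported function on the line whose Fourier transform decays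
  like \<open>exp (- \<Theta> \<bar>t\<bar> * \<bar>t\<bar>)\<close>. Products over the coordinates settle the general dimension.

  If it diverges, convolve \<open>f\<close> with such a product \<open>\<phi>\<close> of tiny support and
  rate \<open>\<Theta> r = 3 / sqrt (1 + r)\<close>. The convolution still vanishes on a ball, and it is the inverse Fourier
  transform of the product of \<open>g\<close> with the transform of \<open>\<phi>\<close>. On every line through the
  centre of the ball its \<open>n\<close>-th derivative is at most a constant times
  \<open>\<Prod>k<n. m (Suc k)\<close>, where \<open>m k\<close> is comparable to \<open>k / \<Theta> (k ^ 4)\<close>. Since \<open>\<Sum>k. 1 / m k\<close> diverges, the
  Denjoy-Carleman theorem, proved by Bang's argument, shows that the convolution vanishes
  identically. Letting \<open>\<phi>\<close> tend to indicators of small boxes gives \<open>f = 0\<close> almost everywhere.\<close>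

section \<open>Iterated averages and compactly supported bumps\<close>

text \<open>Even when the integral diverges, a decreasing \<open>\<Theta>\<close> may be tiny at the
  start of very long plateaus, so \<open>exp (\<Theta> r * r)\<close> need not dominate even a fixed
  power of \<open>r\<close> uniformly. This is why \<open>f\<close> is first convolved: the
  transform of the kernel supplies a factor about \<open>exp (- 3 * sqrt r)\<close>. One third of it
  absorbs polynomial weights, one third gives integrability over the whole space, and one third pays
  for a factor \<open>exp (sqrt r)\<close> in the moment estimates. There \<open>r ^ n\<close> is
  split. About \<open>r powr (1/4)\<close> of its factors cost only \<open>exp (sqrt r)\<close>,
  since \<open>r powr (1/4) * ln r\<close> is negligible against \<open>sqrt r\<close>. The other
  factors are handled by \<open>y ^ n \<le> fact n * exp y\<close> with
  \<open>y = \<Theta> r * r\<close>; their indices satisfy \<open>r \<le> k ^ 4\<close>, hence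
  \<open>\<Theta> (k ^ 4) \<le> \<Theta> r\<close>. Sampling \<open>\<Theta>\<close> at fourth
  powers is harmless: on the dyadic scale it keeps every fourth term of a monotone series, which
  does not affect divergence.\<close>

definition antideriv :: "(real \<Rightarrow> real) \<Rightarrow> real \<Rightarrow> real" where
  "antideriv u = (SOME F. \<forall>x. (F has_real_derivative u x) (at x))"

lemma antideriv:
  assumes "continuous_on UNIV u"
  shows "(antideriv u has_real_derivative u x) (at x)"
proof -
  have "\<exists>F. \<forall>x::real. -\<infinity> < ereal x \<longrightarrow> ereal x < \<infinity> \<longrightarrow> (F has_vector_derivative u x) (at x)"
    by (rule einterval_antiderivative) (use assms in \<open>auto simp: continuous_on_eq_continuous_at\<close>)
  then have "\<exists>F. \<forall>x. (F has_real_derivative u x) (at x)"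
    by (simp add: has_real_derivative_iff_has_vector_derivative)
  then have "\<forall>x. (antideriv u has_real_derivative u x) (at x)"
    unfolding antideriv_def by (rule someI_ex)
  then show ?thesis by blast
qed

text \<open>Since only differences of the primitive enter, any choice of primitive will do. Using
  primitives rather than integrals lets every estimate on averages come from the mean value
  theorem.\<close>

definition avg :: "real \<Rightarrow> (real \<Rightarrow> real) \<Rightarrow> real \<Rightarrow> real" where
  "avg a u x = (antideriv u (x + a) - antideriv u (x - a)) / (2 * a)"

lemma avg_mean_value:
  assumes "continuous_on UNIV u" "a > 0"
  shows "\<exists>y. x - a < y \<and> y < x + a \<and> avg a u x = u y"
proof -
  have "\<exists>z. x - a < z \<and> z < x + a \<and>
      antideriv u (x + a) - antideriv u (x - a) = ((x + a) - (x - a)) * u z"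
    by (rule MVT2) (use assms antideriv in auto)
  then show ?thesis using assms(2) by (auto simp: avg_def)
qed

text \<open>The mean value theorem is applied to the difference of the two primitives, so that both
  functions are evaluated at the same point. Hence averaging does not increase the sup distance of
  two functions.\<close>

lemma avg_diff_mean_value:
  assumes "continuous_on UNIV u" "continuous_on UNIV v" "a > 0"
  shows "\<exists>y. avg a u x - avg a v x = u y - v y"
proof -
  have "\<exists>z. x - a < z \<and> z < x + a \<and>
      (antideriv u (x + a) - antideriv v (x + a)) - (antideriv u (x - a) - antideriv v (x - a))
      = ((x + a) - (x - a)) * (u z - v z)"
    by (rule MVT2) (use assms antideriv in \<open>auto intro!: derivative_eq_intros\<close>)
  then obtain z where "(antideriv u (x + a) - antideriv v (x + a)) -
      (antideriv u (x - a) - antideriv v (x - a)) = ((x + a) - (x - a)) * (u z - v z)" by blast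
  then have "(antideriv u (x + a) - antideriv u (x - a)) - (antideriv v (x + a) - antideriv v (x - a))
      = 2 * a * (u z - v z)" by simp
  then have "avg a u x - avg a v x = u z - v z"
    unfolding avg_def diff_divide_distrib[symmetric] using assms(3) by simp
  then show ?thesis ..
qed

lemma avg_deriv:
  assumes "continuous_on UNIV u" "a > 0"
  shows "(avg a u has_real_derivative (u (x + a) - u (x - a)) / (2 * a)) (at x)"
proof -
  have "((\<lambda>x. antideriv u (x + a)) has_real_derivative u (x + a) * 1) (at x)"
    by (rule DERIV_chain2[OF antideriv[OF assms(1)]]) (auto intro!: derivative_eq_intros)
  moreover have "((\<lambda>x. antideriv u (x - a)) has_real_derivative u (x - a) * 1) (at x)"
    by (rule DERIV_chain2[OF antideriv[OF assms(1)]]) (auto intro!: derivative_eq_intros)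
  ultimately show ?thesis
    unfolding avg_def[abs_def] by (intro DERIV_cdivide DERIV_diff) simp_all
qed

lemma avg_cont:
  assumes "continuous_on UNIV u" "a > 0"
  shows "continuous_on UNIV (avg a u)"
  by (intro continuous_at_imp_continuous_on ballI DERIV_isCont[OF avg_deriv[OF assms]])

section \<open>Compactly supported functions on the line and their Fourier transforms\<close>

lemma norm_integral_le:
  fixes f :: "'b \<Rightarrow> 'c::{banach, second_countable_topology}"
  assumes "integrable M g" "\<And>x. norm (f x) \<le> g x"
  shows "norm (integral\<^sup>L M f) \<le> integral\<^sup>L M g"
proof -
  have "norm (integral\<^sup>L M f) \<le> (\<integral>x. norm (f x) \<partial>M)" by (rule integral_norm_bound)
  also have "\<dots> \<le> integral\<^sup>L M g"
    using assms order_trans[OF norm_ge_zero assms(2)] by (intro integral_mono') auto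
  finally show ?thesis .
qed

lemma integrable_compact_support:
  fixes f :: "real \<Rightarrow> 'b::euclidean_space"
  assumes "continuous_on UNIV f" "\<And>x. \<bar>x\<bar> \<ge> B \<Longrightarrow> f x = 0"
  shows "integrable lborel f"
proof -
  have "set_integrable lborel {-B..B} f"
    using continuous_on_subset[OF assms(1)] by (intro borel_integrable_atLeastAtMost') auto
  then have "integrable lborel (\<lambda>x. indicator {-B..B} x *\<^sub>R f x)" by (simp add: set_integrable_def)
  moreover have "(\<lambda>x. indicator {-B..B} x *\<^sub>R f x) = f"
    using assms(2) by (auto simp: indicator_def fun_eq_iff)
  ultimately show ?thesis by simp
qed

text \<open>Applied to a product, this is integration by parts without boundary terms.\<close>

lemma integral_derivative_eq_0:
  fixes F f :: "real \<Rightarrow> complex"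
  assumes F: "\<And>x. (F has_vector_derivative f x) (at x)" and f: "continuous_on UNIV f"
    and supp: "\<And>x. \<bar>x\<bar> \<ge> B \<Longrightarrow> F x = 0" and B: "B \<ge> 0"
  shows "(\<integral>x. f x \<partial>lborel) = 0"
proof -
  have f0: "f x = 0" if "\<bar>x\<bar> > B" for x
  proof -
    have "open {x. \<bar>x\<bar> > B}" by (intro open_Collect_less continuous_intros)
    then have "((\<lambda>_. 0) has_vector_derivative f x) (at x)"
      using that supp by (intro has_vector_derivative_transform_within_open[OF F]) auto
    then show ?thesis
      using has_vector_derivative_const vector_derivative_unique_at by blast
  qed
  have "(LBINT x. indicat_real {-B-1..B+1} x *\<^sub>R f x) = F (B + 1) - F (-B-1)"
    using F B continuous_on_subset[OF f]
    by (intro integral_FTC_Icc) (auto intro: has_vector_derivative_at_within)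
  moreover have "(\<lambda>x. indicat_real {-B-1..B+1} x *\<^sub>R f x) = f"
    using f0 B by (auto simp: indicator_def fun_eq_iff)
  ultimately show ?thesis using supp B by simp
qed

lemma has_vector_derivative_shift:
  assumes "(f has_vector_derivative d) (at (x + c))"
  shows "((\<lambda>x. f (x + c)) has_vector_derivative d) (at x)"
proof -
  have "((\<lambda>x. x + c) has_vector_derivative 1) (at x)"
    by (auto intro!: derivative_eq_intros)
  from vector_diff_chain_at[OF this assms] show ?thesis by (simp add: o_def)
qed

lemma exp_of_real_vector_derivative:
  fixes c :: complex
  shows "((\<lambda>x. exp (c * of_real x)) has_vector_derivative c * exp (c * of_real x)) (at x)"
  by (rule has_vector_derivative_real_field[where f = "\<lambda>z. exp (c * z)"])
     (auto intro!: derivative_eq_intros)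

lemma fourier_bound:
  fixes f :: "real \<Rightarrow> complex"
  assumes "\<And>x. norm (f x) \<le> 1" "\<And>x. \<bar>x\<bar> \<ge> B \<Longrightarrow> f x = 0" "B \<ge> 0"
  shows "norm (fourier f t) \<le> 2 * B"
proof -
  have "norm (fourier f t) \<le> (\<integral>x. indicator {-B..B} x \<partial>lborel)"
    unfolding fourier_def
  proof (rule norm_integral_le)
    show "norm (f x * exp (- (2 * pi * \<i>) * complex_of_real (x \<bullet> t))) \<le> indicator {-B..B} x" for x
      using assms(1)[of x] assms(2)[of x] by (cases "x \<in> {-B..B}") (auto simp: norm_mult)
    show "integrable lborel (indicat_real {-B..B})"
      by (rule integrable_real_indicator) (auto simp: emeasure_lborel_Icc_eq)
  qed
  also have "\<dots> = 2 * B" using assms(3) by simp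
  finally show ?thesis .
qed

lemma fourier_translate:
  fixes f :: "real \<Rightarrow> complex"
  shows "fourier (\<lambda>x. f (x + c)) t = exp (2 * pi * \<i> * of_real (c * t)) * fourier f t"
proof -
  have "fourier f t = (\<integral>x. f (c + 1 * x) * exp (- (2 * pi * \<i>) * complex_of_real ((c + 1 * x) * t)) \<partial>lborel)"
    unfolding fourier_def by (subst lborel_integral_real_affine[where c=1 and t=c]) auto
  also have "\<dots> = (\<integral>x. exp (- (2 * pi * \<i>) * of_real (c * t)) *
      (f (x + c) * exp (- (2 * pi * \<i>) * complex_of_real (x * t))) \<partial>lborel)"
    by (intro Bochner_Integration.integral_cong refl)
       (simp add: algebra_simps exp_add exp_diff exp_minus divide_inverse)
  also have "\<dots> = exp (- (2 * pi * \<i>) * of_real (c * t)) * fourier (\<lambda>x. f (x + c)) t"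
    unfolding fourier_def by simp
  finally show ?thesis by (simp add: mult.assoc[symmetric] flip: exp_add)
qed

section \<open>Infinitely iterated averages of a Lipschitz function\<close>

locale bump_seq =
  fixes a :: "nat \<Rightarrow> real" and u :: "real \<Rightarrow> real" and L R :: real
  assumes a_pos: "\<And>n. a n > 0" and summ: "summable a"
    and lip: "\<And>x y. \<bar>u x - u y\<bar> \<le> L * \<bar>x - y\<bar>" and L_nonneg: "L \<ge> 0"
    and range_u: "\<And>x. u x \<in> {0..1}"
    and supp_u: "\<And>x. \<bar>x\<bar> \<ge> R \<Longrightarrow> u x = 0" and R_nonneg: "R \<ge> 0"
begin

text \<open>The average over \<open>a n\<close> is outermost and a further average is inserted
  innermost, next to \<open>u\<close>. In the limit this gives
  \<open>bump n = avg (a n) (bump (Suc n))\<close>, from which both smoothness and Fourier decay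
  follow.\<close>

fun smear :: "nat \<Rightarrow> nat \<Rightarrow> real \<Rightarrow> real" where
  "smear 0 n = u"
| "smear (Suc m) n = avg (a n) (smear m (Suc n))"

definition bump :: "nat \<Rightarrow> real \<Rightarrow> real" where
  "bump n x = lim (\<lambda>m. smear m n x)"

definition tail :: "nat \<Rightarrow> real" where
  "tail n = (\<Sum>i. a (i + n))"

lemma tail_eq: "tail n = suminf a - sum a {..<n}"
  unfolding tail_def using suminf_minus_initial_segment[OF summ] by simp

lemma tail_tendsto: "(\<lambda>m. tail (n + m)) \<longlonglongrightarrow> 0"
proof -
  have "(\<lambda>m. suminf a - sum a {..<m}) \<longlonglongrightarrow> suminf a - suminf a"
    by (intro tendsto_intros summable_LIMSEQ summ)
  then have "tail \<longlonglongrightarrow> 0" by (simp add: tail_eq[abs_def])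
  from LIMSEQ_ignore_initial_segment[OF this, of n] show ?thesis by (simp add: add.commute)
qed

lemma sum_le_tail: "(\<Sum>i<m. a (n + i)) \<le> tail n"
  unfolding tail_def using summ a_pos
  by (simp add: add.commute[of n] sum_le_suminf summable_ignore_initial_segment less_imp_le)

lemma tail_le: "tail n \<le> suminf a"
  unfolding tail_eq using a_pos by (simp add: sum_nonneg less_imp_le)

lemma cont_u: "continuous_on UNIV u"
proof (rule continuous_at_imp_continuous_on, rule ballI)
  fix x
  have "((\<lambda>y. L * \<bar>y - x\<bar>) \<longlongrightarrow> 0) (at x)"
    by (auto intro!: tendsto_eq_intros)
  then have "((\<lambda>y. u y - u x) \<longlongrightarrow> 0) (at x)"
    by (rule Lim_null_comparison[rotated]) (use lip in auto)
  then show "isCont u x" by (simp add: isCont_def LIM_zero_iff)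
qed

lemma smear_cont: "continuous_on UNIV (smear m n)"
  by (induction m arbitrary: n) (auto intro!: avg_cont cont_u a_pos)

lemma smear_range: "smear m n x \<in> {0..1}"
proof (induction m arbitrary: n x)
  case (Suc m)
  then show ?case using avg_mean_value[OF smear_cont[of m "Suc n"] a_pos[of n], of x] by auto
qed (use range_u in auto)

lemma smear_supp: "\<bar>x\<bar> \<ge> R + (\<Sum>i<m. a (n + i)) \<Longrightarrow> smear m n x = 0"
proof (induction m arbitrary: n x)
  case (Suc m)
  obtain y where y: "x - a n < y" "y < x + a n" "smear (Suc m) n x = smear m (Suc n) y"
    using avg_mean_value[OF smear_cont[of m "Suc n"] a_pos[of n], of x] by auto
  have "(\<Sum>i<Suc m. a (n + i)) = a n + (\<Sum>i<m. a (Suc n + i))"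
    by (subst sum.lessThan_Suc_shift) simp
  with Suc.prems y have "\<bar>y\<bar> \<ge> R + (\<Sum>i<m. a (Suc n + i))" by linarith
  then show ?case using Suc.IH y by simp
qed (use supp_u in auto)

text \<open>One more average changes only the innermost function, from \<open>u\<close> to its
  average over \<open>a (n + m)\<close>, which costs at most \<open>L * a (n + m)\<close> by the
  Lipschitz bound. The outer averages do not enlarge this error.\<close>

lemma smear_step: "\<bar>smear (Suc m) n x - smear m n x\<bar> \<le> L * a (n + m)"
proof (induction m arbitrary: n x)
  case 0
  obtain y where y: "x - a n < y" "y < x + a n" "avg (a n) u x = u y"
    using avg_mean_value[OF cont_u a_pos] by blast
  have "\<bar>u y - u x\<bar> \<le> L * \<bar>y - x\<bar>" by (rule lip)
  also have "\<dots> \<le> L * a n" using y L_nonneg by (intro mult_left_mono) auto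
  finally show ?case using y by simp
next
  case (Suc m)
  obtain y where "smear (Suc (Suc m)) n x - smear (Suc m) n x =
      smear (Suc m) (Suc n) y - smear m (Suc n) y"
    using avg_diff_mean_value[OF smear_cont[of "Suc m" "Suc n"] smear_cont[of m "Suc n"] a_pos[of n], of x]
    by (auto simp del: smear.simps simp: smear.simps(2)[of _ n])
  then show ?case using Suc.IH[of "Suc n" y] by (simp del: smear.simps)
qed

lemma smear_diff: "\<bar>smear (m + k) n x - smear m n x\<bar> \<le> L * tail (n + m)"
proof -
  have "\<bar>smear (m + k) n x - smear m n x\<bar> \<le> L * (\<Sum>i<k. a (n + m + i))"
  proof (induction k)
    case (Suc k)
    then show ?case using smear_step[of "m + k" n x]
      by (simp del: smear.simps add: algebra_simps)
  qed simp
  also have "\<dots> \<le> L * tail (n + m)" by (intro mult_left_mono sum_le_tail L_nonneg)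
  finally show ?thesis .
qed

lemma bump_LIMSEQ: "(\<lambda>m. smear m n x) \<longlonglongrightarrow> bump n x"
proof -
  have "Cauchy (\<lambda>m. smear m n x)"
  proof (rule metric_CauchyI)
    fix e :: real assume "e > 0"
    have "(\<lambda>m. L * tail (n + m)) \<longlonglongrightarrow> L * 0" by (intro tendsto_intros tail_tendsto)
    then have "eventually (\<lambda>m. L * tail (n + m) < e / 2) sequentially"
      using \<open>e > 0\<close> by (intro order_tendstoD) auto
    then obtain M where M: "L * tail (n + M) < e / 2" by (auto simp: eventually_sequentially)
    have "dist (smear i n x) (smear M n x) < e / 2" if "i \<ge> M" for i
      using smear_diff[of M "i - M" n x] M that by (simp add: dist_real_def)
    then show "\<exists>M. \<forall>m\<ge>M. \<forall>k\<ge>M. dist (smear m n x) (smear k n x) < e"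
      by (metis dist_triangle_half_l)
  qed
  then show ?thesis
    unfolding bump_def by (simp add: Cauchy_convergent_iff convergent_LIMSEQ_iff)
qed

lemma bump_approx: "\<bar>bump n x - smear m n x\<bar> \<le> L * tail (n + m)"
proof (rule LIMSEQ_le_const2)
  show "(\<lambda>k. \<bar>smear (k + m) n x - smear m n x\<bar>) \<longlonglongrightarrow> \<bar>bump n x - smear m n x\<bar>"
    by (intro tendsto_intros LIMSEQ_ignore_initial_segment bump_LIMSEQ)
  show "\<exists>N. \<forall>k\<ge>N. \<bar>smear (k + m) n x - smear m n x\<bar> \<le> L * tail (n + m)"
    using smear_diff[where n=n and x=x and m=m] by (auto simp: add.commute)
qed

lemma bump_close: "\<bar>bump n x - u x\<bar> \<le> L * suminf a"
proof -
  have "\<bar>bump n x - u x\<bar> \<le> L * tail n" using bump_approx[of n x 0] by simp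
  also have "\<dots> \<le> L * suminf a" by (intro mult_left_mono tail_le L_nonneg)
  finally show ?thesis .
qed

lemma bump_range: "bump n x \<in> {0..1}"
  using LIMSEQ_le_const[OF bump_LIMSEQ, of 0 n x] LIMSEQ_le_const2[OF bump_LIMSEQ, of n x 1]
    smear_range by auto

lemma bump_supp: "\<bar>x\<bar> \<ge> R + suminf a \<Longrightarrow> bump n x = 0"
proof -
  assume *: "\<bar>x\<bar> \<ge> R + suminf a"
  have "smear m n x = 0" for m
    using * sum_le_tail[of n m] tail_le[of n] by (intro smear_supp) linarith
  then show "bump n x = 0" using bump_LIMSEQ[of n x] by (simp add: LIMSEQ_const_iff)
qed

lemma bump_cont: "continuous_on UNIV (bump n)"
proof (rule uniform_limit_theorem)
  show "\<forall>\<^sub>F m in sequentially. continuous_on UNIV (smear m n)" by (simp add: smear_cont)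
  have lim: "(\<lambda>m. L * tail (n + m)) \<longlonglongrightarrow> 0"
    by (rule tendsto_mult_right_zero tail_tendsto)+
  show "uniform_limit UNIV (\<lambda>m. smear m n) (bump n) sequentially"
  proof (rule uniform_limitI)
    fix e :: real assume "e > 0"
    with lim have "\<forall>\<^sub>F m in sequentially. L * tail (n + m) < e" by (rule order_tendstoD)
    then show "\<forall>\<^sub>F m in sequentially. \<forall>x\<in>UNIV. dist (smear m n x) (bump n x) < e"
      by eventually_elim (use bump_approx in \<open>auto simp: dist_real_def abs_minus_commute intro: le_less_trans\<close>)
  qed
qed simp

text \<open>The averages of \<open>smear m (Suc n)\<close> and of \<open>bump (Suc n)\<close> differ
  by the difference of these functions at a common point, so the recursion of \<open>smear\<close>
  passes to the limit by the uniform bound \<open>bump_approx\<close>.\<close>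

lemma bump_avg: "bump n = avg (a n) (bump (Suc n))"
proof
  fix x
  have "(\<lambda>m. smear (Suc m) n x - avg (a n) (bump (Suc n)) x) \<longlonglongrightarrow> 0"
  proof (rule Lim_null_comparison)
    show "\<forall>\<^sub>F m in sequentially. norm (smear (Suc m) n x - avg (a n) (bump (Suc n)) x)
        \<le> L * tail (Suc n + m)"
    proof (rule always_eventually, rule allI)
      fix m
      obtain y where "smear (Suc m) n x - avg (a n) (bump (Suc n)) x =
          smear m (Suc n) y - bump (Suc n) y"
        using avg_diff_mean_value[OF smear_cont[of m "Suc n"] bump_cont[of "Suc n"] a_pos[of n], of x] by auto
      then show "norm (smear (Suc m) n x - avg (a n) (bump (Suc n)) x) \<le> L * tail (Suc n + m)"
        using bump_approx[of "Suc n" y m] by (simp del: smear.simps add: abs_minus_commute)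
    qed
    show "(\<lambda>m. L * tail (Suc n + m)) \<longlonglongrightarrow> 0"
      by (rule tendsto_mult_right_zero tail_tendsto)+
  qed
  then have "(\<lambda>m. smear (Suc m) n x) \<longlonglongrightarrow> avg (a n) (bump (Suc n)) x"
    by (simp only: LIM_zero_iff)
  moreover have "(\<lambda>m. smear (Suc m) n x) \<longlonglongrightarrow> bump n x"
    by (rule LIMSEQ_Suc[OF bump_LIMSEQ])
  ultimately show "bump n x = avg (a n) (bump (Suc n)) x" by (blast intro: LIMSEQ_unique)
qed

lemma bump_deriv:
  "(bump n has_real_derivative (bump (Suc n) (x + a n) - bump (Suc n) (x - a n)) / (2 * a n)) (at x)"
  by (subst bump_avg) (rule avg_deriv[OF bump_cont a_pos])

abbreviation bumpC :: "nat \<Rightarrow> real \<Rightarrow> complex" where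
  "bumpC n \<equiv> \<lambda>x. of_real (bump n x)"

lemma bumpC_deriv:
  "(bumpC n has_vector_derivative
     (bumpC (Suc n) (x + a n) - bumpC (Suc n) (x - a n)) / of_real (2 * a n)) (at x)"
proof -
  have "((\<lambda>x. complex_of_real (bump n x)) has_vector_derivative
      of_real ((bump (Suc n) (x + a n) - bump (Suc n) (x - a n)) / (2 * a n))) (at x)"
    by (rule has_vector_derivative_of_real[OF bump_deriv])
  then show ?thesis by simp
qed

lemma suminf_nonneg: "0 \<le> suminf a"
  using a_pos by (intro suminf_nonneg summ less_imp_le)

lemma bump_fourier_bound: "norm (fourier (bumpC n) t) \<le> 2 * (R + suminf a)"
  using bump_range bump_supp suminf_nonneg R_nonneg by (intro fourier_bound) auto

lemma bumpC_cont: "continuous_on S (bumpC n)"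
  by (intro continuous_intros continuous_on_subset[OF bump_cont]) auto

lemma bumpC_shift_cont: "continuous_on S (\<lambda>x. bumpC n (x + c))"
  by (intro continuous_intros continuous_on_compose2[OF bump_cont]) auto

text \<open>Averaging over an interval of half-length \<open>a\<close> multiplies the transform by
  \<open>sin (2 * pi * a * t) / (2 * pi * a * t)\<close>. This appears here through integration by
  parts: the derivative of \<open>bump n\<close> is a difference of two translates of
  \<open>bump (Suc n)\<close>, whose transforms differ from that of \<open>bump (Suc n)\<close> by
  phases.\<close>

lemma bump_fourier_step:
  assumes "t \<noteq> 0"
  shows "norm (fourier (bumpC n) t) \<le> norm (fourier (bumpC (Suc n)) t) / (2 * pi * a n * \<bar>t\<bar>)"
proof -
  let ?A = "R + suminf a"
  define e where "e = (\<lambda>x::real. exp (- (2 * pi * \<i>) * complex_of_real (x * t)))"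
  define D where "D = (\<lambda>x. (bumpC (Suc n) (x + a n) - bumpC (Suc n) (x - a n)) / of_real (2 * a n))"
  have e': "(e has_vector_derivative (- (2 * pi * \<i> * t)) * e x) (at x)" for x
    unfolding e_def using exp_of_real_vector_derivative[of "- (2 * pi * \<i> * t)" x]
    by (simp add: mult_ac)
  have e_cont: "continuous_on S e" for S unfolding e_def by (intro continuous_intros)
  have D_cont: "continuous_on S D" for S
    unfolding D_def using bumpC_shift_cont[of S "Suc n" "a n"] bumpC_shift_cont[of S "Suc n" "- a n"] a_pos[of n]
    by (auto intro!: continuous_intros)
  have int: "integrable lborel (\<lambda>x. bumpC (Suc n) (x + c) * e x)" for c
  proof (rule integrable_compact_support)
    show "continuous_on UNIV (\<lambda>x. bumpC (Suc n) (x + c) * e x)"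
      by (intro continuous_on_mult bumpC_shift_cont e_cont)
    show "bumpC (Suc n) (x + c) * e x = 0" if "\<bar>x\<bar> \<ge> ?A + \<bar>c\<bar>" for x
      using that bump_supp[of "x + c" "Suc n"] by simp
  qed
  have int0: "integrable lborel (\<lambda>x. bumpC n x * e x)"
    by (rule integrable_compact_support[where B = ?A])
       (auto intro!: continuous_on_mult bumpC_cont e_cont simp: bump_supp)
  have De: "D x * e x = (bumpC (Suc n) (x + a n) * e x - bumpC (Suc n) (x + - a n) * e x) / of_real (2 * a n)" for x
    by (simp add: D_def algebra_simps diff_divide_distrib)
  have intD: "integrable lborel (\<lambda>x. D x * e x)"
    unfolding De using Bochner_Integration.integrable_diff[OF int[of "a n"] int[of "- a n"]] by simp
  have "0 = (\<integral>x. D x * e x + (- (2 * pi * \<i> * t)) * (bumpC n x * e x) \<partial>lborel)"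
  proof (rule integral_derivative_eq_0[where F = "\<lambda>x. bumpC n x * e x" and B = ?A, symmetric])
    fix x
    have "((\<lambda>x. bumpC n x * e x) has_vector_derivative
        bumpC n x * ((- (2 * pi * \<i> * t)) * e x) + D x * e x) (at x)"
      unfolding D_def by (rule has_vector_derivative_mult[OF bumpC_deriv e'])
    then show "((\<lambda>x. bumpC n x * e x) has_vector_derivative
        D x * e x + (- (2 * pi * \<i> * t)) * (bumpC n x * e x)) (at x)"
      by (simp add: algebra_simps)
  qed (use R_nonneg suminf_nonneg in \<open>auto intro!: continuous_intros D_cont e_cont continuous_on_subset[OF bump_cont] simp: bump_supp\<close>)
  also have "\<dots> = (\<integral>x. D x * e x \<partial>lborel) - 2 * pi * \<i> * t * (\<integral>x. bumpC n x * e x \<partial>lborel)"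
    by (subst Bochner_Integration.integral_add[OF intD]) (use int0 in auto)
  finally have "2 * pi * \<i> * t * fourier (bumpC n) t = (\<integral>x. D x * e x \<partial>lborel)"
    by (simp add: fourier_def e_def)
  also have "\<dots> = (fourier (\<lambda>x. bumpC (Suc n) (x + a n)) t - fourier (\<lambda>x. bumpC (Suc n) (x + - a n)) t) / of_real (2 * a n)"
    unfolding De using int[of "a n"] int[of "- a n"] by (simp add: fourier_def e_def)
  also have "\<dots> = (exp (2 * pi * \<i> * of_real (a n * t)) - exp (2 * pi * \<i> * of_real (- a n * t))) *
      fourier (bumpC (Suc n)) t / of_real (2 * a n)"
    unfolding fourier_translate[of "bumpC (Suc n)"] by (simp add: algebra_simps)
  finally have "norm (2 * pi * \<i> * t * fourier (bumpC n) t) =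
      norm (exp (2 * pi * \<i> * of_real (a n * t)) - exp (2 * pi * \<i> * of_real (- a n * t))) *
      norm (fourier (bumpC (Suc n)) t) / (2 * a n)"
    using a_pos[of n] by (simp add: norm_mult norm_divide)
  also have "\<dots> \<le> 2 * norm (fourier (bumpC (Suc n)) t) / (2 * a n)"
  proof (intro divide_right_mono mult_right_mono)
    show "norm (exp (2 * pi * \<i> * of_real (a n * t)) - exp (2 * pi * \<i> * of_real (- a n * t))) \<le> 2"
      by (rule order_trans[OF norm_triangle_ineq4]) simp
  qed (use a_pos[of n] in auto)
  finally show ?thesis using assms a_pos[of n] by (simp add: norm_mult field_simps)
qed

text \<open>The number \<open>N\<close> of exploited averages is free; it is chosen later in
  dependence on \<open>t\<close>.\<close>

lemma bump_fourier_prod: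
  assumes "t \<noteq> 0"
  shows "norm (fourier (bumpC n) t) \<le> 2 * (R + suminf a) * (\<Prod>i<N. 1 / (2 * pi * a (n + i) * \<bar>t\<bar>))"
proof (induction N arbitrary: n)
  case 0
  then show ?case using bump_fourier_bound by simp
next
  case (Suc N)
  have "norm (fourier (bumpC n) t) \<le> norm (fourier (bumpC (Suc n)) t) / (2 * pi * a n * \<bar>t\<bar>)"
    by (rule bump_fourier_step[OF assms])
  also have "\<dots> \<le> (2 * (R + suminf a) * (\<Prod>i<N. 1 / (2 * pi * a (Suc n + i) * \<bar>t\<bar>))) / (2 * pi * a n * \<bar>t\<bar>)"
    using a_pos[of n] by (intro divide_right_mono Suc.IH) auto
  also have "\<dots> = 2 * (R + suminf a) * (\<Prod>i<Suc N. 1 / (2 * pi * a (n + i) * \<bar>t\<bar>))"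
    by (subst prod.lessThan_Suc_shift) simp
  finally show ?case .
qed

text \<open>Each derivative moves the second argument up by one, because differentiating
  \<open>bump n\<close> leads to \<open>bump (Suc n)\<close>.\<close>

fun bump_derivs :: "nat \<Rightarrow> nat \<Rightarrow> real \<Rightarrow> complex" where
  "bump_derivs 0 n = bumpC n"
| "bump_derivs (Suc k) n = (\<lambda>x. (bump_derivs k (Suc n) (x + a n) - bump_derivs k (Suc n) (x - a n)) / of_real (2 * a n))"

lemma bump_derivs: "(bump_derivs k n has_vector_derivative bump_derivs (Suc k) n x) (at x)"
proof (induction k arbitrary: n x)
  case 0
  then show ?case using bumpC_deriv by simp
next
  case (Suc k)
  have *: "((\<lambda>x. bump_derivs k (Suc n) (x + c)) has_vector_derivative bump_derivs (Suc k) (Suc n) (x + c)) (at x)" for c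
    by (rule has_vector_derivative_shift[OF Suc.IH])
  have "((\<lambda>x. (bump_derivs k (Suc n) (x + a n) - bump_derivs k (Suc n) (x + - a n)) / of_real (2 * a n))
      has_vector_derivative (bump_derivs (Suc k) (Suc n) (x + a n) - bump_derivs (Suc k) (Suc n) (x + - a n)) / of_real (2 * a n)) (at x)"
    by (intro has_vector_derivative_divide has_vector_derivative_diff *)
  then show ?case by simp
qed

end

text \<open>Smoothness with an explicit sequence of derivatives, which spares the coinduction until
  \<open>smooth_alg_smooth_fun\<close>.\<close>

definition smooth1 :: "(real \<Rightarrow> complex) \<Rightarrow> bool" where
  "smooth1 v \<longleftrightarrow> (\<exists>F. F 0 = v \<and> (\<forall>n t. (F n has_vector_derivative F (Suc n) t) (at t)))"

lemma smooth1_continuous: "smooth1 v \<Longrightarrow> continuous_on S v"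
  unfolding smooth1_def
  by (metis continuous_at_imp_continuous_on has_vector_derivative_continuous)

lemma (in bump_seq) bump_smooth: "smooth1 (bumpC n)"
  unfolding smooth1_def by (rule exI[of _ "\<lambda>k. bump_derivs k n"]) (use bump_derivs in auto)

text \<open>Ingham's choice of averaging lengths is \<open>a n\<close> proportional to \<open>\<Theta> n / n\<close>: each of the first
  \<open>\<Theta> \<bar>t\<bar> * \<bar>t\<bar>\<close> averages then gains a factor \<open>1 / e\<close> in the Fourier transform at \<open>t\<close>. Starting the
  sequence at a late index makes the total averaging length, hence the error \<open>\<delta>\<close>, small. At
  \<open>n = 0\<close> the summand \<open>\<Theta> n / n\<close> is the junk value \<open>0\<close>.\<close>

lemma ingham_1d:
  fixes \<Theta> u :: "real \<Rightarrow> real"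
  assumes nonneg: "\<And>r. \<Theta> r \<ge> 0" and mono: "\<And>r s. 0 \<le> r \<Longrightarrow> r \<le> s \<Longrightarrow> \<Theta> s \<le> \<Theta> r"
    and lim: "(\<Theta> \<longlongrightarrow> 0) at_top" and sum: "summable (\<lambda>n. \<Theta> (real n) / real n)"
    and lip: "\<And>x y. \<bar>u x - u y\<bar> \<le> L * \<bar>x - y\<bar>" and L: "L \<ge> 0"
    and range_u: "\<And>x. u x \<in> {0..1}"
    and supp_u: "\<And>x. \<bar>x\<bar> \<ge> R \<Longrightarrow> u x = 0" and R: "R \<ge> 0" and \<delta>: "\<delta> > 0"
  obtains V :: "real \<Rightarrow> real" and C where
    "smooth1 (\<lambda>x. of_real (V x))" "\<And>x. V x \<in> {0..1}" "\<And>x. \<bar>V x - u x\<bar> \<le> \<delta>"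
    "\<And>x. \<bar>x\<bar> \<ge> R + \<delta> \<Longrightarrow> V x = 0" "C > 0"
    "\<And>t. norm (fourier (\<lambda>x. of_real (V x)) t) \<le> C * exp (- \<Theta> \<bar>t\<bar> * \<bar>t\<bar>)"
proof -
  \<comment> \<open>The factor \<open>exp 1 / (2 * pi)\<close> makes each exploited average gain at
    least \<open>1 / e\<close>. The summand \<open>1 / real n ^ 2\<close> keeps the lengths positive
    where \<open>\<Theta>\<close> vanishes.\<close>
  define \<alpha> where "\<alpha> n = exp 1 / (2 * pi) * (\<Theta> (real n) / real n + 1 / real n ^ 2)" for n
  have \<alpha>_summ: "summable \<alpha>"
    unfolding \<alpha>_def using inverse_power_summable[of 2, where 'a = real]
    by (intro summable_mult summable_add sum) (simp add: inverse_eq_divide)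
  have \<alpha>_pos: "\<alpha> n > 0" if "n \<ge> 1" for n
    using that nonneg[of n] unfolding \<alpha>_def by (intro mult_pos_pos add_nonneg_pos) auto
  \<comment> \<open>With denominator \<open>L + 1\<close> the total length and \<open>L\<close>
    times the total length are both at most \<open>\<delta>\<close>: the former bounds the growth of
    the support, the latter the distance to \<open>u\<close>.\<close>
  obtain N0 where N0: "\<And>n. n \<ge> N0 \<Longrightarrow> norm (\<Sum>i. \<alpha> (i + n)) < \<delta> / (L + 1)"
    using suminf_exist_split[OF _ \<alpha>_summ, of "\<delta> / (L + 1)"] \<delta> L by auto
  define n0 where "n0 = max 1 N0"
  define a where "a i = \<alpha> (i + n0)" for i
  interpret bump_seq a u L R
  proof
    show "summable a" unfolding a_def using \<alpha>_summ by (simp add: summable_ignore_initial_segment)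
  qed (use lip L range_u supp_u R \<alpha>_pos in \<open>auto simp: a_def n0_def\<close>)
  have "suminf a < \<delta> / (L + 1)" using N0[of n0] unfolding a_def[abs_def] by (simp add: n0_def)
  then have A1: "(L + 1) * suminf a \<le> \<delta>" using L by (simp add: field_simps)
  then have A2: "L * suminf a \<le> \<delta>" "suminf a \<le> \<delta>"
    using suminf_nonneg mult_nonneg_nonneg[OF L suminf_nonneg] unfolding distrib_right by linarith+
  \<comment> \<open>Beyond \<open>T\<close> we have
    \<open>\<Theta> \<bar>t\<bar> * \<bar>t\<bar> \<le> \<bar>t\<bar>\<close>. So an index
    \<open>k\<close> below this product is also below \<open>\<bar>t\<bar>\<close>, and monotonicity
    gives \<open>\<Theta> \<bar>t\<bar> \<le> \<Theta> k\<close>.\<close>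
  obtain T where T: "T > 0" "\<Theta> T \<le> 1"
  proof -
    have "eventually (\<lambda>r. \<Theta> r < 1 \<and> r > 0) at_top"
      using order_tendstoD(2)[OF lim, of 1] eventually_gt_at_top[of "0::real"] by (auto intro: eventually_conj)
    from eventually_happens[OF this] obtain T where "\<Theta> T < 1 \<and> T > 0" by auto
    then show ?thesis using that[of T] by auto
  qed
  define B where "B = 2 * (R + suminf a)"
  have B: "B \<ge> 0" using R suminf_nonneg by (simp add: B_def)
  \<comment> \<open>For \<open>\<bar>t\<bar> > T\<close>, \<open>exp (1 + real n0)\<close> pays for
    rounding \<open>w\<close> down to \<open>N'\<close> and for the \<open>n0\<close> skipped
    lengths. The other exponential treats \<open>\<bar>t\<bar> \<le> T\<close> by the trivial bound
    \<open>B\<close>, and \<open>+ 1\<close> makes \<open>C\<close> positive without a strict bound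
    on \<open>B\<close>.\<close>
  define C where "C = B * (exp (1 + real n0) + exp (\<Theta> 0 * T)) + 1"
  have "norm (fourier (bumpC 0) t) \<le> C * exp (- \<Theta> \<bar>t\<bar> * \<bar>t\<bar>)" for t
  proof (cases "\<bar>t\<bar> \<le> T")
    case True
    have "\<Theta> \<bar>t\<bar> * \<bar>t\<bar> \<le> \<Theta> 0 * T" using True nonneg mono[of 0 "\<bar>t\<bar>"] by (intro mult_mono) auto
    then have "1 \<le> exp (\<Theta> 0 * T) * exp (- \<Theta> \<bar>t\<bar> * \<bar>t\<bar>)" by (simp flip: exp_add)
    then have "B * 1 \<le> B * (exp (\<Theta> 0 * T) * exp (- \<Theta> \<bar>t\<bar> * \<bar>t\<bar>))" using B by (rule mult_left_mono)
    also have "\<dots> \<le> C * exp (- \<Theta> \<bar>t\<bar> * \<bar>t\<bar>)"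
      using B unfolding C_def mult.assoc[symmetric] by (intro mult_right_mono) (auto simp: distrib_left)
    finally show ?thesis using bump_fourier_bound[of 0 t] by (simp add: B_def)
  next
    case False
    define w where "w = \<Theta> \<bar>t\<bar> * \<bar>t\<bar>"
    define N' where "N' = nat \<lfloor>w\<rfloor>"
    have w0: "w \<ge> 0" using nonneg by (simp add: w_def)
    then have N': "real N' \<le> w" "w < real N' + 1" unfolding N'_def by linarith+
    have "\<Theta> \<bar>t\<bar> \<le> 1" using mono[of T "\<bar>t\<bar>"] T False by auto
    then have wt: "w \<le> \<bar>t\<bar>" unfolding w_def using mult_right_mono[of "\<Theta> \<bar>t\<bar>" 1 "\<bar>t\<bar>"] by simp
    have factor: "0 \<le> 1 / (2 * pi * a (0 + i) * \<bar>t\<bar>) \<and> 1 / (2 * pi * a (0 + i) * \<bar>t\<bar>) \<le> exp (-1)" if "i \<in> {..<N' - n0}" for i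
    proof
      define k where "k = i + n0"
      have k: "k \<ge> 1" "k \<le> N'" using that by (auto simp: k_def n0_def)
      have "real k \<le> w" using k N' by linarith
      also have "w \<le> \<Theta> k * \<bar>t\<bar>"
        unfolding w_def using \<open>real k \<le> w\<close> wt by (intro mult_right_mono mono) auto
      finally have "1 \<le> \<Theta> k / k * \<bar>t\<bar>" using k by (simp add: field_simps)
      also have "\<dots> \<le> (\<Theta> k / k + 1 / real k ^ 2) * \<bar>t\<bar>" by (intro mult_right_mono) auto
      finally have "exp 1 * 1 \<le> exp 1 * ((\<Theta> k / k + 1 / real k ^ 2) * \<bar>t\<bar>)" by (intro mult_left_mono) auto
      also have "\<dots> = 2 * pi * a (0 + i) * \<bar>t\<bar>" by (simp add: a_def \<alpha>_def k_def)
      finally have *: "exp 1 \<le> 2 * pi * a (0 + i) * \<bar>t\<bar>" by simp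
      have "1 / (2 * pi * a (0 + i) * \<bar>t\<bar>) \<le> 1 / exp 1"
        using * by (intro frac_le) auto
      then show "1 / (2 * pi * a (0 + i) * \<bar>t\<bar>) \<le> exp (-1)" by (simp add: exp_minus inverse_eq_divide)
      show "0 \<le> 1 / (2 * pi * a (0 + i) * \<bar>t\<bar>)" using a_pos[of "0 + i"] by auto
    qed
    have "t \<noteq> 0" using False T by auto
    then have "norm (fourier (bumpC 0) t) \<le> B * (\<Prod>i<N' - n0. 1 / (2 * pi * a (0 + i) * \<bar>t\<bar>))"
      unfolding B_def by (rule bump_fourier_prod)
    also have "\<dots> \<le> B * (\<Prod>i<N' - n0. exp (-1))"
      using B factor by (intro mult_left_mono prod_mono) auto
    also have "\<dots> = B * exp (- real (N' - n0))" by (simp flip: exp_of_nat_mult)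
    also have "\<dots> \<le> B * (exp (1 + real n0) * exp (- w))"
      using N' B by (intro mult_left_mono) (auto simp flip: exp_add)
    also have "\<dots> \<le> C * exp (- w)"
      using B unfolding C_def mult.assoc[symmetric] by (intro mult_right_mono) (auto simp: distrib_left)
    finally show ?thesis by (simp add: w_def)
  qed
  moreover have "C > 0" unfolding C_def using B by (intro add_nonneg_pos mult_nonneg_nonneg) auto
  moreover have "\<bar>bump 0 x - u x\<bar> \<le> \<delta>" for x using bump_close[of 0 x] A2 by linarith
  moreover have "bump 0 x = 0" if "\<bar>x\<bar> \<ge> R + \<delta>" for x using bump_supp[of x 0] A2 that by linarith
  ultimately show ?thesis using bump_smooth[of 0] bump_range[of 0] by (intro that[of "bump 0" C]) auto
qed

section \<open>Smooth functions of product form\<close>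

text \<open>This algebra is closed under directional derivatives, since the increment enters the
  derivative of \<open>u (x \<bullet> b)\<close> only as the constant \<open>h \<bullet> b\<close>.
  Membership in it is therefore an invariant for the coinductive \<open>smooth_fun\<close>.\<close>

inductive smooth_alg :: "('a::euclidean_space \<Rightarrow> complex) \<Rightarrow> bool" where
  const: "smooth_alg (\<lambda>x. c)"
| comp: "smooth1 u \<Longrightarrow> b \<in> Basis \<Longrightarrow> smooth_alg (\<lambda>x. u (x \<bullet> b))"
| add: "smooth_alg f \<Longrightarrow> smooth_alg g \<Longrightarrow> smooth_alg (\<lambda>x. f x + g x)"
| mult: "smooth_alg f \<Longrightarrow> smooth_alg g \<Longrightarrow> smooth_alg (\<lambda>x. f x * g x)"

lemma smooth1_deriv:
  assumes "smooth1 u"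
  obtains v where "smooth1 v" "\<And>t. (u has_vector_derivative v t) (at t)"
proof -
  obtain F where F: "F 0 = u" "\<And>n t. (F n has_vector_derivative F (Suc n) t) (at t)"
    using assms unfolding smooth1_def by blast
  have "smooth1 (F 1)"
    unfolding smooth1_def by (rule exI[of _ "\<lambda>n. F (Suc n)"]) (use F in auto)
  then show ?thesis using F(2)[of 0] F(1) by (intro that[of "F 1"]) auto
qed

lemma smooth_alg_derivative:
  fixes f :: "'a::euclidean_space \<Rightarrow> complex"
  assumes "smooth_alg f"
  shows "\<exists>D. (\<forall>x. (f has_derivative D x) (at x)) \<and> (\<forall>h. smooth_alg (\<lambda>x. D x h))"
  using assms
proof induction
  case (const c)
  show ?case by (rule exI[of _ "\<lambda>x h. 0"]) (auto intro: smooth_alg.const)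
next
  case (comp u b)
  then obtain v where v: "smooth1 v" "\<And>t. (u has_vector_derivative v t) (at t)"
    using smooth1_deriv by blast
  have "((\<lambda>x. u (x \<bullet> b)) has_derivative (\<lambda>h. of_real (h \<bullet> b) * v (x \<bullet> b))) (at x)" for x :: 'a
  proof -
    have "((\<lambda>x. x \<bullet> b) has_derivative (\<lambda>h. h \<bullet> b)) (at x)" by (auto intro!: derivative_eq_intros)
    from has_derivative_compose[OF this v(2)[unfolded has_vector_derivative_def]]
    show ?thesis by (simp add: scaleR_conv_of_real)
  qed
  then show ?case
    by (intro exI[of _ "\<lambda>x h. of_real (h \<bullet> b) * v (x \<bullet> b)"])
       (auto intro!: smooth_alg.intros v comp)
next
  case (add f g)
  then obtain D E where "\<And>x. (f has_derivative D x) (at x)" "\<And>h. smooth_alg (\<lambda>x. D x h)"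
    "\<And>x. (g has_derivative E x) (at x)" "\<And>h. smooth_alg (\<lambda>x. E x h)" by blast
  then show ?case
    by (intro exI[of _ "\<lambda>x h. D x h + E x h"])
       (auto intro!: derivative_intros smooth_alg.intros add)
next
  case (mult f g)
  then obtain D E where "\<And>x. (f has_derivative D x) (at x)" "\<And>h. smooth_alg (\<lambda>x. D x h)"
    "\<And>x. (g has_derivative E x) (at x)" "\<And>h. smooth_alg (\<lambda>x. E x h)" by blast
  then show ?case
    by (intro exI[of _ "\<lambda>x h. f x * E x h + D x h * g x"])
       (auto intro!: has_derivative_mult smooth_alg.intros mult)
qed

lemma smooth_alg_smooth_fun: "smooth_alg f \<Longrightarrow> smooth_fun f"
proof (coinduction arbitrary: f rule: smooth_fun.coinduct)
  case (smooth_fun f)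
  then obtain D where D: "\<And>x. (f has_derivative D x) (at x)" "\<And>h. smooth_alg (\<lambda>x. D x h)"
    using smooth_alg_derivative by blast
  have "frechet_derivative f (at x) = D x" for x
    using frechet_derivative_at[OF D(1)] by simp
  then show ?case using D by (auto simp: differentiable_def)
qed

lemma smooth_alg_prod:
  "finite S \<Longrightarrow> (\<And>b. b \<in> S \<Longrightarrow> smooth_alg (F b)) \<Longrightarrow> smooth_alg (\<lambda>x. \<Prod>b\<in>S. F b x)"
  by (induction S rule: finite_induct) (auto intro: smooth_alg.intros)

lemma test_function_tensor:
  fixes F :: "'a::euclidean_space \<Rightarrow> real \<Rightarrow> complex"
  assumes "smooth_alg (\<lambda>x::'a. \<Prod>b\<in>Basis. F b (x \<bullet> b))"
    and supp: "\<And>b t. b \<in> Basis \<Longrightarrow> \<bar>t\<bar> \<ge> B \<Longrightarrow> F b t = 0"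
  shows "test_function (\<lambda>x::'a. \<Prod>b\<in>Basis. F b (x \<bullet> b))"
  unfolding test_function_def
proof
  have "x \<in> cbox (\<Sum>b\<in>Basis. (-B) *\<^sub>R b) (\<Sum>b\<in>Basis. B *\<^sub>R b)"
    if "(\<Prod>b\<in>Basis. F b (x \<bullet> b)) \<noteq> 0" for x :: 'a
  proof -
    have *: "\<bar>x \<bullet> b\<bar> < B" if "b \<in> Basis" for b
      using supp[OF that, of "x \<bullet> b"] \<open>_ \<noteq> 0\<close> that by (force simp: not_le[symmetric])
    show ?thesis
      unfolding mem_box
    proof (intro ballI)
      fix i :: 'a assume "i \<in> Basis"
      then show "(\<Sum>b\<in>Basis. (-B) *\<^sub>R b) \<bullet> i \<le> x \<bullet> i \<and> x \<bullet> i \<le> (\<Sum>b\<in>Basis. B *\<^sub>R b) \<bullet> i"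
        unfolding inner_sum_left_Basis[OF \<open>i \<in> Basis\<close>] using *[of i] by auto
    qed
  qed
  then have "bounded {x::'a. (\<Prod>b\<in>Basis. F b (x \<bullet> b)) \<noteq> 0}"
    by (intro bounded_subset[OF bounded_cbox]) blast
  then show "compact (closure {x::'a. (\<Prod>b\<in>Basis. F b (x \<bullet> b)) \<noteq> 0})" by simp
qed (rule smooth_alg_smooth_fun[OF assms(1)])

section \<open>Tensor products of functions of one coordinate\<close>

lemma
  fixes F :: "'a::euclidean_space \<Rightarrow> real \<Rightarrow> 'b::{real_normed_field,banach,second_countable_topology}"
  assumes "\<And>b. b \<in> Basis \<Longrightarrow> integrable lborel (F b)"
  shows integrable_tensor: "integrable lborel (\<lambda>x::'a. \<Prod>b\<in>Basis. F b (x \<bullet> b))"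
    and integral_tensor: "integral\<^sup>L lborel (\<lambda>x::'a. \<Prod>b\<in>Basis. F b (x \<bullet> b)) = (\<Prod>b\<in>Basis. integral\<^sup>L lborel (F b))"
proof -
  interpret product_sigma_finite "\<lambda>_::'a. lborel :: real measure" ..
  have [measurable]: "b \<in> Basis \<Longrightarrow> F b \<in> borel_measurable borel" for b
    using borel_measurable_integrable[OF assms] by simp
  have [measurable]: "(\<lambda>x::'a. \<Prod>b\<in>Basis. F b (x \<bullet> b)) \<in> borel_measurable borel" by measurable
  have [measurable]: "(\<lambda>f. \<Sum>b\<in>Basis. f b *\<^sub>R b) \<in> (\<Pi>\<^sub>M b\<in>(Basis::'a set). lborel) \<rightarrow>\<^sub>M borel" by measurable
  have eq: "(\<Prod>b\<in>Basis. F b ((\<Sum>b\<in>Basis. f b *\<^sub>R b) \<bullet> b)) = (\<Prod>b\<in>Basis. F b (f b))" for f :: "'a \<Rightarrow> real"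
    by (intro prod.cong) auto
  show "integrable lborel (\<lambda>x::'a. \<Prod>b\<in>Basis. F b (x \<bullet> b))"
    by (subst lborel_eq, subst integrable_distr_eq) (auto simp: eq intro!: product_integrable_prod assms)
  show "integral\<^sup>L lborel (\<lambda>x::'a. \<Prod>b\<in>Basis. F b (x \<bullet> b)) = (\<Prod>b\<in>Basis. integral\<^sup>L lborel (F b))"
    by (subst lborel_eq, subst integral_distr) (auto simp: eq intro!: product_integral_prod assms)
qed

lemma integrable_fourier_integrand:
  fixes f :: "real \<Rightarrow> complex"
  assumes "integrable lborel f"
  shows "integrable lborel (\<lambda>x. f x * exp (- (2 * pi * \<i>) * complex_of_real (x * t)))"
proof (rule Bochner_Integration.integrable_bound[OF assms])
  have [measurable]: "f \<in> borel_measurable borel" using assms by auto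
  show "(\<lambda>x. f x * exp (- (2 * pi * \<i>) * complex_of_real (x * t))) \<in> borel_measurable lborel"
    by measurable
qed (auto simp: norm_mult)

lemma fourier_tensor:
  fixes F :: "'a::euclidean_space \<Rightarrow> real \<Rightarrow> complex"
  assumes "\<And>b. b \<in> Basis \<Longrightarrow> integrable lborel (F b)"
  shows "fourier (\<lambda>x::'a. \<Prod>b\<in>Basis. F b (x \<bullet> b)) \<xi> = (\<Prod>b\<in>Basis. fourier (F b) (\<xi> \<bullet> b))"
proof -
  have "fourier (\<lambda>x::'a. \<Prod>b\<in>Basis. F b (x \<bullet> b)) \<xi> =
      (\<integral>x. (\<Prod>b\<in>Basis. (\<lambda>t. F b t * exp (- (2 * pi * \<i>) * complex_of_real (t * (\<xi> \<bullet> b)))) (x \<bullet> b)) \<partial>lborel)"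
    unfolding fourier_def
  proof (rule Bochner_Integration.integral_cong[OF refl])
    fix x :: 'a
    have "exp (- (2 * pi * \<i>) * complex_of_real (x \<bullet> \<xi>)) =
        (\<Prod>b\<in>Basis. exp (- (2 * pi * \<i>) * complex_of_real ((x \<bullet> b) * (\<xi> \<bullet> b))))"
      by (subst euclidean_inner) (simp add: exp_sum[symmetric] sum_distrib_left sum_negf)
    then show "(\<Prod>b\<in>Basis. F b (x \<bullet> b)) * exp (- (2 * pi * \<i>) * complex_of_real (x \<bullet> \<xi>)) =
        (\<Prod>b\<in>Basis. F b (x \<bullet> b) * exp (- (2 * pi * \<i>) * complex_of_real ((x \<bullet> b) * (\<xi> \<bullet> b))))"
      by (simp add: prod.distrib)
  qed
  also have "\<dots> = (\<Prod>b\<in>Basis. fourier (F b) (\<xi> \<bullet> b))"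
    unfolding fourier_def inner_real_def
    by (rule integral_tensor[of "\<lambda>b t. F b t * exp (- (2 * pi * \<i>) * complex_of_real (t * (\<xi> \<bullet> b)))"])
       (rule integrable_fourier_integrand[OF assms])
  finally show ?thesis .
qed

lemma norm_le_coordinate:
  fixes \<xi> :: "'a::euclidean_space"
  obtains b where "b \<in> Basis" "norm \<xi> \<le> sqrt DIM('a) * \<bar>\<xi> \<bullet> b\<bar>"
proof -
  have "infnorm \<xi> \<in> (\<lambda>i. \<bar>\<xi> \<bullet> i\<bar>) ` Basis"
    unfolding infnorm_Max by (intro Max_in) auto
  then obtain b where "b \<in> Basis" "infnorm \<xi> = \<bar>\<xi> \<bullet> b\<bar>" by auto
  then show ?thesis using norm_le_infnorm[of \<xi>] that by auto
qed

text \<open>One coordinate suffices for the decay: some \<open>\<bar>\<xi> \<bullet> b\<bar>\<close>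
  is at least \<open>norm \<xi> / sqrt DIM('a)\<close>, and \<open>\<Theta>\<close> is no smaller
  there than at \<open>norm \<xi>\<close>. So the one-dimensional result is applied to
  \<open>\<Theta>\<close> multiplied by \<open>sqrt DIM('a)\<close>, and the other coordinates
  contribute only factors at most constant.\<close>

lemma ingham_tensor:
  fixes \<Theta> :: "real \<Rightarrow> real" and u :: "'a::euclidean_space \<Rightarrow> real \<Rightarrow> real"
  assumes nonneg: "\<And>r. \<Theta> r \<ge> 0" and mono: "\<And>r s. 0 \<le> r \<Longrightarrow> r \<le> s \<Longrightarrow> \<Theta> s \<le> \<Theta> r"
    and lim: "(\<Theta> \<longlongrightarrow> 0) at_top" and sum: "summable (\<lambda>n. \<Theta> (real n) / real n)"
    and lip: "\<And>b x y. \<bar>u b x - u b y\<bar> \<le> L * \<bar>x - y\<bar>" and L: "L \<ge> 0"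
    and range_u: "\<And>b x. u b x \<in> {0..1}"
    and supp_u: "\<And>b x. \<bar>x\<bar> \<ge> R \<Longrightarrow> u b x = 0" and R: "R \<ge> 0" and \<delta>: "\<delta> > 0"
  obtains V :: "'a \<Rightarrow> real \<Rightarrow> real" and C where
    "\<And>b. smooth1 (\<lambda>x. of_real (V b x))" "\<And>b x. V b x \<in> {0..1}" "\<And>b x. \<bar>V b x - u b x\<bar> \<le> \<delta>"
    "\<And>b x. \<bar>x\<bar> \<ge> R + \<delta> \<Longrightarrow> V b x = 0" "C > 0"
    "\<And>\<xi>. norm (\<Prod>b\<in>Basis. fourier (\<lambda>x. of_real (V b x)) (\<xi> \<bullet> b)) \<le> C * exp (- \<Theta> (norm \<xi>) * norm \<xi>)"
proof -
  define d where "d = sqrt (real DIM('a))"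
  have d: "d \<ge> 0" by (simp add: d_def)
  have "\<exists>V C. smooth1 (\<lambda>x. of_real (V x)) \<and> (\<forall>x. V x \<in> {0..1}) \<and> (\<forall>x. \<bar>V x - u b x\<bar> \<le> \<delta>) \<and>
      (\<forall>x. \<bar>x\<bar> \<ge> R + \<delta> \<longrightarrow> V x = 0) \<and> C > 0 \<and>
      (\<forall>t. norm (fourier (\<lambda>x. of_real (V x)) t) \<le> C * exp (- (d * \<Theta> \<bar>t\<bar>) * \<bar>t\<bar>))" for b
  proof (rule ingham_1d[of "\<lambda>r. d * \<Theta> r" "u b" L R \<delta>])
    show "((\<lambda>r. d * \<Theta> r) \<longlongrightarrow> 0) at_top" by (rule tendsto_mult_right_zero[OF lim])
    show "summable (\<lambda>n. d * \<Theta> (real n) / real n)" using summable_mult[OF sum, of d] by simp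
  qed (use assms d in \<open>auto intro!: mult_left_mono\<close>)
  then obtain V C where V: "\<And>b. smooth1 (\<lambda>x. of_real (V b x))" "\<And>b x. V b x \<in> {0..1}"
    "\<And>b x. \<bar>V b x - u b x\<bar> \<le> \<delta>" "\<And>b x. \<bar>x\<bar> \<ge> R + \<delta> \<Longrightarrow> V b x = 0" and C: "\<And>b. C b > 0"
    and F: "\<And>b t. norm (fourier (\<lambda>x. of_real (V b x)) t) \<le> C b * exp (- (d * \<Theta> \<bar>t\<bar>) * \<bar>t\<bar>)"
    by metis
  have "norm (\<Prod>b\<in>Basis. fourier (\<lambda>x. of_real (V b x)) (\<xi> \<bullet> b))
      \<le> (\<Prod>b\<in>Basis. C b) * exp (- \<Theta> (norm \<xi>) * norm \<xi>)" for \<xi> :: 'a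
  proof -
    obtain b where b: "b \<in> Basis" "norm \<xi> \<le> d * \<bar>\<xi> \<bullet> b\<bar>"
      unfolding d_def using norm_le_coordinate by blast
    define w where "w c = (d * \<Theta> \<bar>\<xi> \<bullet> c\<bar>) * \<bar>\<xi> \<bullet> c\<bar>" for c
    have "norm (\<Prod>b\<in>Basis. fourier (\<lambda>x. of_real (V b x)) (\<xi> \<bullet> b)) \<le> (\<Prod>b\<in>Basis. C b * exp (- w b))"
      unfolding prod_norm[symmetric] w_def using F by (intro prod_mono) auto
    also have "\<dots> = (\<Prod>b\<in>Basis. C b) * exp (- (\<Sum>b\<in>Basis. w b))"
      by (simp add: prod.distrib exp_sum[symmetric] sum_negf)
    also have "\<dots> \<le> (\<Prod>b\<in>Basis. C b) * exp (- \<Theta> (norm \<xi>) * norm \<xi>)"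
    proof (intro mult_left_mono prod_nonneg)
      have "\<Theta> (norm \<xi>) * norm \<xi> \<le> \<Theta> \<bar>\<xi> \<bullet> b\<bar> * (d * \<bar>\<xi> \<bullet> b\<bar>)"
        using b nonneg Basis_le_norm[OF b(1)] by (intro mult_mono mono) auto
      also have "\<dots> = w b" by (simp add: w_def)
      also have "\<dots> \<le> (\<Sum>b\<in>Basis. w b)"
        using b d nonneg by (intro member_le_sum) (auto simp: w_def)
      finally show "exp (- (\<Sum>b\<in>Basis. w b)) \<le> exp (- \<Theta> (norm \<xi>) * norm \<xi>)" by simp
    qed (use C in \<open>auto intro: less_imp_le\<close>)
    finally show ?thesis .
  qed
  moreover have "(\<Prod>b\<in>Basis. C b) > 0" using C by (intro prod_pos) auto
  ultimately show ?thesis using V by (intro that[of V]) auto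
qed

section \<open>The dyadic form of the integral condition\<close>

lemma poly_exp_decay:
  fixes m :: nat
  obtains K where "K > 0" "\<And>r. r \<ge> 0 \<Longrightarrow> (1 + r) ^ m * exp (- (r / sqrt (1 + r))) \<le> K"
proof -
  have "((\<lambda>r::real. (1 + r) ^ m * exp (- (r / sqrt (1 + r)))) \<longlongrightarrow> 0) at_top"
    by real_asymp
  then have "eventually (\<lambda>r::real. (1 + r) ^ m * exp (- (r / sqrt (1 + r))) < 1) at_top"
    by (rule order_tendstoD) simp
  then obtain S :: real where S: "\<And>r. r \<ge> S \<Longrightarrow> (1 + r) ^ m * exp (- (r / sqrt (1 + r))) < 1"
    by (auto simp: eventually_at_top_linorder)
  show ?thesis
  proof (rule that[of "(1 + \<bar>S\<bar>) ^ m + 1"])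
    fix r :: real assume r: "r \<ge> 0"
    show "(1 + r) ^ m * exp (- (r / sqrt (1 + r))) \<le> (1 + \<bar>S\<bar>) ^ m + 1"
    proof (cases "r \<ge> S")
      case True
      then show ?thesis using S[of r] zero_le_power[of "1 + \<bar>S\<bar>" m] by linarith
    next
      case False
      have "(1 + r) ^ m * exp (- (r / sqrt (1 + r))) \<le> (1 + \<bar>S\<bar>) ^ m * 1"
        using False r by (intro mult_mono power_mono) auto
      then show ?thesis by simp
    qed
  qed (auto intro!: add_nonneg_pos)
qed

lemma integrable_inverse_quadratic: "integrable lborel (\<lambda>x::real. 1 / (1 + x\<^sup>2))"
  using integrable_inverse_1_plus_square by (simp add: set_integrable_def inverse_eq_divide)

text \<open>This product serves as the integrable majorant in every dimension: it factorises over
  the coordinates, so no polar coordinates are needed.\<close>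

lemma integrable_inverse_quadratic_tensor:
  "integrable lborel (\<lambda>x::'a::euclidean_space. \<Prod>b\<in>Basis. 1 / (1 + (x \<bullet> b)\<^sup>2))"
  by (rule integrable_tensor) (rule integrable_inverse_quadratic)

lemma prod_quadratic_le:
  fixes x :: "'a::euclidean_space"
  shows "(\<Prod>b\<in>Basis. 1 + (x \<bullet> b)\<^sup>2) \<le> (1 + norm x) ^ (2 * DIM('a))"
proof -
  have "(\<Prod>b\<in>Basis. 1 + (x \<bullet> b)\<^sup>2) \<le> (\<Prod>b\<in>(Basis::'a set). (1 + norm x)\<^sup>2)"
  proof (rule prod_mono)
    fix b :: 'a assume "b \<in> Basis"
    then have "\<bar>x \<bullet> b\<bar>\<^sup>2 \<le> (norm x)\<^sup>2" by (intro power_mono Basis_le_norm) auto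
    moreover have "1 + (norm x)\<^sup>2 \<le> (1 + norm x)\<^sup>2" by (simp add: power2_sum)
    ultimately show "0 \<le> 1 + (x \<bullet> b)\<^sup>2 \<and> 1 + (x \<bullet> b)\<^sup>2 \<le> (1 + norm x)\<^sup>2" by auto
  qed
  then show ?thesis by (simp add: power_mult)
qed

lemma decay_integrable_tensor:
  obtains K where "K > 0" "\<And>x::'a::euclidean_space. exp (- (norm x / sqrt (1 + norm x))) \<le> K * (\<Prod>b\<in>Basis. 1 / (1 + (x \<bullet> b)\<^sup>2))"
proof -
  obtain K where K: "K > 0" "\<And>r. r \<ge> 0 \<Longrightarrow> (1 + r) ^ (2 * DIM('a)) * exp (- (r / sqrt (1 + r))) \<le> K"
    using poly_exp_decay by blast
  show ?thesis
  proof (rule that[OF K(1)])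
    fix x :: 'a
    let ?p = "\<Prod>b\<in>Basis. 1 + (x \<bullet> b)\<^sup>2"
    have p: "?p > 0" by (intro prod_pos ballI add_pos_nonneg) auto
    have "?p * exp (- (norm x / sqrt (1 + norm x))) \<le> (1 + norm x) ^ (2 * DIM('a)) * exp (- (norm x / sqrt (1 + norm x)))"
      by (intro mult_right_mono prod_quadratic_le) auto
    also have "\<dots> \<le> K" by (rule K) simp
    finally have "exp (- (norm x / sqrt (1 + norm x))) \<le> K / ?p" using p by (simp add: field_simps)
    then show "exp (- (norm x / sqrt (1 + norm x))) \<le> K * (\<Prod>b\<in>Basis. 1 / (1 + (x \<bullet> b)\<^sup>2))"
      by (simp add: prod_dividef)
  qed
qed

lemma set_nn_integral_const_mono:
  assumes "A \<in> sets M" "\<And>x. x \<in> A \<Longrightarrow> ennreal c \<le> f x"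
  shows "ennreal c * emeasure M A \<le> (\<integral>\<^sup>+x\<in>A. f x \<partial>M)"
proof -
  have "ennreal c * emeasure M A = (\<integral>\<^sup>+x\<in>A. ennreal c \<partial>M)"
    using assms(1) by (simp add: nn_integral_cmult_indicator)
  also have "\<dots> \<le> (\<integral>\<^sup>+x\<in>A. f x \<partial>M)"
    by (intro nn_integral_mono) (auto simp: assms indicator_def)
  finally show ?thesis .
qed

lemma set_nn_integral_le_const:
  assumes "A \<in> sets M" "\<And>x. x \<in> A \<Longrightarrow> f x \<le> ennreal c"
  shows "(\<integral>\<^sup>+x\<in>A. f x \<partial>M) \<le> ennreal c * emeasure M A"
proof -
  have "(\<integral>\<^sup>+x\<in>A. f x \<partial>M) \<le> (\<integral>\<^sup>+x\<in>A. ennreal c \<partial>M)"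
    by (intro nn_integral_mono) (auto simp: assms indicator_def)
  also have "\<dots> = ennreal c * emeasure M A"
    using assms(1) by (simp add: nn_integral_cmult_indicator)
  finally show ?thesis .
qed

lemma emeasure_annulus:
  fixes k :: nat
  shows "emeasure lborel {\<xi>::'a::euclidean_space. 2 ^ k \<le> norm \<xi> \<and> norm \<xi> < 2 ^ Suc k}
    = ennreal (unit_ball_vol DIM('a) * (2 ^ DIM('a) - 1) * (2 ^ k) ^ DIM('a))"
proof -
  have "{\<xi>::'a. 2 ^ k \<le> norm \<xi> \<and> norm \<xi> < 2 ^ Suc k} = ball 0 (2 ^ Suc k) - ball 0 (2 ^ k)"
    by auto
  also have "emeasure lborel \<dots> = emeasure lborel (ball (0::'a) (2 ^ Suc k)) - emeasure lborel (ball (0::'a) (2 ^ k))"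
    by (rule emeasure_Diff) (auto simp: emeasure_ball intro!: subset_ball)
  also have "\<dots> = ennreal (unit_ball_vol DIM('a) * (2 ^ Suc k) ^ DIM('a) - unit_ball_vol DIM('a) * (2 ^ k) ^ DIM('a))"
    by (simp add: emeasure_ball ennreal_minus del: power_Suc)
  also have "unit_ball_vol DIM('a) * (2 ^ Suc k) ^ DIM('a) - unit_ball_vol DIM('a) * (2 ^ k) ^ DIM('a)
      = unit_ball_vol DIM('a) * (2 ^ DIM('a) - 1) * (2 ^ k) ^ DIM('a)"
    by (simp add: algebra_simps power_mult_distrib)
  finally show ?thesis .
qed

text \<open>The annulus between radii \<open>2 ^ k\<close> and \<open>2 ^ Suc k\<close> has volume
  proportional to \<open>(2 ^ k) ^ DIM('a)\<close>, which cancels the denominator up to a factor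
  \<open>2 ^ DIM('a)\<close>. By monotonicity it contributes at most a constant times
  \<open>\<Theta> (2 ^ k)\<close> and at least a constant times
  \<open>\<Theta> (2 ^ Suc k)\<close>.\<close>

lemma dyadic_integral_test:
  fixes \<theta> :: "'a::euclidean_space \<Rightarrow> real" and \<Theta> :: "real \<Rightarrow> real"
  assumes meas: "\<theta> \<in> borel_measurable lborel"
    and eq: "\<And>\<xi>. \<theta> \<xi> = \<Theta> (norm \<xi>)" and nonneg: "\<And>r. \<Theta> r \<ge> 0"
    and mono: "\<And>r s. 0 \<le> r \<Longrightarrow> r \<le> s \<Longrightarrow> \<Theta> s \<le> \<Theta> r"
  shows "(\<integral>\<^sup>+\<xi>\<in>{\<xi>. norm \<xi> \<ge> 1}. ennreal (\<theta> \<xi> / norm \<xi> ^ DIM('a)) \<partial>lborel) < \<infinity>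
    \<longleftrightarrow> summable (\<lambda>k. \<Theta> (2 ^ k))"
proof -
  define f where "f \<xi> = ennreal (\<theta> \<xi> / norm \<xi> ^ DIM('a))" for \<xi> :: 'a
  define A where "A k = {\<xi>::'a. 2 ^ k \<le> norm \<xi> \<and> norm \<xi> < 2 ^ Suc k}" for k :: nat
  define c where "c = unit_ball_vol (real DIM('a)) * (2 ^ DIM('a) - 1)"
  have c: "c > 0" unfolding c_def by (intro mult_pos_pos) auto
  have A_sets[measurable]: "A k \<in> sets lborel" for k unfolding A_def by measurable
  have f_meas[measurable]: "f \<in> borel_measurable lborel" using meas unfolding f_def by measurable
  have "\<xi> \<in> (\<Union>k. A k)" if "norm \<xi> \<ge> 1" for \<xi>
  proof -
    obtain n where "norm \<xi> < 2 ^ n" using real_arch_pow[of 2 "norm \<xi>"] by auto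
    define k where "k = (LEAST n. norm \<xi> < 2 ^ n)"
    have k: "norm \<xi> < 2 ^ k" unfolding k_def by (rule LeastI) fact
    have "k \<noteq> 0"
    proof
      assume "k = 0"
      with k that show False by simp
    qed
    then obtain j where j: "k = Suc j" by (cases k) auto
    have "\<not> norm \<xi> < 2 ^ j" using j not_less_Least[of j "\<lambda>n. norm \<xi> < 2 ^ n"] by (simp add: k_def)
    then have "\<xi> \<in> A j" using k j by (simp add: A_def)
    then show ?thesis by blast
  qed
  moreover have "norm \<xi> \<ge> 1" if "\<xi> \<in> A k" for \<xi> k
  proof -
    have "1 \<le> (2::real) ^ k" by simp
    also have "\<dots> \<le> norm \<xi>" using that by (simp add: A_def)
    finally show ?thesis .
  qed
  ultimately have U: "{\<xi>::'a. norm \<xi> \<ge> 1} = (\<Union>k. A k)" by blast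
  have "A i \<inter> A j = {}" if "i < j" for i j
  proof -
    have *: "(2::real) ^ Suc i \<le> 2 ^ j" using that by (intro power_increasing) auto
    have False if "x \<in> A i" "x \<in> A j" for x
    proof -
      have "norm x < 2 ^ Suc i" "2 ^ j \<le> norm x" using that by (auto simp: A_def)
      with * show False by linarith
    qed
    then show ?thesis by blast
  qed
  then have disj: "disjoint_family A"
    unfolding disjoint_family_on_def by (metis inf_commute linorder_neqE_nat)
  have I: "(\<integral>\<^sup>+\<xi>\<in>{\<xi>. norm \<xi> \<ge> 1}. f \<xi> \<partial>lborel) = (\<Sum>k. \<integral>\<^sup>+\<xi>\<in>A k. f \<xi> \<partial>lborel)"
    unfolding U by (rule nn_integral_disjoint_family[OF f_meas A_sets disj])
  have emA: "emeasure lborel (A k) = ennreal (c * (2 ^ k) ^ DIM('a))" for k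
    unfolding A_def c_def by (rule emeasure_annulus)
  have lower: "ennreal (c / 2 ^ DIM('a) * \<Theta> (2 ^ Suc k)) \<le> (\<integral>\<^sup>+\<xi>\<in>A k. f \<xi> \<partial>lborel)" for k
  proof -
    have "ennreal (c / 2 ^ DIM('a) * \<Theta> (2 ^ Suc k)) = ennreal (\<Theta> (2 ^ Suc k) / (2 ^ Suc k) ^ DIM('a)) * emeasure lborel (A k)"
      using c nonneg by (simp add: emA power_mult_distrib flip: ennreal_mult)
    also have "\<dots> \<le> (\<integral>\<^sup>+\<xi>\<in>A k. f \<xi> \<partial>lborel)"
    proof (rule set_nn_integral_const_mono)
      fix \<xi> assume *: "\<xi> \<in> A k"
      then have "0 < norm \<xi>" unfolding A_def using less_le_trans[of 0 "2 ^ k" "norm \<xi>"] by auto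
      then show "ennreal (\<Theta> (2 ^ Suc k) / (2 ^ Suc k) ^ DIM('a)) \<le> f \<xi>"
        unfolding f_def eq using * nonneg by (intro ennreal_leI frac_le mono power_mono) (auto simp: A_def)
    qed (rule A_sets)
    finally show ?thesis .
  qed
  have upper: "(\<integral>\<^sup>+\<xi>\<in>A k. f \<xi> \<partial>lborel) \<le> ennreal (c * \<Theta> (2 ^ k))" for k
  proof -
    have "(\<integral>\<^sup>+\<xi>\<in>A k. f \<xi> \<partial>lborel) \<le> ennreal (\<Theta> (2 ^ k) / (2 ^ k) ^ DIM('a)) * emeasure lborel (A k)"
    proof (rule set_nn_integral_le_const)
      fix \<xi> assume *: "\<xi> \<in> A k"
      then show "f \<xi> \<le> ennreal (\<Theta> (2 ^ k) / (2 ^ k) ^ DIM('a))"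
        unfolding f_def eq using * nonneg by (intro ennreal_leI frac_le mono power_mono) (auto simp: A_def)
    qed (rule A_sets)
    also have "\<dots> = ennreal (c * \<Theta> (2 ^ k))"
      using c nonneg by (simp add: emA flip: ennreal_mult)
    finally show ?thesis .
  qed
  show ?thesis
    unfolding f_def[symmetric] I
  proof
    assume *: "(\<Sum>k. \<integral>\<^sup>+\<xi>\<in>A k. f \<xi> \<partial>lborel) < \<infinity>"
    have "(\<Sum>k. ennreal (c / 2 ^ DIM('a) * \<Theta> (2 ^ Suc k))) \<le> (\<Sum>k. \<integral>\<^sup>+\<xi>\<in>A k. f \<xi> \<partial>lborel)"
      by (intro suminf_le lower) auto
    with * have "(\<Sum>k. ennreal (c / 2 ^ DIM('a) * \<Theta> (2 ^ Suc k))) \<noteq> top"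
      by (auto simp: top_unique)
    then have "summable (\<lambda>k. c / 2 ^ DIM('a) * \<Theta> (2 ^ Suc k))"
      using c nonneg by (intro summable_suminf_not_top) auto
    then have "summable (\<lambda>k. \<Theta> (2 ^ Suc k))"
      using c by (subst (asm) summable_cmult_iff) auto
    then show "summable (\<lambda>k. \<Theta> (2 ^ k))" by (rule summable_Suc_iff[THEN iffD1])
  next
    assume "summable (\<lambda>k. \<Theta> (2 ^ k))"
    then have s: "summable (\<lambda>k. c * \<Theta> (2 ^ k))" by (rule summable_mult)
    have "(\<Sum>k. \<integral>\<^sup>+\<xi>\<in>A k. f \<xi> \<partial>lborel) \<le> (\<Sum>k. ennreal (c * \<Theta> (2 ^ k)))"
      by (intro suminf_le upper) auto
    also have "\<dots> = ennreal (\<Sum>k. c * \<Theta> (2 ^ k))"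
      using c nonneg s by (intro suminf_ennreal2) auto
    also have "\<dots> < \<infinity>" by simp
    finally show "(\<Sum>k. \<integral>\<^sup>+\<xi>\<in>A k. f \<xi> \<partial>lborel) < \<infinity>" .
  qed
qed

section \<open>Functions with prescribed Fourier decay\<close>

text \<open>An admissible rate beyond every polynomial: \<open>exp (- slow r * r)\<close> decays roughly like
  \<open>exp (- sqrt r)\<close>.\<close>

definition slow :: "real \<Rightarrow> real" where
  "slow r = 1 / sqrt (1 + \<bar>r\<bar>)"

lemma slow_pos: "slow r > 0"
  by (simp add: slow_def)

lemma slow_mono: "0 \<le> r \<Longrightarrow> r \<le> s \<Longrightarrow> slow s \<le> slow r"
  unfolding slow_def by (intro frac_le) auto

lemma slow_tendsto: "(slow \<longlongrightarrow> 0) at_top"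
  unfolding slow_def by real_asymp

lemma slow_summable: "summable (\<lambda>n. slow (real n) / real n)"
proof (rule summable_comparison_test)
  show "summable (\<lambda>n. real n powr (-3/2))" by (simp add: summable_real_powr_iff)
  have "norm (slow (real n) / real n) \<le> real n powr (-3/2)" if "n \<ge> 1" for n
  proof -
    have n: "real n > 0" using that by simp
    have "sqrt (real n) * real n \<le> sqrt (1 + real n) * real n" by (intro mult_right_mono) auto
    then have "1 / (sqrt (1 + real n) * real n) \<le> 1 / (sqrt (real n) * real n)"
      using n by (intro divide_left_mono) auto
    also have "sqrt (real n) * real n = real n powr (1/2) * real n powr 1" using n by (simp add: powr_half_sqrt)
    also have "\<dots> = real n powr (3/2)" by (subst powr_add[symmetric]) simp
    also have "1 / \<dots> = real n powr (-3/2)" by (simp add: powr_minus_divide[symmetric])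
    finally show ?thesis by (simp add: slow_def mult.commute)
  qed
  then show "\<exists>N. \<forall>n\<ge>N. norm (slow (real n) / real n) \<le> real n powr (-3/2)" by blast
qed

lemma slow_mult: "r \<ge> 0 \<Longrightarrow> slow r * r = r / sqrt (1 + r)"
  by (simp add: slow_def)

lemma integrable_smooth1_compact_support:
  fixes V :: "real \<Rightarrow> real"
  assumes "smooth1 (\<lambda>x. of_real (V x))" "\<And>x. \<bar>x\<bar> \<ge> R \<Longrightarrow> V x = 0"
  shows "integrable lborel (\<lambda>x. complex_of_real (V x))"
  using assms by (intro integrable_compact_support smooth1_continuous) auto

text \<open>Running the construction for \<open>\<Theta> + slow\<close> leaves a spare factor
  \<open>exp (- (norm \<xi> / sqrt (1 + norm \<xi>)))\<close>. It makes one and the same function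
  serve all exponents \<open>q\<close> and all \<open>N\<close>.\<close>

theorem ingham_existence:
  fixes \<theta> :: "'a::euclidean_space \<Rightarrow> real" and \<Theta> :: "real \<Rightarrow> real"
  assumes eq: "\<And>\<xi>. \<theta> \<xi> = \<Theta> (norm \<xi>)" and nonneg: "\<And>r. \<Theta> r \<ge> 0"
    and mono: "\<And>r s. 0 \<le> r \<Longrightarrow> r \<le> s \<Longrightarrow> \<Theta> s \<le> \<Theta> r"
    and lim: "(\<Theta> \<longlongrightarrow> 0) at_top" and summ: "summable (\<lambda>k. \<Theta> (2 ^ k))"
  obtains f :: "'a \<Rightarrow> complex" and C where "test_function f" "f 0 \<noteq> 0" "C > 0"
    "\<And>\<xi>. norm (fourier f \<xi>) \<le> C * exp (- \<theta> \<xi> * norm \<xi>) * exp (- (norm \<xi> / sqrt (1 + norm \<xi>)))"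
proof -
  \<comment> \<open>Cauchy condensation passes between the dyadic series and the series of
    \<open>\<Theta> n / n\<close> that governs the averaging lengths.\<close>
  have "summable (\<lambda>n. 2 ^ n * (\<Theta> (real (2 ^ n)) / real (2 ^ n)))" using summ by simp
  then have s1: "summable (\<lambda>n. \<Theta> (real n) / real n)"
    using mono nonneg by (subst condensation_test) (auto intro!: frac_le)
  define \<Psi> where "\<Psi> r = \<Theta> r + slow r" for r
  obtain V :: "'a \<Rightarrow> real \<Rightarrow> real" and C where V: "\<And>b. smooth1 (\<lambda>x. of_real (V b x))"
    "\<And>b x. V b x \<in> {0..1}" "\<And>b x. \<bar>V b x - max 0 (1 - \<bar>x\<bar>)\<bar> \<le> 1 / 2"
    "\<And>b x. \<bar>x\<bar> \<ge> 1 + 1 / 2 \<Longrightarrow> V b x = 0" "C > 0"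
    "\<And>\<xi>. norm (\<Prod>b\<in>Basis. fourier (\<lambda>x. of_real (V b x)) (\<xi> \<bullet> b)) \<le> C * exp (- \<Psi> (norm \<xi>) * norm \<xi>)"
  \<comment> \<open>The tent function has value 1 at the origin, so an error of \<open>1/2\<close>
    cannot make \<open>V b 0\<close> vanish.\<close>
  proof (rule ingham_tensor[where \<Theta> = \<Psi> and u = "\<lambda>b x. max 0 (1 - \<bar>x\<bar>)" and L = 1 and R = 1 and \<delta> = "1/2"])
    show "summable (\<lambda>n. \<Psi> (real n) / real n)"
      using summable_add[OF s1 slow_summable] by (simp add: \<Psi>_def add_divide_distrib)
    show "(\<Psi> \<longlongrightarrow> 0) at_top" unfolding \<Psi>_def by (rule tendsto_add_zero[OF lim slow_tendsto])
    show "\<Psi> s \<le> \<Psi> r" if "0 \<le> r" "r \<le> s" for r s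
      unfolding \<Psi>_def using that by (intro add_mono mono slow_mono)
    show "0 \<le> \<Psi> r" for r using nonneg[of r] slow_pos[of r] by (simp add: \<Psi>_def)
  qed auto
  have int: "integrable lborel (\<lambda>x. complex_of_real (V b x))" for b
    by (rule integrable_smooth1_compact_support[OF V(1) V(4)])
  let ?f = "\<lambda>x::'a. \<Prod>b\<in>Basis. complex_of_real (V b (x \<bullet> b))"
  have "test_function ?f"
    by (rule test_function_tensor[where B = "1 + 1 / 2" and F = "\<lambda>b t. complex_of_real (V b t)"])
       (auto intro!: smooth_alg_prod smooth_alg.comp[where u = "\<lambda>t. complex_of_real (V b t)" for b] V(1) simp: V(4))
  moreover have "V b 0 \<noteq> 0" for b using V(3)[of b 0] by auto
  then have "?f 0 \<noteq> 0" by simp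
  moreover have "norm (fourier ?f \<xi>) \<le> C * exp (- \<theta> \<xi> * norm \<xi>) * exp (- (norm \<xi> / sqrt (1 + norm \<xi>)))" for \<xi>
  proof -
    have "fourier ?f \<xi> = (\<Prod>b\<in>Basis. fourier (\<lambda>x. of_real (V b x)) (\<xi> \<bullet> b))"
      by (rule fourier_tensor[of "\<lambda>b x. of_real (V b x)"]) (rule int)
    then have "norm (fourier ?f \<xi>) \<le> C * exp (- \<Psi> (norm \<xi>) * norm \<xi>)" using V(6)[of \<xi>] by simp
    also have "- \<Psi> (norm \<xi>) * norm \<xi> = - \<theta> \<xi> * norm \<xi> + - (norm \<xi> / sqrt (1 + norm \<xi>))"
      using slow_mult[of "norm \<xi>"] by (simp add: \<Psi>_def eq algebra_simps)
    finally show ?thesis by (simp add: mult.assoc flip: exp_add)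
  qed
  ultimately show ?thesis using V(5) that by blast
qed

lemma ingham_weight_finite:
  fixes F :: "'a::euclidean_space \<Rightarrow> complex"
  assumes C: "C > 0" and q: "q \<ge> 1" and N: "N \<ge> 0"
    and F: "\<And>\<xi>. norm (F \<xi>) \<le> C * exp (- \<theta> \<xi> * norm \<xi>) * exp (- (norm \<xi> / sqrt (1 + norm \<xi>)))"
  shows "(\<integral>\<^sup>+\<xi>. ennreal (norm (F \<xi>) powr q * exp (q * \<theta> \<xi> * norm \<xi>) / (1 + norm \<xi>) powr N) \<partial>lborel) < \<infinity>"
proof -
  obtain K where K: "K > 0"
    "\<And>x::'a. exp (- (norm x / sqrt (1 + norm x))) \<le> K * (\<Prod>b\<in>Basis. 1 / (1 + (x \<bullet> b)\<^sup>2))"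
    using decay_integrable_tensor by blast
  let ?g = "\<lambda>\<xi>::'a. C powr q * (K * (\<Prod>b\<in>Basis. 1 / (1 + (\<xi> \<bullet> b)\<^sup>2)))"
  have "norm (F \<xi>) powr q * exp (q * \<theta> \<xi> * norm \<xi>) / (1 + norm \<xi>) powr N \<le> ?g \<xi>" for \<xi>
  proof -
    let ?s = "norm \<xi> / sqrt (1 + norm \<xi>)"
    have s: "?s \<ge> 0" by simp
    have "norm (F \<xi>) powr q \<le> (C * exp (- \<theta> \<xi> * norm \<xi>) * exp (- ?s)) powr q"
      using q F[of \<xi>] by (intro powr_mono2) auto
    also have "\<dots> = C powr q * exp (- (q * \<theta> \<xi> * norm \<xi>)) * exp (- (q * ?s))"
      using C by (simp add: powr_mult exp_powr_real mult_ac)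
    finally have "norm (F \<xi>) powr q * exp (q * \<theta> \<xi> * norm \<xi>) \<le>
        C powr q * exp (- (q * \<theta> \<xi> * norm \<xi>)) * exp (- (q * ?s)) * exp (q * \<theta> \<xi> * norm \<xi>)"
      by (rule mult_right_mono) simp
    also have "\<dots> = C powr q * exp (- (q * ?s))" by (simp add: exp_minus)
    also have "\<dots> \<le> C powr q * exp (- ?s)"
      using mult_right_mono[OF q s] by (intro mult_left_mono) auto
    also have "\<dots> \<le> ?g \<xi>" by (intro mult_left_mono K) auto
    finally have *: "norm (F \<xi>) powr q * exp (q * \<theta> \<xi> * norm \<xi>) \<le> ?g \<xi>" .
    have "(1 + norm \<xi>) powr N \<ge> 1" using N by (intro ge_one_powr_ge_zero) auto
    then have "norm (F \<xi>) powr q * exp (q * \<theta> \<xi> * norm \<xi>) / (1 + norm \<xi>) powr N \<le> norm (F \<xi>) powr q * exp (q * \<theta> \<xi> * norm \<xi>) / 1"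
      by (intro divide_left_mono) auto
    with * show ?thesis by linarith
  qed
  then have "(\<integral>\<^sup>+\<xi>. ennreal (norm (F \<xi>) powr q * exp (q * \<theta> \<xi> * norm \<xi>) / (1 + norm \<xi>) powr N) \<partial>lborel)
      \<le> (\<integral>\<^sup>+\<xi>. ennreal (?g \<xi>) \<partial>lborel)"
    by (intro nn_integral_mono ennreal_leI)
  also have "\<dots> < \<infinity>"
  proof -
    have "integrable lborel ?g" by (intro integrable_mult_right integrable_inverse_quadratic_tensor)
    moreover have "?g \<xi> \<ge> 0" for \<xi>
      using K(1) by (intro mult_nonneg_nonneg prod_nonneg) auto
    ultimately have "(\<integral>\<^sup>+\<xi>. ennreal (?g \<xi>) \<partial>lborel) = ennreal (integral\<^sup>L lborel ?g)"
      by (intro nn_integral_eq_integral) auto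
    then show ?thesis by simp
  qed
  finally show ?thesis .
qed

section \<open>Fourier inversion and the convolution formula\<close>

lemma integral_std_normal_exp:
  "(\<integral>x. of_real (std_normal_density x) * exp (\<i> * of_real (t * x)) \<partial>lborel) = of_real (exp (- t\<^sup>2 / 2))"
proof -
  have "char std_normal_distribution t = (\<integral>x. std_normal_density x *\<^sub>R exp (\<i> * of_real (t * x)) \<partial>lborel)"
    unfolding char_def by (subst integral_density) auto
  then show ?thesis by (simp add: char_std_normal_distribution scaleR_conv_of_real)
qed

lemma std_normal_density_exp: "std_normal_density x = exp (- x\<^sup>2 / 2) / sqrt (2 * pi)"
  by (simp add: std_normal_density_def)

lemma fourier_integrable_pair:
  fixes f g :: "real \<Rightarrow> complex" and e :: "real \<Rightarrow> real \<Rightarrow> complex"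
  assumes f: "integrable lborel f" and g: "integrable lborel g"
    and e: "\<And>x y. norm (e x y) = 1" "case_prod e \<in> borel_measurable (lborel \<Otimes>\<^sub>M lborel)"
  shows "integrable (lborel \<Otimes>\<^sub>M lborel) (\<lambda>(x, y). f x * g y * e x y)"
proof -
  have "integrable (lborel \<Otimes>\<^sub>M lborel) (\<lambda>p. f (fst p) * g (snd p))"
  proof (rule lborel_pair.Fubini_integrable)
    show "(\<lambda>p. f (fst p) * g (snd p)) \<in> borel_measurable (lborel \<Otimes>\<^sub>M lborel)"
      using f g by (auto dest!: borel_measurable_integrable)
    show "integrable lborel (\<lambda>x. \<integral>y. norm (f (fst (x, y)) * g (snd (x, y))) \<partial>lborel)"
      using f by (simp add: norm_mult)
    show "AE x in lborel. integrable lborel (\<lambda>y. f (fst (x, y)) * g (snd (x, y)))"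
      using g by simp
  qed
  then show ?thesis
  proof (rule Bochner_Integration.integrable_bound)
    have [measurable]: "f \<in> borel_measurable borel" "g \<in> borel_measurable borel" using f g by auto
    note e(2)[measurable]
    show "(\<lambda>(x, y). f x * g y * e x y) \<in> borel_measurable (lborel \<Otimes>\<^sub>M lborel)" by measurable
  qed (auto simp: norm_mult e)
qed

text \<open>Gaussian regularisation: the Gaussian is essentially its own Fourier transform.\<close>

lemma fourier_inversion_0:
  fixes \<eta> :: "real \<Rightarrow> complex"
  assumes cont: "continuous_on UNIV \<eta>" and bound: "\<And>x. norm (\<eta> x) \<le> 1"
    and supp: "\<And>x. \<bar>x\<bar> \<ge> R \<Longrightarrow> \<eta> x = 0" and int: "integrable lborel (fourier \<eta>)"
  shows "(\<integral>u. fourier \<eta> u \<partial>lborel) = \<eta> 0"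
proof -
  have \<eta>_int: "integrable lborel \<eta>" by (rule integrable_compact_support[OF cont supp])
  have [measurable]: "\<eta> \<in> borel_measurable borel" using \<eta>_int by auto
  have [measurable]: "fourier \<eta> \<in> borel_measurable borel" using int by auto
  define \<epsilon> where "\<epsilon> n = 1 / real (Suc n)" for n
  have \<epsilon>: "\<epsilon> n > 0" for n by (simp add: \<epsilon>_def)
  have \<epsilon>0: "\<epsilon> \<longlonglongrightarrow> 0" unfolding \<epsilon>_def by real_asymp
  define \<gamma> where "\<gamma> n u = complex_of_real (sqrt (2 * pi) * std_normal_density (\<epsilon> n * u))" for n u
  have \<gamma>_eq: "\<gamma> n u = of_real (exp (- (\<epsilon> n * u)\<^sup>2 / 2))" for n u
    by (simp add: \<gamma>_def std_normal_density_exp)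
  have [measurable]: "\<gamma> n \<in> borel_measurable borel" for n unfolding \<gamma>_def[abs_def] by measurable
  have \<gamma>_int: "integrable lborel (\<gamma> n)" for n
  proof -
    have "integrable lborel (\<lambda>u. std_normal_density (0 + \<epsilon> n * u))"
      using \<epsilon>[of n] by (intro lborel_integrable_real_affine integrable_std_normal_moment[of 0, simplified]) auto
    then show ?thesis unfolding \<gamma>_def[abs_def] by (intro integrable_of_real integrable_mult_right) simp
  qed
  have lim1: "(\<lambda>n. \<integral>u. fourier \<eta> u * \<gamma> n u \<partial>lborel) \<longlonglongrightarrow> (\<integral>u. fourier \<eta> u \<partial>lborel)"
  proof (rule integral_dominated_convergence[where w = "\<lambda>u. norm (fourier \<eta> u)"])
    show "AE u in lborel. (\<lambda>n. fourier \<eta> u * \<gamma> n u) \<longlonglongrightarrow> fourier \<eta> u"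
    proof (rule AE_I2)
      fix u
      have "(\<lambda>n. fourier \<eta> u * \<gamma> n u) \<longlonglongrightarrow> fourier \<eta> u * of_real (exp (- (0 * u)\<^sup>2 / 2))"
        unfolding \<gamma>_eq by (intro tendsto_intros \<epsilon>0) auto
      then show "(\<lambda>n. fourier \<eta> u * \<gamma> n u) \<longlonglongrightarrow> fourier \<eta> u" by simp
    qed
    show "AE u in lborel. norm (fourier \<eta> u * \<gamma> n u) \<le> norm (fourier \<eta> u)" for n
      by (rule AE_I2) (simp add: norm_mult \<gamma>_eq mult_left_le)
  qed (use int in auto)
  \<comment> \<open>Fubini moves the transform from \<open>\<eta>\<close> onto the Gaussian, which
    becomes a Gaussian of width \<open>\<epsilon> n / (2 * pi)\<close> and mass 1. Rescaling then
    puts the small parameter into the argument of \<open>\<eta>\<close>, where continuity at 0 can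
    be used.\<close>
  have eq: "(\<integral>u. fourier \<eta> u * \<gamma> n u \<partial>lborel) = (\<integral>w. \<eta> (\<epsilon> n / (2 * pi) * w) * of_real (std_normal_density w) \<partial>lborel)" for n
  proof -
    let ?e = "\<lambda>z u. exp (- (2 * pi * \<i>) * complex_of_real (z * u))"
    have "(\<integral>u. fourier \<eta> u * \<gamma> n u \<partial>lborel) = (\<integral>u. (\<integral>z. \<eta> z * \<gamma> n u * ?e z u \<partial>lborel) \<partial>lborel)"
    proof (rule Bochner_Integration.integral_cong[OF refl])
      fix u
      have "fourier \<eta> u * \<gamma> n u = (\<integral>z. \<eta> z * ?e z u * \<gamma> n u \<partial>lborel)"
        unfolding fourier_def by simp
      then show "fourier \<eta> u * \<gamma> n u = (\<integral>z. \<eta> z * \<gamma> n u * ?e z u \<partial>lborel)" by (simp add: mult_ac)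
    qed
    also have "\<dots> = (\<integral>z. (\<integral>u. \<eta> z * \<gamma> n u * ?e z u \<partial>lborel) \<partial>lborel)"
      by (rule lborel_pair.Fubini_integral[OF fourier_integrable_pair[OF \<eta>_int \<gamma>_int]]) auto
    also have "\<dots> = (\<integral>z. \<eta> z * of_real (2 * pi / \<epsilon> n * std_normal_density (2 * pi * z / \<epsilon> n)) \<partial>lborel)"
    proof (rule Bochner_Integration.integral_cong[OF refl])
      fix z
      have "(\<integral>u. \<gamma> n u * ?e z u \<partial>lborel) = \<bar>1 / \<epsilon> n\<bar> *\<^sub>R (\<integral>u. \<gamma> n (0 + 1 / \<epsilon> n * u) * ?e z (0 + 1 / \<epsilon> n * u) \<partial>lborel)"
        using \<epsilon>[of n] by (intro lborel_integral_real_affine) auto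
      also have "(\<lambda>u. \<gamma> n (0 + 1 / \<epsilon> n * u) * ?e z (0 + 1 / \<epsilon> n * u)) =
          (\<lambda>u. of_real (sqrt (2 * pi)) * (of_real (std_normal_density u) * exp (\<i> * of_real ((- 2 * pi * z / \<epsilon> n) * u))))"
        using \<epsilon>[of n] by (simp add: \<gamma>_def fun_eq_iff mult_ac)
      also have "(\<integral>u. of_real (sqrt (2 * pi)) * (of_real (std_normal_density u) * exp (\<i> * of_real ((- 2 * pi * z / \<epsilon> n) * u))) \<partial>lborel)
          = of_real (sqrt (2 * pi)) * of_real (exp (- (- 2 * pi * z / \<epsilon> n)\<^sup>2 / 2))"
        by (simp only: integral_mult_right_zero integral_std_normal_exp)
      also have "(- 2 * pi * z / \<epsilon> n)\<^sup>2 = (2 * pi * z / \<epsilon> n)\<^sup>2" by (simp add: power2_eq_square)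
      also have "\<bar>1 / \<epsilon> n\<bar> *\<^sub>R (of_real (sqrt (2 * pi)) * complex_of_real (exp (- (2 * pi * z / \<epsilon> n)\<^sup>2 / 2)))
          = of_real (2 * pi / \<epsilon> n * std_normal_density (2 * pi * z / \<epsilon> n))"
      proof -
        have "\<bar>1 / \<epsilon> n\<bar> * (sqrt (2 * pi) * exp (- (2 * pi * z / \<epsilon> n)\<^sup>2 / 2)) = 2 * pi / \<epsilon> n * std_normal_density (2 * pi * z / \<epsilon> n)"
          using \<epsilon>[of n] real_sqrt_mult_self[of "2 * pi"] by (simp add: std_normal_density_exp field_simps)
        from arg_cong[OF this, of complex_of_real] show ?thesis by (simp add: scaleR_conv_of_real)
      qed
      finally show "(\<integral>u. \<eta> z * \<gamma> n u * ?e z u \<partial>lborel) = \<eta> z * of_real (2 * pi / \<epsilon> n * std_normal_density (2 * pi * z / \<epsilon> n))"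
        by (simp add: mult.assoc)
    qed
    also have "\<dots> = \<bar>\<epsilon> n / (2 * pi)\<bar> *\<^sub>R (\<integral>w. \<eta> (0 + \<epsilon> n / (2 * pi) * w) *
        of_real (2 * pi / \<epsilon> n * std_normal_density (2 * pi * (0 + \<epsilon> n / (2 * pi) * w) / \<epsilon> n)) \<partial>lborel)"
      using \<epsilon>[of n] by (intro lborel_integral_real_affine) auto
    also have "\<dots> = (\<integral>w. \<bar>\<epsilon> n / (2 * pi)\<bar> *\<^sub>R (\<eta> (0 + \<epsilon> n / (2 * pi) * w) *
        of_real (2 * pi / \<epsilon> n * std_normal_density (2 * pi * (0 + \<epsilon> n / (2 * pi) * w) / \<epsilon> n))) \<partial>lborel)"
      by (rule integral_scaleR_right[symmetric])
    also have "\<dots> = (\<integral>w. \<eta> (\<epsilon> n / (2 * pi) * w) * of_real (std_normal_density w) \<partial>lborel)"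
      using \<epsilon>[of n] by (intro Bochner_Integration.integral_cong refl) (simp add: scaleR_conv_of_real field_simps)
    finally show ?thesis .
  qed
  have "(\<lambda>n. \<integral>w. \<eta> (\<epsilon> n / (2 * pi) * w) * of_real (std_normal_density w) \<partial>lborel) \<longlonglongrightarrow> (\<integral>w. \<eta> 0 * of_real (std_normal_density w) \<partial>lborel)"
  proof (rule integral_dominated_convergence[where w = std_normal_density])
    show "integrable lborel std_normal_density" using integrable_std_normal_moment[of 0] by simp
    show "AE w in lborel. (\<lambda>n. \<eta> (\<epsilon> n / (2 * pi) * w) * of_real (std_normal_density w)) \<longlonglongrightarrow> \<eta> 0 * of_real (std_normal_density w)"
    proof (rule AE_I2)
      fix w
      have "(\<lambda>n. \<epsilon> n / (2 * pi) * w) \<longlonglongrightarrow> 0 / (2 * pi) * w" by (intro tendsto_intros \<epsilon>0) auto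
      then have "(\<lambda>n. \<eta> (\<epsilon> n / (2 * pi) * w)) \<longlonglongrightarrow> \<eta> 0"
        using cont by (intro isCont_tendsto_compose[of 0 \<eta>]) (auto simp: continuous_on_eq_continuous_at)
      then show "(\<lambda>n. \<eta> (\<epsilon> n / (2 * pi) * w) * of_real (std_normal_density w)) \<longlonglongrightarrow> \<eta> 0 * of_real (std_normal_density w)"
        by (intro tendsto_intros)
    qed
    show "AE w in lborel. norm (\<eta> (\<epsilon> n / (2 * pi) * w) * of_real (std_normal_density w)) \<le> std_normal_density w" for n
      by (rule AE_I2) (use bound in \<open>auto simp: norm_mult intro!: mult_left_le_one_le\<close>)
  qed auto
  also have "(\<integral>w. \<eta> 0 * of_real (std_normal_density w) \<partial>lborel) = \<eta> 0"
    using integral_std_normal_exp[of 0] by simp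
  finally show ?thesis using lim1 unfolding eq by (rule LIMSEQ_unique[rotated])
qed

section \<open>Smoothness of characters and of Fourier transforms\<close>

lemma smooth1_scale:
  assumes "smooth1 v"
  shows "smooth1 (\<lambda>t. v (t * c))"
proof -
  obtain F where F: "F 0 = v" "\<And>n t. (F n has_vector_derivative F (Suc n) t) (at t)"
    using assms unfolding smooth1_def by blast
  have "((\<lambda>t. of_real c ^ n * F n (t * c)) has_vector_derivative of_real c ^ Suc n * F (Suc n) (t * c)) (at t)" for n t
  proof -
    have "((\<lambda>t. t * c) has_vector_derivative c) (at t)" by (auto intro!: derivative_eq_intros)
    from vector_diff_chain_at[OF this F(2)[of n "t * c"]]
    have "((\<lambda>t. F n (t * c)) has_vector_derivative c *\<^sub>R F (Suc n) (t * c)) (at t)" by (simp add: o_def)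
    from has_vector_derivative_mult_right[OF this, of "of_real c ^ n"] show ?thesis
      by (simp add: scaleR_conv_of_real mult_ac)
  qed
  then show ?thesis
    unfolding smooth1_def
    by (intro exI[of _ "\<lambda>n t. of_real c ^ n * F n (t * c)"]) (auto simp: F)
qed

lemma smooth1_exp: "smooth1 (\<lambda>t. exp (c * of_real t))"
proof -
  have "((\<lambda>t. c ^ n * exp (c * of_real t)) has_vector_derivative c ^ Suc n * exp (c * of_real t)) (at t)" for n t
    using has_vector_derivative_mult_right[OF exp_of_real_vector_derivative[of c t], of "c ^ n"]
    by (simp add: mult_ac)
  then show ?thesis
    unfolding smooth1_def by (intro exI[of _ "\<lambda>n t. c ^ n * exp (c * of_real t)"]) auto
qed

lemma integral_lborel_compact_support:
  fixes f :: "real \<Rightarrow> complex"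
  assumes "continuous_on UNIV f" "\<And>x. \<bar>x\<bar> \<ge> B \<Longrightarrow> f x = 0"
  shows "(\<integral>x. f x \<partial>lborel) = integral (cbox (-B) B) f"
proof -
  have "set_integrable lborel {-B..B} f"
    using continuous_on_subset[OF assms(1)] by (intro borel_integrable_atLeastAtMost') auto
  from set_borel_integral_eq_integral(2)[OF this]
  have "(\<integral>x. indicator {-B..B} x *\<^sub>R f x \<partial>lborel) = integral {-B..B} f" by (simp add: set_lebesgue_integral_def)
  moreover have "(\<lambda>x. indicator {-B..B} x *\<^sub>R f x) = f"
    using assms(2) by (auto simp: indicator_def fun_eq_iff)
  ultimately show ?thesis by simp
qed

text \<open>Compact support turns the transform into an integral over a fixed compact interval,
  where joint continuity of the integrand is all that Leibniz's rule requires, at every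
  order.\<close>

lemma smooth1_fourier:
  fixes f :: "real \<Rightarrow> complex"
  assumes cont: "continuous_on UNIV f" and supp: "\<And>x. \<bar>x\<bar> \<ge> B \<Longrightarrow> f x = 0"
  shows "smooth1 (fourier f)"
proof -
  define E where "E n t x = (- (2 * pi * \<i> * of_real x)) ^ n * (f x * exp (- (2 * pi * \<i>) * of_real (x * t)))" for n t and x :: real
  have E_cont: "continuous_on S (\<lambda>(t, x). E n t x)" for S n
  proof -
    have "continuous_on S (\<lambda>p. f (snd p))"
      by (rule continuous_on_compose2[OF cont]) (auto intro!: continuous_intros)
    then show ?thesis unfolding E_def split_beta by (intro continuous_intros)
  qed
  have E_cont1: "continuous_on S (E n t)" for S n t
    unfolding E_def[abs_def] by (intro continuous_intros continuous_on_subset[OF cont]) auto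
  have deriv: "((\<lambda>t. integral (cbox (-B) B) (E n t)) has_vector_derivative integral (cbox (-B) B) (E (Suc n) t)) (at t)" for n t
  proof (rule leibniz_rule_vector_derivative[where U = UNIV])
    fix t x
    have "((\<lambda>t. exp ((- (2 * pi * \<i> * of_real x)) * of_real t)) has_vector_derivative
        (- (2 * pi * \<i> * of_real x)) * exp ((- (2 * pi * \<i> * of_real x)) * of_real t)) (at t)"
      by (rule exp_of_real_vector_derivative)
    from has_vector_derivative_mult_right[OF this, of "(- (2 * pi * \<i> * of_real x)) ^ n * f x"]
    show "((\<lambda>t. E n t x) has_vector_derivative E (Suc n) t x) (at t)"
      by (simp add: E_def mult_ac)
    show "E n t integrable_on cbox (-B) B" for t by (rule integrable_continuous[OF E_cont1])
    show "continuous_on (UNIV \<times> cbox (-B) B) (\<lambda>(t, x). E (Suc n) t x)" by (rule E_cont)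
  qed auto
  have "fourier f = (\<lambda>t. integral (cbox (-B) B) (E 0 t))"
  proof
    fix t
    have "fourier f t = (\<integral>x. E 0 t x \<partial>lborel)" by (simp add: fourier_def E_def)
    also have "\<dots> = integral (cbox (-B) B) (E 0 t)"
      using supp by (intro integral_lborel_compact_support E_cont1) (auto simp: E_def)
    finally show "fourier f t = integral (cbox (-B) B) (E 0 t)" .
  qed
  then show ?thesis
    unfolding smooth1_def
    by (intro exI[of _ "\<lambda>n t. integral (cbox (-B) B) (E n t)"]) (use deriv in auto)
qed

text \<open>A character times \<open>fourier V\<close> is not compactly supported; \<open>cut r x\<close> truncates it by
  \<open>\<eta> (s * r)\<close>, and on the Fourier side \<open>V\<close> is convolved with an approximate identity made from
  \<open>fourier \<eta>\<close> as \<open>r\<close> tends to \<open>0\<close>.\<close>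

locale mollify =
  fixes \<eta> V :: "real \<Rightarrow> complex" and R B K0 :: real
  assumes \<eta>_cont: "continuous_on UNIV \<eta>" and \<eta>_bound: "\<And>x. norm (\<eta> x) \<le> 1"
    and \<eta>_supp: "\<And>x. \<bar>x\<bar> \<ge> R \<Longrightarrow> \<eta> x = 0"
    and \<eta>_decay: "\<And>w. norm (fourier \<eta> w) \<le> K0 / (1 + w\<^sup>2)\<^sup>2"
    and V_cont: "continuous_on UNIV V" and V_bound: "\<And>x. norm (V x) \<le> 1"
    and V_supp: "\<And>x. \<bar>x\<bar> \<ge> B \<Longrightarrow> V x = 0" and B_nonneg: "B \<ge> 0"
begin

definition cut :: "real \<Rightarrow> real \<Rightarrow> real \<Rightarrow> complex" where
  "cut r x s = \<eta> (s * r) * fourier V s * exp (2 * pi * \<i> * of_real x * of_real s)"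

lemma K0_nonneg: "K0 \<ge> 0"
  using order_trans[OF norm_ge_zero \<eta>_decay[of 0]] by simp

lemma fourier_V_cont: "continuous_on S (fourier V)"
  by (rule smooth1_continuous[OF smooth1_fourier[OF V_cont V_supp]])

lemma fourier_\<eta>_int: "integrable lborel (fourier \<eta>)"
proof (rule Bochner_Integration.integrable_bound[OF integrable_mult_right[OF integrable_inverse_quadratic, of K0]])
  show "fourier \<eta> \<in> borel_measurable lborel"
    using borel_measurable_continuous_onI[OF smooth1_continuous[OF smooth1_fourier[OF \<eta>_cont \<eta>_supp]]] by simp
  show "AE w in lborel. norm (fourier \<eta> w) \<le> norm (K0 * (1 / (1 + w\<^sup>2)))"
  proof (rule AE_I2)
    fix w :: real
    have "1 + w\<^sup>2 \<le> (1 + w\<^sup>2)\<^sup>2" using mult_right_mono[of 1 "1 + w\<^sup>2" "1 + w\<^sup>2"] by (simp add: power2_eq_square[of "1 + w\<^sup>2"])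
    then have "K0 / (1 + w\<^sup>2)\<^sup>2 \<le> K0 / (1 + w\<^sup>2)"
      using K0_nonneg by (intro divide_left_mono) (auto intro!: mult_pos_pos add_pos_nonneg zero_less_power)
    also have "\<dots> \<le> norm (K0 * (1 / (1 + w\<^sup>2)))" using K0_nonneg by simp
    finally show "norm (fourier \<eta> w) \<le> norm (K0 * (1 / (1 + w\<^sup>2)))" using \<eta>_decay[of w] by linarith
  qed
qed

text \<open>Multiplication by \<open>\<eta> (s * r)\<close> becomes convolution with
  \<open>fourier \<eta>\<close> dilated by \<open>r\<close>; the substitution
  \<open>w = (z + y - x) / r\<close> moves the dilation into the argument of
  \<open>V\<close>.\<close>

lemma fourier_cut:
  assumes r: "r > 0"
  shows "fourier (cut r x) y = (\<integral>w. V (x - y + r * w) * fourier \<eta> w \<partial>lborel)"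
proof -
  have V_int: "integrable lborel V" by (rule integrable_compact_support[OF V_cont V_supp])
  have \<eta>r_int: "integrable lborel (\<lambda>s. \<eta> (s * r))"
  proof (rule integrable_compact_support[where B = "R / r"])
    show "continuous_on UNIV (\<lambda>s. \<eta> (s * r))"
      by (rule continuous_on_compose2[OF \<eta>_cont]) (auto intro!: continuous_intros)
    show "\<eta> (s * r) = 0" if "\<bar>s\<bar> \<ge> R / r" for s
      using that r by (intro \<eta>_supp) (simp add: abs_mult field_simps)
  qed
  let ?e = "\<lambda>s z. exp (- (2 * pi * \<i>) * complex_of_real (s * (z + y - x)))"
  have "fourier (cut r x) y = (\<integral>s. (\<integral>z. \<eta> (s * r) * V z * ?e s z \<partial>lborel) \<partial>lborel)"
    unfolding fourier_def[of "cut r x"]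
  proof (rule Bochner_Integration.integral_cong[OF refl])
    fix s
    have "cut r x s * exp (- (2 * pi * \<i>) * complex_of_real (s \<bullet> y)) =
        (\<integral>z. (\<eta> (s * r) * exp (2 * pi * \<i> * of_real x * of_real s) * exp (- (2 * pi * \<i>) * complex_of_real (s \<bullet> y)))
          * (V z * exp (- (2 * pi * \<i>) * complex_of_real (z \<bullet> s))) \<partial>lborel)"
      unfolding integral_mult_right_zero by (simp add: cut_def fourier_def mult_ac)
    also have "\<dots> = (\<integral>z. \<eta> (s * r) * V z * ?e s z \<partial>lborel)"
      by (intro Bochner_Integration.integral_cong refl)
         (simp add: mult_ac flip: exp_add, simp add: algebra_simps flip: exp_add)
    finally show "cut r x s * exp (- (2 * pi * \<i>) * complex_of_real (s \<bullet> y)) = (\<integral>z. \<eta> (s * r) * V z * ?e s z \<partial>lborel)" .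
  qed
  also have "\<dots> = (\<integral>z. (\<integral>s. \<eta> (s * r) * V z * ?e s z \<partial>lborel) \<partial>lborel)"
    by (rule lborel_pair.Fubini_integral[symmetric, OF fourier_integrable_pair[OF \<eta>r_int V_int]]) auto
  also have "\<dots> = (\<integral>z. V z * (of_real (1 / r) * fourier \<eta> ((z + y - x) / r)) \<partial>lborel)"
  proof (rule Bochner_Integration.integral_cong[OF refl])
    fix z
    have "fourier \<eta> ((z + y - x) / r) = \<bar>r\<bar> *\<^sub>R (\<integral>s. \<eta> (0 + r * s) * exp (- (2 * pi * \<i>) * complex_of_real ((0 + r * s) \<bullet> ((z + y - x) / r))) \<partial>lborel)"
      unfolding fourier_def using r by (intro lborel_integral_real_affine) auto
    also have "(\<lambda>s. \<eta> (0 + r * s) * exp (- (2 * pi * \<i>) * complex_of_real ((0 + r * s) \<bullet> ((z + y - x) / r)))) = (\<lambda>s. \<eta> (s * r) * ?e s z)"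
      using r by (simp add: fun_eq_iff mult_ac)
    finally have "(\<integral>s. \<eta> (s * r) * ?e s z \<partial>lborel) = of_real (1 / r) * fourier \<eta> ((z + y - x) / r)"
      using r by (simp add: scaleR_conv_of_real)
    moreover have "(\<integral>s. \<eta> (s * r) * V z * ?e s z \<partial>lborel) = V z * (\<integral>s. \<eta> (s * r) * ?e s z \<partial>lborel)"
      unfolding integral_mult_right_zero[symmetric] by (simp add: mult_ac)
    ultimately show "(\<integral>s. \<eta> (s * r) * V z * ?e s z \<partial>lborel) = V z * (of_real (1 / r) * fourier \<eta> ((z + y - x) / r))"
      by simp
  qed
  also have "\<dots> = \<bar>r\<bar> *\<^sub>R (\<integral>w. V ((x - y) + r * w) * (of_real (1 / r) * fourier \<eta> (((x - y) + r * w + y - x) / r)) \<partial>lborel)"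
    using r by (intro lborel_integral_real_affine) auto
  also have "\<dots> = (\<integral>w. V (x - y + r * w) * fourier \<eta> w \<partial>lborel)"
    unfolding integral_scaleR_right[symmetric] using r
    by (intro Bochner_Integration.integral_cong refl) (simp add: scaleR_conv_of_real)
  finally show ?thesis .
qed

text \<open>The bound must be uniform in \<open>r\<close> to serve as a majorant. On the support of
  \<open>V\<close> the shift forces \<open>1 + y\<^sup>2 \<le> c * (1 + w\<^sup>2)\<close>; so one
  of the two factors \<open>1 + w\<^sup>2\<close> in the decay of \<open>fourier \<eta>\<close> is
  traded for decay in \<open>y\<close>, and the other keeps the integral over \<open>w\<close>
  finite.\<close>

lemma fourier_cut_bound:
  obtains K where "K \<ge> 0" "\<And>r y. 0 < r \<Longrightarrow> r \<le> 1 \<Longrightarrow> norm (fourier (cut r x) y) \<le> K * (1 / (1 + y\<^sup>2))"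
proof -
  define A where "A = \<bar>x\<bar> + B"
  define c where "c = 2 + 2 * A\<^sup>2"
  define J where "J = (\<integral>w. 1 / (1 + w\<^sup>2) \<partial>lborel :: real)"
  have J: "J \<ge> 0" unfolding J_def by (intro Bochner_Integration.integral_nonneg) auto
  have c: "c \<ge> 0" by (simp add: c_def)
  show ?thesis
  proof (rule that[of "c * K0 * J"])
    fix r y :: real assume r: "0 < r" "r \<le> 1"
    have "norm (V (x - y + r * w) * fourier \<eta> w) \<le> c * K0 / (1 + y\<^sup>2) * (1 / (1 + w\<^sup>2))" for w
    proof (cases "V (x - y + r * w) = 0")
      case True
      then show ?thesis using c K0_nonneg by simp
    next
      case False
      then have "\<bar>x - y + r * w\<bar> < B" using V_supp not_less by blast
      moreover have "\<bar>r * w\<bar> \<le> \<bar>w\<bar>" using r by (simp add: abs_mult mult_left_le_one_le)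
      ultimately have "\<bar>y\<bar> \<le> A + \<bar>w\<bar>" unfolding A_def by linarith
      then have "\<bar>y\<bar>\<^sup>2 \<le> (A + \<bar>w\<bar>)\<^sup>2" by (intro power_mono) auto
      also have "\<dots> \<le> 2 * A\<^sup>2 + 2 * w\<^sup>2"
        using sum_squares_bound[of A "\<bar>w\<bar>"] by (simp add: power2_sum)
      finally have "1 + y\<^sup>2 \<le> c + 2 * w\<^sup>2" by (simp add: c_def)
      also have "\<dots> \<le> c * (1 + w\<^sup>2)" by (simp add: c_def algebra_simps)
      finally have y: "1 + y\<^sup>2 \<le> c * (1 + w\<^sup>2)" .
      have p: "1 + y\<^sup>2 > 0" "1 + w\<^sup>2 > 0" by (auto intro!: add_pos_nonneg)
      have "norm (V (x - y + r * w) * fourier \<eta> w) \<le> 1 * (K0 / (1 + w\<^sup>2)\<^sup>2)"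
        unfolding norm_mult by (intro mult_mono V_bound \<eta>_decay) auto
      also have "\<dots> = K0 * (1 + y\<^sup>2) / ((1 + y\<^sup>2) * (1 + w\<^sup>2)\<^sup>2)" using p by simp
      also have "\<dots> \<le> K0 * (c * (1 + w\<^sup>2)) / ((1 + y\<^sup>2) * (1 + w\<^sup>2)\<^sup>2)"
        using y K0_nonneg p by (intro divide_right_mono mult_left_mono) auto
      also have "\<dots> = c * K0 / (1 + y\<^sup>2) * (1 / (1 + w\<^sup>2))" using p by (simp add: power2_eq_square)
      finally show ?thesis .
    qed
    then have "norm (fourier (cut r x) y) \<le> (\<integral>w. c * K0 / (1 + y\<^sup>2) * (1 / (1 + w\<^sup>2)) \<partial>lborel)"
      unfolding fourier_cut[OF r(1)]
      by (intro norm_integral_le integrable_mult_right integrable_inverse_quadratic)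
    also have "\<dots> = c * K0 / (1 + y\<^sup>2) * J" unfolding J_def by (rule integral_mult_right_zero)
    finally show "norm (fourier (cut r x) y) \<le> c * K0 * J * (1 / (1 + y\<^sup>2))" by simp
  qed (use c K0_nonneg J in auto)
qed

lemma fourier_cut_tendsto: "(\<lambda>n. fourier (cut (1 / real (Suc n)) x) y) \<longlonglongrightarrow> V (x - y) * \<eta> 0"
proof -
  have "(\<lambda>n. \<integral>w. V (x - y + 1 / real (Suc n) * w) * fourier \<eta> w \<partial>lborel) \<longlonglongrightarrow> (\<integral>w. V (x - y) * fourier \<eta> w \<partial>lborel)"
  proof (rule integral_dominated_convergence[where w = "\<lambda>w. norm (fourier \<eta> w)"])
    have [measurable]: "V \<in> borel_measurable borel" by (rule borel_measurable_continuous_onI[OF V_cont])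
    have [measurable]: "fourier \<eta> \<in> borel_measurable borel" using fourier_\<eta>_int by auto
    show "(\<lambda>w. V (x - y) * fourier \<eta> w) \<in> borel_measurable lborel"
      "\<And>n. (\<lambda>w. V (x - y + 1 / real (Suc n) * w) * fourier \<eta> w) \<in> borel_measurable lborel" by measurable
    show "AE w in lborel. (\<lambda>n. V (x - y + 1 / real (Suc n) * w) * fourier \<eta> w) \<longlonglongrightarrow> V (x - y) * fourier \<eta> w"
    proof (rule AE_I2)
      fix w
      have "(\<lambda>n. x - y + 1 / real (Suc n) * w) \<longlonglongrightarrow> x - y" by real_asymp
      then have "(\<lambda>n. V (x - y + 1 / real (Suc n) * w)) \<longlonglongrightarrow> V (x - y)"
        using V_cont by (intro isCont_tendsto_compose[of "x - y" V]) (auto simp: continuous_on_eq_continuous_at)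
      then show "(\<lambda>n. V (x - y + 1 / real (Suc n) * w) * fourier \<eta> w) \<longlonglongrightarrow> V (x - y) * fourier \<eta> w"
        by (intro tendsto_intros)
    qed
    show "AE w in lborel. norm (V (x - y + 1 / real (Suc n) * w) * fourier \<eta> w) \<le> norm (fourier \<eta> w)" for n
      by (rule AE_I2) (simp add: norm_mult V_bound mult_left_le_one_le)
  qed (use fourier_\<eta>_int in auto)
  \<comment> \<open>The approximate identity has total mass \<open>\<eta> 0\<close>, by inversion at
    the origin.\<close>
  also have "(\<integral>w. V (x - y) * fourier \<eta> w \<partial>lborel) = V (x - y) * \<eta> 0"
    by (simp add: fourier_inversion_0[OF \<eta>_cont \<eta>_bound \<eta>_supp fourier_\<eta>_int])
  finally show ?thesis by (subst fourier_cut) auto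
qed

lemma cut_continuous: "continuous_on UNIV (cut r x)"
  unfolding cut_def[abs_def]
  by (intro continuous_intros fourier_V_cont continuous_on_compose2[OF \<eta>_cont]) auto

lemma cut_supp: "r > 0 \<Longrightarrow> \<bar>s\<bar> \<ge> R / r \<Longrightarrow> cut r x s = 0"
  by (simp add: cut_def \<eta>_supp abs_mult field_simps)

lemma cut_norm: "norm (cut r x s) \<le> norm (fourier V s)"
  unfolding cut_def norm_mult using \<eta>_bound by (simp add: mult_left_le_one_le)

lemma cut_tendsto: "(\<lambda>n. cut (1 / real (Suc n)) x s) \<longlonglongrightarrow> \<eta> 0 * fourier V s * exp (2 * pi * \<i> * of_real x * of_real s)"
proof -
  have "(\<lambda>n. s * (1 / real (Suc n))) \<longlonglongrightarrow> 0" by real_asymp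
  then have "(\<lambda>n. \<eta> (s * (1 / real (Suc n)))) \<longlonglongrightarrow> \<eta> 0"
    using \<eta>_cont by (intro isCont_tendsto_compose[of 0 \<eta>]) (auto simp: continuous_on_eq_continuous_at)
  then show ?thesis unfolding cut_def by (intro tendsto_intros)
qed

end

section \<open>From the multiplication formula to an inversion formula for convolutions\<close>

lemma cutoff_exists:
  obtains \<eta> :: "real \<Rightarrow> complex" and K0 where "smooth1 \<eta>" "\<And>x. norm (\<eta> x) \<le> 1"
    "\<And>x. \<bar>x\<bar> \<ge> 2 \<Longrightarrow> \<eta> x = 0" "\<And>w. norm (fourier \<eta> w) \<le> K0 / (1 + w\<^sup>2)\<^sup>2" "\<eta> 0 \<noteq> 0"
proof -
  obtain V :: "real \<Rightarrow> real" and C where V: "smooth1 (\<lambda>x. of_real (V x))" "\<And>x. V x \<in> {0..1}"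
    "\<And>x. \<bar>V x - max 0 (1 - \<bar>x\<bar>)\<bar> \<le> 1/2" "\<And>x. \<bar>x\<bar> \<ge> 1 + 1/2 \<Longrightarrow> V x = 0" "C > 0"
    "\<And>t. norm (fourier (\<lambda>x. of_real (V x)) t) \<le> C * exp (- slow \<bar>t\<bar> * \<bar>t\<bar>)"
  proof (rule ingham_1d[where \<Theta> = slow and u = "\<lambda>x. max 0 (1 - \<bar>x\<bar>)" and L = 1 and R = 1 and \<delta> = "1/2"])
  qed (use slow_mono slow_tendsto slow_summable less_imp_le[OF slow_pos] in auto)
  obtain K where K: "K > 0" "\<And>r. r \<ge> 0 \<Longrightarrow> (1 + r) ^ 4 * exp (- (r / sqrt (1 + r))) \<le> K"
    using poly_exp_decay by blast
  have "norm (fourier (\<lambda>x. of_real (V x)) w) \<le> C * K / (1 + w\<^sup>2)\<^sup>2" for w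
  proof -
    have p: "(1 + w\<^sup>2)\<^sup>2 > 0" by (intro zero_less_power add_pos_nonneg) auto
    have "1 + w\<^sup>2 \<le> (1 + \<bar>w\<bar>)\<^sup>2" by (simp add: power2_sum)
    then have "(1 + w\<^sup>2)\<^sup>2 \<le> ((1 + \<bar>w\<bar>)\<^sup>2)\<^sup>2" by (intro power_mono) auto
    also have "\<dots> = (1 + \<bar>w\<bar>) ^ 4" by (simp flip: power_mult)
    finally have "(1 + w\<^sup>2)\<^sup>2 * exp (- (\<bar>w\<bar> / sqrt (1 + \<bar>w\<bar>))) \<le> (1 + \<bar>w\<bar>) ^ 4 * exp (- (\<bar>w\<bar> / sqrt (1 + \<bar>w\<bar>)))"
      by (intro mult_right_mono) auto
    also have "\<dots> \<le> K" by (rule K) simp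
    finally have "exp (- (\<bar>w\<bar> / sqrt (1 + \<bar>w\<bar>))) \<le> K / (1 + w\<^sup>2)\<^sup>2" using p by (simp add: field_simps)
    then have "C * exp (- slow \<bar>w\<bar> * \<bar>w\<bar>) \<le> C * (K / (1 + w\<^sup>2)\<^sup>2)"
      using V(5) by (intro mult_left_mono) (simp_all add: slow_def)
    then show ?thesis using V(6)[of w] by simp
  qed
  moreover have "V 0 \<noteq> 0" using V(3)[of 0] by auto
  ultimately show ?thesis
    using V by (intro that[of "\<lambda>x. of_real (V x)" "C * K"]) auto
qed

text \<open>The inequality \<open>t \<le> t powr p + 1\<close>, multiplied by
  \<open>W \<le> 1\<close>, takes the place of Hoelder's inequality.\<close>

lemma Lp_weighted_integrable:
  fixes f :: "'a::euclidean_space \<Rightarrow> complex" and W :: "'a \<Rightarrow> real"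
  assumes f: "Lp p f" and p: "1 \<le> p"
    and W: "integrable lborel W" and W0: "\<And>y. 0 \<le> W y" and W1: "\<And>y. W y \<le> 1"
  shows "integrable lborel (\<lambda>y. norm (f y) * W y)"
proof (rule integrableI_bounded)
  have [measurable]: "f \<in> borel_measurable borel" using f by (simp add: Lp_def)
  have [measurable]: "W \<in> borel_measurable borel" using W by auto
  show "(\<lambda>y. norm (f y) * W y) \<in> borel_measurable lborel" by measurable
  have "norm (norm (f y) * W y) \<le> norm (f y) powr p + W y" for y
  proof -
    have "norm (f y) \<le> norm (f y) powr p + 1"
    proof (cases "norm (f y) \<le> 1")
      case False
      then have "norm (f y) powr 1 \<le> norm (f y) powr p" using p by (intro powr_mono) auto
      then show ?thesis using False by simp
    qed (simp add: add_increasing)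
    then have "norm (f y) * W y \<le> (norm (f y) powr p + 1) * W y" by (intro mult_right_mono W0)
    also have "\<dots> \<le> norm (f y) powr p * 1 + W y"
      unfolding distrib_right using W1[of y] by (intro add_mono mult_left_mono) auto
    finally show ?thesis using W0[of y] by (simp add: abs_mult)
  qed
  then have "(\<integral>\<^sup>+y. ennreal (norm (norm (f y) * W y)) \<partial>lborel) \<le> (\<integral>\<^sup>+y. ennreal (norm (f y) powr p) + ennreal (W y) \<partial>lborel)"
    using W0 by (intro nn_integral_mono) (simp flip: ennreal_plus add: ennreal_leI)
  also have "\<dots> = (\<integral>\<^sup>+y. ennreal (norm (f y) powr p) \<partial>lborel) + (\<integral>\<^sup>+y. ennreal (W y) \<partial>lborel)"
    by (rule nn_integral_add) auto
  also have "(\<integral>\<^sup>+y. ennreal (W y) \<partial>lborel) = ennreal (integral\<^sup>L lborel W)"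
    using W0 by (intro nn_integral_eq_integral W) auto
  also have "(\<integral>\<^sup>+y. ennreal (norm (f y) powr p) \<partial>lborel) + ennreal (integral\<^sup>L lborel W) < \<infinity>"
    using f by (simp add: Lp_def)
  finally show "(\<integral>\<^sup>+y. ennreal (norm (norm (f y) * W y)) \<partial>lborel) < \<infinity>" .
qed

lemma inverse_quadratic_tensor_bounds:
  fixes y :: "'a::euclidean_space"
  shows "0 \<le> (\<Prod>b\<in>Basis. 1 / (1 + (y \<bullet> b)\<^sup>2))" "(\<Prod>b\<in>Basis. 1 / (1 + (y \<bullet> b)\<^sup>2)) \<le> 1"
proof -
  have "1 / (1 + t\<^sup>2) \<le> 1" for t :: real
    using add_pos_nonneg[of 1 "t\<^sup>2"] by (subst divide_le_eq_1_pos) auto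
  then show "0 \<le> (\<Prod>b\<in>Basis. 1 / (1 + (y \<bullet> b)\<^sup>2))" "(\<Prod>b\<in>Basis. 1 / (1 + (y \<bullet> b)\<^sup>2)) \<le> 1"
    by (auto intro!: prod_nonneg prod_le_1)
qed

text \<open>Formally this is the multiplication formula for \<open>\<phi> \<xi> =
  (\<Prod>b\<in>Basis. fourier (V b) (\<xi> \<bullet> b)) * exp (2 * pi * \<i> * of_real (x
  \<bullet> \<xi>))\<close>, whose transform is the reflected and translated kernel. As this
  \<open>\<phi>\<close> need not have compact support, the formula is applied to the truncations
  \<open>\<psi> n\<close>; both limits carry the same nonzero factor
  \<open>\<eta> 0 ^ DIM('a)\<close>, which cancels.\<close>

theorem convolution_eq_inverse_fourier:
  fixes f g :: "'a::euclidean_space \<Rightarrow> complex" and V :: "'a \<Rightarrow> real \<Rightarrow> complex"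
  assumes f: "Lp p f" and p: "1 \<le> p" and fg: "fourier_transform_of f g"
    and V_smooth: "\<And>b. smooth1 (V b)" and V_bound: "\<And>b x. norm (V b x) \<le> 1"
    and V_supp: "\<And>b x. \<bar>x\<bar> \<ge> B \<Longrightarrow> V b x = 0" and B: "B \<ge> 0"
    and int: "integrable lborel (\<lambda>\<xi>. g \<xi> * (\<Prod>b\<in>Basis. fourier (V b) (\<xi> \<bullet> b)))"
  shows "(\<integral>y. f y * (\<Prod>b\<in>Basis. V b (x \<bullet> b - y \<bullet> b)) \<partial>lborel) =
    (\<integral>\<xi>. g \<xi> * (\<Prod>b\<in>Basis. fourier (V b) (\<xi> \<bullet> b)) * exp (2 * pi * \<i> * of_real (x \<bullet> \<xi>)) \<partial>lborel)"
proof -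
  obtain \<eta> :: "real \<Rightarrow> complex" and K0 where \<eta>: "smooth1 \<eta>" "\<And>x. norm (\<eta> x) \<le> 1"
    "\<And>x. \<bar>x\<bar> \<ge> 2 \<Longrightarrow> \<eta> x = 0" "\<And>w. norm (fourier \<eta> w) \<le> K0 / (1 + w\<^sup>2)\<^sup>2" "\<eta> 0 \<noteq> 0"
    using cutoff_exists by blast
  interpret M: mollify \<eta> "V b" 2 B K0 for b
    by standard (use \<eta> V_bound V_supp B smooth1_continuous V_smooth in auto)
  have [measurable]: "f \<in> borel_measurable borel" "g \<in> borel_measurable borel"
    using f fg by (auto simp: Lp_def fourier_transform_of_def)
  have [measurable]: "V b \<in> borel_measurable borel" for b
    by (rule borel_measurable_continuous_onI[OF smooth1_continuous[OF V_smooth]])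
  have [measurable]: "fourier (V b) \<in> borel_measurable borel" for b
    by (rule borel_measurable_continuous_onI[OF M.fourier_V_cont])
  define \<psi> where "\<psi> n \<xi> = (\<Prod>b\<in>Basis. M.cut b (1 / real (Suc n)) (x \<bullet> b) (\<xi> \<bullet> b))" for n and \<xi> :: 'a
  have [measurable]: "M.cut b r t \<in> borel_measurable borel" for b r t
    by (rule borel_measurable_continuous_onI[OF M.cut_continuous])
  have [measurable]: "\<psi> n \<in> borel_measurable borel" for n unfolding \<psi>_def[abs_def] by measurable
  have cut_int: "integrable lborel (M.cut b (1 / real (Suc n)) t)" for b n t
    by (rule integrable_compact_support[OF M.cut_continuous M.cut_supp]) auto
  have F\<psi>: "fourier (\<psi> n) y = (\<Prod>b\<in>Basis. fourier (M.cut b (1 / real (Suc n)) (x \<bullet> b)) (y \<bullet> b))" for n y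
    unfolding \<psi>_def[abs_def] by (rule fourier_tensor[of "\<lambda>b. M.cut b (1 / real (Suc n)) (x \<bullet> b)"]) (rule cut_int)
  have test: "test_function (\<psi> n)" for n
    unfolding \<psi>_def[abs_def]
  proof (rule test_function_tensor[where B = "2 / (1 / real (Suc n))" and F = "\<lambda>b. M.cut b (1 / real (Suc n)) (x \<bullet> b)"])
    show "smooth_alg (\<lambda>\<xi>::'a. \<Prod>b\<in>Basis. M.cut b (1 / real (Suc n)) (x \<bullet> b) (\<xi> \<bullet> b))"
    proof (rule smooth_alg_prod)
      fix b :: 'a assume b: "b \<in> Basis"
      have "smooth_alg (\<lambda>\<xi>::'a. \<eta> (\<xi> \<bullet> b * (1 / real (Suc n))))"
        by (rule smooth_alg.comp[OF smooth1_scale[OF \<eta>(1)] b])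
      moreover have "smooth_alg (\<lambda>\<xi>::'a. fourier (V b) (\<xi> \<bullet> b))"
        by (rule smooth_alg.comp[OF smooth1_fourier[OF M.V_cont M.V_supp] b])
      moreover have "smooth_alg (\<lambda>\<xi>::'a. exp (2 * pi * \<i> * of_real (x \<bullet> b) * of_real (\<xi> \<bullet> b)))"
        by (rule smooth_alg.comp[OF smooth1_exp b])
      ultimately show "smooth_alg (\<lambda>\<xi>::'a. M.cut b (1 / real (Suc n)) (x \<bullet> b) (\<xi> \<bullet> b))"
        unfolding M.cut_def by (intro smooth_alg.mult)
    qed simp
  qed (rule M.cut_supp, auto)
  have pairing: "(\<integral>y. f y * fourier (\<psi> n) y \<partial>lborel) = (\<integral>\<xi>. g \<xi> * \<psi> n \<xi> \<partial>lborel)" for n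
    using fg test by (auto simp: fourier_transform_of_def)
  have "\<exists>K\<ge>0. \<forall>r y. 0 < r \<longrightarrow> r \<le> 1 \<longrightarrow> norm (fourier (M.cut b r (x \<bullet> b)) y) \<le> K * (1 / (1 + y\<^sup>2))" for b
    by (rule M.fourier_cut_bound[of b "x \<bullet> b"]) blast
  then obtain K where K: "\<And>b. K b \<ge> 0"
    "\<And>b r y. 0 < r \<Longrightarrow> r \<le> 1 \<Longrightarrow> norm (fourier (M.cut b r (x \<bullet> b)) y) \<le> K b * (1 / (1 + y\<^sup>2))"
    by metis
  have lim1: "(\<lambda>n. \<integral>y. f y * fourier (\<psi> n) y \<partial>lborel) \<longlonglongrightarrow>
      (\<integral>y. f y * (\<Prod>b\<in>Basis. V b (x \<bullet> b - y \<bullet> b) * \<eta> 0) \<partial>lborel)"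
  \<comment> \<open>The transforms of the truncations need not vanish off a common compact set.
    Their uniform quadratic decay in each coordinate gives a majorant that is integrable against an
    \<open>L^p\<close> function.\<close>
  proof (rule integral_dominated_convergence[where w = "\<lambda>y. (\<Prod>b\<in>Basis. K b) * (norm (f y) * (\<Prod>b\<in>Basis. 1 / (1 + (y \<bullet> b)\<^sup>2)))"])
    have [measurable]: "fourier (M.cut b (1 / real (Suc n)) t) \<in> borel_measurable borel" for b n t
      by (rule borel_measurable_continuous_onI[OF smooth1_continuous[OF smooth1_fourier[OF M.cut_continuous M.cut_supp]]]) auto
    show "(\<lambda>y. f y * fourier (\<psi> n) y) \<in> borel_measurable lborel" for n unfolding F\<psi> by measurable
    show "(\<lambda>y. f y * (\<Prod>b\<in>Basis. V b (x \<bullet> b - y \<bullet> b) * \<eta> 0)) \<in> borel_measurable lborel" by measurable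
    show "AE y in lborel. (\<lambda>n. f y * fourier (\<psi> n) y) \<longlonglongrightarrow> f y * (\<Prod>b\<in>Basis. V b (x \<bullet> b - y \<bullet> b) * \<eta> 0)"
      unfolding F\<psi> by (intro AE_I2 tendsto_intros M.fourier_cut_tendsto)
    show "AE y in lborel. norm (f y * fourier (\<psi> n) y) \<le> (\<Prod>b\<in>Basis. K b) * (norm (f y) * (\<Prod>b\<in>Basis. 1 / (1 + (y \<bullet> b)\<^sup>2)))" for n
    proof (rule AE_I2)
      fix y
      have "norm (fourier (\<psi> n) y) \<le> (\<Prod>b\<in>Basis. K b * (1 / (1 + (y \<bullet> b)\<^sup>2)))"
        unfolding F\<psi> prod_norm[symmetric] by (intro prod_mono conjI norm_ge_zero K) auto
      then have "norm (f y) * norm (fourier (\<psi> n) y) \<le> norm (f y) * ((\<Prod>b\<in>Basis. K b) * (\<Prod>b\<in>Basis. 1 / (1 + (y \<bullet> b)\<^sup>2)))"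
        unfolding prod.distrib by (rule mult_left_mono) simp
      then show "norm (f y * fourier (\<psi> n) y) \<le> (\<Prod>b\<in>Basis. K b) * (norm (f y) * (\<Prod>b\<in>Basis. 1 / (1 + (y \<bullet> b)\<^sup>2)))"
        by (simp add: norm_mult mult_ac)
    qed
    show "integrable lborel (\<lambda>y. (\<Prod>b\<in>Basis. K b) * (norm (f y) * (\<Prod>b\<in>Basis. 1 / (1 + (y \<bullet> b)\<^sup>2))))"
      by (intro integrable_mult_right Lp_weighted_integrable[OF f p] integrable_inverse_quadratic_tensor
        inverse_quadratic_tensor_bounds)
  qed
  have lim2: "(\<lambda>n. \<integral>\<xi>. g \<xi> * \<psi> n \<xi> \<partial>lborel) \<longlonglongrightarrow>
      (\<integral>\<xi>. g \<xi> * (\<Prod>b\<in>Basis. \<eta> 0 * fourier (V b) (\<xi> \<bullet> b) * exp (2 * pi * \<i> * of_real (x \<bullet> b) * of_real (\<xi> \<bullet> b))) \<partial>lborel)"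
  \<comment> \<open>On this side truncation only decreases the modulus, so the assumed integrability
    provides the majorant.\<close>
  proof (rule integral_dominated_convergence[where w = "\<lambda>\<xi>. norm (g \<xi> * (\<Prod>b\<in>Basis. fourier (V b) (\<xi> \<bullet> b)))"])
    show "(\<lambda>\<xi>. g \<xi> * \<psi> n \<xi>) \<in> borel_measurable lborel" for n by measurable
    show "(\<lambda>\<xi>. g \<xi> * (\<Prod>b\<in>Basis. \<eta> 0 * fourier (V b) (\<xi> \<bullet> b) * exp (2 * pi * \<i> * of_real (x \<bullet> b) * of_real (\<xi> \<bullet> b)))) \<in> borel_measurable lborel"
      by measurable
    show "AE \<xi> in lborel. (\<lambda>n. g \<xi> * \<psi> n \<xi>) \<longlonglongrightarrow> g \<xi> * (\<Prod>b\<in>Basis. \<eta> 0 * fourier (V b) (\<xi> \<bullet> b) * exp (2 * pi * \<i> * of_real (x \<bullet> b) * of_real (\<xi> \<bullet> b)))"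
      unfolding \<psi>_def by (intro AE_I2 tendsto_mult tendsto_const tendsto_prod M.cut_tendsto)
    show "AE \<xi> in lborel. norm (g \<xi> * \<psi> n \<xi>) \<le> norm (g \<xi> * (\<Prod>b\<in>Basis. fourier (V b) (\<xi> \<bullet> b)))" for n
      unfolding \<psi>_def norm_mult prod_norm[symmetric]
      by (intro AE_I2 mult_left_mono prod_mono conjI norm_ge_zero M.cut_norm)
    show "integrable lborel (\<lambda>\<xi>. norm (g \<xi> * (\<Prod>b\<in>Basis. fourier (V b) (\<xi> \<bullet> b))))"
      by (rule integrable_norm[OF int])
  qed
  have "(\<integral>y. f y * (\<Prod>b\<in>Basis. V b (x \<bullet> b - y \<bullet> b) * \<eta> 0) \<partial>lborel) =
      (\<integral>\<xi>. g \<xi> * (\<Prod>b\<in>Basis. \<eta> 0 * fourier (V b) (\<xi> \<bullet> b) * exp (2 * pi * \<i> * of_real (x \<bullet> b) * of_real (\<xi> \<bullet> b))) \<partial>lborel)"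
    using lim1 lim2 unfolding pairing by (rule LIMSEQ_unique)
  also have "(\<lambda>y. f y * (\<Prod>b\<in>Basis. V b (x \<bullet> b - y \<bullet> b) * \<eta> 0)) = (\<lambda>y. \<eta> 0 ^ DIM('a) * (f y * (\<Prod>b\<in>Basis. V b (x \<bullet> b - y \<bullet> b))))"
    by (simp add: prod.distrib mult_ac)
  also have "(\<lambda>\<xi>. g \<xi> * (\<Prod>b\<in>Basis. \<eta> 0 * fourier (V b) (\<xi> \<bullet> b) * exp (2 * pi * \<i> * of_real (x \<bullet> b) * of_real (\<xi> \<bullet> b)))) =
      (\<lambda>\<xi>. \<eta> 0 ^ DIM('a) * (g \<xi> * (\<Prod>b\<in>Basis. fourier (V b) (\<xi> \<bullet> b)) * exp (2 * pi * \<i> * of_real (x \<bullet> \<xi>))))"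
  proof
    fix \<xi>
    have "exp (2 * pi * \<i> * of_real (x \<bullet> \<xi>)) = (\<Prod>b\<in>Basis. exp (2 * pi * \<i> * of_real (x \<bullet> b) * of_real (\<xi> \<bullet> b)))"
      by (subst euclidean_inner) (simp add: exp_sum[symmetric] sum_distrib_left mult.assoc)
    then show "g \<xi> * (\<Prod>b\<in>Basis. \<eta> 0 * fourier (V b) (\<xi> \<bullet> b) * exp (2 * pi * \<i> * of_real (x \<bullet> b) * of_real (\<xi> \<bullet> b))) =
        \<eta> 0 ^ DIM('a) * (g \<xi> * (\<Prod>b\<in>Basis. fourier (V b) (\<xi> \<bullet> b)) * exp (2 * pi * \<i> * of_real (x \<bullet> \<xi>)))"
      by (simp add: prod.distrib)
  qed
  finally show ?thesis using \<eta>(5) by simp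
qed

section \<open>Quasi-analyticity after Bang\<close>

lemma sum_le_exp:
  fixes y :: real
  assumes "y \<ge> 0"
  shows "(\<Sum>i<k. y ^ i / fact i) \<le> exp y"
proof -
  have s: "summable (\<lambda>i. y ^ i / fact i)"
    using summable_exp[of y] by (simp add: divide_inverse mult.commute)
  have "(\<Sum>i<k. y ^ i / fact i) \<le> (\<Sum>i. y ^ i / fact i)"
    using assms by (intro sum_le_suminf s) auto
  also have "\<dots> = exp y" by (simp add: exp_def divide_inverse mult.commute scaleR_conv_of_real)
  finally show ?thesis .
qed

lemma power_le_fact_exp:
  fixes y :: real
  assumes "y \<ge> 0"
  shows "y ^ n \<le> fact n * exp y"
proof -
  have "y ^ n / fact n \<le> (\<Sum>i<Suc n. y ^ i / fact i)"
    using assms by (intro member_le_sum[of n "{..<Suc n}" "\<lambda>i. y ^ i / fact i"]) auto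
  also have "\<dots> \<le> exp y" by (rule sum_le_exp[OF assms])
  finally show ?thesis by (simp add: field_simps)
qed

text \<open>\<open>F n\<close> plays the role of the \<open>n\<close>-th derivative of
  \<open>F 0\<close>, but the only link between the orders is the Taylor estimate, so nothing has to
  be differentiated. Monotonicity of \<open>m\<close> is log-convexity of \<open>M\<close>.\<close>

locale taylor_majorant =
  fixes F :: "nat \<Rightarrow> real \<Rightarrow> complex" and m M :: "nat \<Rightarrow> real"
  assumes M0: "M 0 > 0" and M_Suc: "\<And>n. M (Suc n) = M n * m (Suc n)"
    and m_pos: "\<And>n. m (Suc n) > 0" and m_mono: "\<And>i j. 1 \<le> i \<Longrightarrow> i \<le> j \<Longrightarrow> m i \<le> m j"
    and bound: "\<And>n x. norm (F n x) \<le> M n"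
    and taylor: "\<And>j k x h. norm (F j (x + h) - (\<Sum>i<k. F (j + i) x * of_real h ^ i / fact i))
        \<le> M (j + k) * \<bar>h\<bar> ^ k / fact k"
begin

lemma M_pos: "M n > 0"
  by (induction n) (auto simp: M0 M_Suc m_pos)

lemma M_ratio: "n + i \<le> N \<Longrightarrow> M (n + i) \<le> M n * m N ^ i"
proof (induction i)
  case (Suc i)
  have "M (n + Suc i) = M (n + i) * m (Suc (n + i))" by (simp add: M_Suc)
  also have "\<dots> \<le> (M n * m N ^ i) * m N"
    using Suc M_pos[of "n + i"] M_pos[of n] m_pos[of "N - 1"] m_pos[of "n + i"]
    by (intro mult_mono m_mono Suc.IH) (auto intro!: mult_nonneg_nonneg zero_le_power)
  finally show ?case by (simp add: mult_ac)
qed simp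

text \<open>Once the lower orders vanish at 0, the expansion of \<open>F 0\<close> to order
  \<open>Suc n\<close> reduces to \<open>F n 0 * h ^ n / fact n\<close>, which is of size
  \<open>h ^ Suc n\<close>. Dividing by \<open>h ^ n\<close> and letting \<open>h\<close> tend to 0
  gives the claim.\<close>

lemma flat_at_zero:
  assumes "\<epsilon> > 0" "\<And>t. \<bar>t\<bar> < \<epsilon> \<Longrightarrow> F 0 t = 0"
  shows "F n 0 = 0"
proof (induction n rule: less_induct)
  case (less n)
  have *: "norm (F n 0) \<le> fact n * M (Suc n) * h" if h: "0 < h" "h < \<epsilon>" for h
  proof -
    have "(\<Sum>i<Suc n. F (0 + i) 0 * of_real h ^ i / fact i) = F n 0 * of_real h ^ n / fact n"
      using less.IH by (simp add: sum.neutral)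
    then have "norm (F n 0 * of_real h ^ n / fact n) \<le> M (Suc n) * h ^ Suc n / fact (Suc n)"
      using taylor[of 0 0 h "Suc n"] assms(2)[of h] h by simp
    then have "norm (F n 0) * h ^ n / fact n \<le> M (Suc n) * h ^ Suc n / fact (Suc n)"
      using h by (simp add: norm_mult norm_divide norm_power)
    also have "\<dots> \<le> M (Suc n) * h ^ Suc n / 1"
      using h M_pos[of "Suc n"] by (intro divide_left_mono) (auto intro!: mult_nonneg_nonneg simp del: fact_Suc)
    finally have "norm (F n 0) * h ^ n \<le> fact n * M (Suc n) * h * h ^ n"
      by (simp add: field_simps)
    then show ?thesis using h by simp
  qed
  have "norm (F n 0) \<le> 0"
  proof (rule field_le_epsilon)
    fix e :: real assume e: "e > 0"
    let ?K = "fact n * M (Suc n)"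
    have K: "?K > 0" using M_pos[of "Suc n"] by simp
    define h where "h = min (\<epsilon> / 2) (e / ?K)"
    have "0 < h" "h < \<epsilon>" using assms(1) e K by (auto simp: h_def)
    from *[OF this] have "norm (F n 0) \<le> ?K * h" by simp
    also have "\<dots> \<le> ?K * (e / ?K)" using K by (intro mult_left_mono) (auto simp: h_def)
    finally show "norm (F n 0) \<le> 0 + e" using K e by (auto split: if_splits)
  qed
  then show ?case by simp
qed

text \<open>Bang's functional is the maximum of \<open>exp (- N)\<close> and of \<open>norm (F n x) / (exp n * M n)\<close> over
  \<open>n < N\<close>. Moving by \<open>h\<close> multiplies it by at most \<open>exp (e * \<bar>h\<bar> * m N)\<close>, because the Taylor remainder of
  order \<open>N\<close> is already covered by \<open>exp (- N)\<close>.\<close>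

lemma propagate:
  assumes N: "N \<ge> 1" and s: "s \<ge> exp (- real N)"
    and P: "\<And>n. n < N \<Longrightarrow> norm (F n x) \<le> s * exp (real n) * M n" and n: "n < N"
  shows "norm (F n (x + h)) \<le> s * exp (exp 1 * \<bar>h\<bar> * m N) * exp (real n) * M n"
proof -
  define k where "k = N - n"
  have k: "n + k = N" using n by (simp add: k_def)
  have s0: "s > 0" using s by (rule less_le_trans[rotated]) simp
  let ?y = "exp 1 * \<bar>h\<bar> * m N"
  have mN: "m N > 0" using m_pos[of "N - 1"] N by simp
  have y: "?y \<ge> 0" using mN by simp
  \<comment> \<open>The \<open>i\<close> extra factors \<open>e\<close> and the \<open>i\<close>
    extra ratios of \<open>M\<close>, each at most \<open>m N\<close>, combine with
    \<open>\<bar>h\<bar> ^ i\<close> to \<open>?y ^ i\<close>; the Taylor sum becomes a partial sum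
    of \<open>exp ?y\<close>.\<close>
  have term_bound: "s * exp (real (n + i)) * M (n + i) * \<bar>h\<bar> ^ i / fact i \<le> s * exp (real n) * M n * (?y ^ i / fact i)"
    if "n + i \<le> N" for i
  proof -
    have "s * exp (real (n + i)) * M (n + i) * \<bar>h\<bar> ^ i / fact i
        \<le> s * exp (real (n + i)) * (M n * m N ^ i) * \<bar>h\<bar> ^ i / fact i"
      using M_ratio[OF that] s0 by (intro divide_right_mono mult_right_mono mult_left_mono) auto
    also have "\<dots> = s * exp (real n) * M n * (?y ^ i / fact i)"
      by (simp add: exp_add power_mult_distrib exp_of_nat_mult[of i 1, simplified] mult_ac)
    finally show ?thesis .
  qed
  have "norm (F n (x + h)) \<le> norm (\<Sum>i<k. F (n + i) x * of_real h ^ i / fact i) + M (n + k) * \<bar>h\<bar> ^ k / fact k"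
    using taylor[of n x h k] by (smt (verit) norm_triangle_sub)
  also have "norm (\<Sum>i<k. F (n + i) x * of_real h ^ i / fact i) \<le> (\<Sum>i<k. s * exp (real n) * M n * (?y ^ i / fact i))"
  proof (rule sum_norm_le)
    fix i assume "i \<in> {..<k}"
    then have i: "n + i < N" using k by auto
    have "norm (F (n + i) x * of_real h ^ i / fact i) \<le> s * exp (real (n + i)) * M (n + i) * \<bar>h\<bar> ^ i / fact i"
      unfolding norm_mult norm_divide norm_power using P[OF i]
      by (auto intro!: divide_right_mono mult_right_mono)
    also have "\<dots> \<le> s * exp (real n) * M n * (?y ^ i / fact i)" using i by (intro term_bound) auto
    finally show "norm (F (n + i) x * of_real h ^ i / fact i) \<le> s * exp (real n) * M n * (?y ^ i / fact i)" .
  qed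
  also have "M (n + k) * \<bar>h\<bar> ^ k / fact k \<le> s * exp (real n) * M n * (?y ^ k / fact k)"
  proof -
    have "1 \<le> s * exp (real (n + k))"
    proof -
      have "1 = exp (- real N) * exp (real (n + k))" unfolding k by (simp flip: exp_add)
      also have "\<dots> \<le> s * exp (real (n + k))" using s by (intro mult_right_mono) auto
      finally show ?thesis .
    qed
    then have "1 * (M (n + k) * \<bar>h\<bar> ^ k / fact k) \<le> s * exp (real (n + k)) * (M (n + k) * \<bar>h\<bar> ^ k / fact k)"
      using M_pos[of "n + k"] by (intro mult_right_mono) (auto intro!: divide_nonneg_nonneg mult_nonneg_nonneg)
    also have "\<dots> = s * exp (real (n + k)) * M (n + k) * \<bar>h\<bar> ^ k / fact k" by simp
    also have "\<dots> \<le> s * exp (real n) * M n * (?y ^ k / fact k)" using k by (intro term_bound) auto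
    finally show ?thesis by simp
  qed
  also have "(\<Sum>i<k. s * exp (real n) * M n * (?y ^ i / fact i)) + s * exp (real n) * M n * (?y ^ k / fact k)
      = s * exp (real n) * M n * (\<Sum>i<Suc k. ?y ^ i / fact i)"
    by (simp add: sum_distrib_left distrib_left)
  also have "\<dots> \<le> s * exp (real n) * M n * exp ?y"
    using s0 M_pos[of n] by (intro mult_left_mono sum_le_exp[OF y]) auto
  finally show ?thesis by (simp add: mult_ac)
qed

text \<open>A step of length \<open>1 / (e * m (Suc k))\<close> costs one factor \<open>e\<close>, which lowering the order from
  \<open>Suc k\<close> to \<open>k\<close> absorbs.\<close>

lemma chain:
  assumes flat: "\<And>n. F n 0 = 0" and "k \<le> N"
  shows "\<bar>x\<bar> \<le> (\<Sum>i=k..<N. 1 / (exp 1 * m (Suc i))) \<Longrightarrow> n < k \<Longrightarrow> norm (F n x) \<le> exp (- real k) * exp (real n) * M n"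
  using \<open>k \<le> N\<close>
\<comment> \<open>The induction descends from \<open>k = N\<close>. There the sum is empty, so
  \<open>x = 0\<close> and flatness applies.\<close>
proof (induction k arbitrary: x n rule: inc_induct)
  case base
  then show ?case using flat M_pos[of n] by simp
next
  case (step k)
  define \<delta> where "\<delta> = 1 / (exp 1 * m (Suc k))"
  define S where "S = (\<Sum>i=Suc k..<N. 1 / (exp 1 * m (Suc i)))"
  have \<delta>: "\<delta> > 0" using m_pos[of k] by (simp add: \<delta>_def)
  have S: "S \<ge> 0" unfolding S_def using m_pos by (intro sum_nonneg) (auto intro: less_imp_le)
  have "\<bar>x\<bar> \<le> \<delta> + S"
    using step.prems(1) step.hyps by (simp add: sum.atLeast_Suc_lessThan \<delta>_def S_def)
  \<comment> \<open>The point \<open>y\<close> is \<open>x\<close> clamped to the interval that the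
    higher order has already covered.\<close>
  then obtain y where y: "\<bar>y\<bar> \<le> S" "\<bar>x - y\<bar> \<le> \<delta>"
    using S \<delta> by (intro that[of "max (-S) (min S x)"]) (auto simp: max_def min_def abs_if split: if_splits)
  have "norm (F n (y + (x - y))) \<le> exp (- real (Suc k)) * exp (exp 1 * \<bar>x - y\<bar> * m (Suc k)) * exp (real n) * M n"
    using step.IH[of y] y(1) step.prems(2) by (intro propagate) (auto simp: S_def)
  also have "\<dots> \<le> exp (- real (Suc k)) * exp 1 * exp (real n) * M n"
  proof (intro mult_right_mono mult_left_mono)
    have "exp 1 * \<bar>x - y\<bar> * m (Suc k) \<le> exp 1 * \<delta> * m (Suc k)"
      using y(2) m_pos[of k] by (intro mult_right_mono mult_left_mono) auto
    also have "\<dots> = 1" using m_pos[of k] by (simp add: \<delta>_def)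
    finally show "exp (exp 1 * \<bar>x - y\<bar> * m (Suc k)) \<le> exp 1" by simp
  qed (use M_pos[of n] in auto)
  also have "exp (- real (Suc k)) * exp 1 = exp (- real k)" by (simp flip: exp_add)
  finally show ?case by simp
qed

text \<open>For a fixed order \<open>k\<close>, divergence allows \<open>chain\<close> to start from
  an \<open>N\<close> so large that its steps down to order \<open>k\<close> reach from 0 to
  \<open>x\<close>. The value there is at most \<open>exp (- k) * M 0\<close>, and \<open>k\<close>
  is arbitrary.\<close>

theorem denjoy_carleman:
  assumes flat: "\<And>n. F n 0 = 0" and div: "\<not> summable (\<lambda>n. 1 / m (Suc n))"
  shows "F 0 x = 0"
proof -
  have "norm (F 0 x) \<le> exp (- real k) * M 0" if "k \<ge> 1" for k
  proof -
    have "\<exists>N\<ge>k. \<bar>x\<bar> \<le> (\<Sum>i=k..<N. 1 / (exp 1 * m (Suc i)))"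
    proof (rule ccontr)
      assume "\<not> ?thesis"
      then have *: "(\<Sum>i=k..<N. 1 / (exp 1 * m (Suc i))) \<le> \<bar>x\<bar>" if "N \<ge> k" for N
        using that by force
      have "summable (\<lambda>i. 1 / (exp 1 * m (Suc (i + k))))"
      proof (rule summableI_nonneg_bounded)
        show "(\<Sum>i<n. 1 / (exp 1 * m (Suc (i + k)))) \<le> \<bar>x\<bar>" for n
          using *[of "n + k"] sum.shift_bounds_nat_ivl[of "\<lambda>i. 1 / (exp 1 * m (Suc i))" 0 k n]
          by (simp add: atLeast0LessThan)
      qed (use m_pos in \<open>auto intro: less_imp_le\<close>)
      then have "summable (\<lambda>i. 1 / (exp 1 * m (Suc i)))" by (subst (asm) summable_iff_shift)
      from summable_mult[OF this, of "exp 1"] show False using div by simp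
    qed
    then obtain N where N: "N \<ge> k" "\<bar>x\<bar> \<le> (\<Sum>i=k..<N. 1 / (exp 1 * m (Suc i)))" by blast
    from chain[OF flat this, of 0] that show ?thesis by simp
  qed
  then have "\<forall>\<^sub>F k in sequentially. norm (F 0 x) \<le> exp (- real k) * M 0"
    by (auto simp: eventually_sequentially)
  moreover have "(\<lambda>k. exp (- real k) * M 0) \<longlonglongrightarrow> 0" by real_asymp
  ultimately have "norm (F 0 x) \<le> 0"
    by (intro tendsto_lowerbound[of _ _ sequentially]) auto
  then show ?thesis by simp
qed

end

section \<open>Moment bounds and Fourier integrals along lines\<close>

lemma root4_bound:
  obtains C where "C > 0" "\<And>r. r \<ge> 0 \<Longrightarrow> (1 + r) powr (r powr (1/4) + 1) * exp (- sqrt r) \<le> C"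
proof -
  \<comment> \<open>On the logarithmic scale, \<open>r powr (1/4) * ln (1 + r)\<close> is negligible
    against \<open>sqrt r\<close>.\<close>
  have "((\<lambda>r::real. (1 + r) powr (r powr (1/4) + 1) * exp (- sqrt r)) \<longlongrightarrow> 0) at_top"
    by real_asymp
  then have "eventually (\<lambda>r::real. (1 + r) powr (r powr (1/4) + 1) * exp (- sqrt r) < 1) at_top"
    by (rule order_tendstoD) simp
  then obtain S :: real where S: "\<And>r. r \<ge> S \<Longrightarrow> (1 + r) powr (r powr (1/4) + 1) * exp (- sqrt r) < 1"
    by (auto simp: eventually_at_top_linorder)
  let ?C = "(1 + \<bar>S\<bar>) powr (\<bar>S\<bar> powr (1/4) + 1)"
  show ?thesis
  proof (rule that[of "?C + 1"])
    fix r :: real assume r: "r \<ge> 0"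
    show "(1 + r) powr (r powr (1/4) + 1) * exp (- sqrt r) \<le> ?C + 1"
    proof (cases "r \<ge> S")
      case True
      then show ?thesis using S[of r] powr_ge_zero[of "1 + \<bar>S\<bar>" "\<bar>S\<bar> powr (1/4) + 1"] by linarith
    next
      case False
      have "(1 + r) powr (r powr (1/4) + 1) \<le> (1 + \<bar>S\<bar>) powr (r powr (1/4) + 1)"
        using False r by (intro powr_mono2) auto
      also have "\<dots> \<le> ?C" using False r by (intro powr_mono powr_mono2 add_right_mono) auto
      finally have "(1 + r) powr (r powr (1/4) + 1) * exp (- sqrt r) \<le> ?C * 1"
        using r by (intro mult_mono) auto
      then show ?thesis by simp
    qed
  qed (auto intro!: add_nonneg_pos)
qed

text \<open>The factor \<open>exp (sqrt r)\<close> absorbs the powers belonging to those \<open>k\<close> with \<open>k ^ 4 < r\<close>, for which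
  \<open>\<Theta> (k ^ 4)\<close> is not controlled by \<open>\<Theta> r\<close>.\<close>

lemma power_le_weight:
  fixes \<Theta> :: "real \<Rightarrow> real"
  assumes pos: "\<And>r. \<Theta> r > 0" and le1: "\<And>r. \<Theta> r \<le> 1"
    and mono: "\<And>r s. 0 \<le> r \<Longrightarrow> r \<le> s \<Longrightarrow> \<Theta> s \<le> \<Theta> r"
  obtains C where "C > 0"
    "\<And>r n. r \<ge> 0 \<Longrightarrow> r ^ n \<le> C * (\<Prod>k<n. real (Suc k) / \<Theta> (real (Suc k) ^ 4)) * exp (\<Theta> r * r + sqrt r)"
proof -
  obtain C where C: "C > 0" "\<And>r. r \<ge> 0 \<Longrightarrow> (1 + r) powr (r powr (1/4) + 1) * exp (- sqrt r) \<le> C"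
    using root4_bound by blast
  show ?thesis
  proof (rule that[OF C(1)])
    fix r :: real and n :: nat assume r: "r \<ge> 0"
    \<comment> \<open>From index \<open>j\<close> on, \<open>r \<le> k ^ 4\<close> holds. The first
      \<open>p\<close> powers of \<open>r\<close> are charged to \<open>exp (sqrt r)\<close>, the
      remaining \<open>n - p\<close> to \<open>exp (\<Theta> r * r)\<close>.\<close>
    define j where "j = nat \<lceil>r powr (1/4)\<rceil>"
    have j1: "r powr (1/4) \<le> real j" "real j \<le> r powr (1/4) + 1"
      unfolding j_def using powr_ge_zero[of r "1/4"] by linarith+
    have "r = (r powr (1/4)) ^ 4"
      using r by (cases "r = 0") (simp_all add: powr_power)
    also have "\<dots> \<le> real j ^ 4" using j1 by (intro power_mono) auto
    finally have rj: "r \<le> real j ^ 4" .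
    define p where "p = min j n"
    have low: "r ^ p \<le> C * exp (sqrt r)"
    proof -
      have "r ^ p \<le> (1 + r) ^ p" using r by (intro power_mono) auto
      also have "\<dots> \<le> (1 + r) powr (r powr (1/4) + 1)"
        using r j1 by (subst powr_realpow[symmetric]) (auto simp: p_def intro!: powr_mono)
      finally have "r ^ p * exp (- sqrt r) \<le> C"
        using C(2)[OF r] by (meson exp_ge_zero mult_right_mono order_trans)
      then show ?thesis by (simp add: exp_minus field_simps)
    qed
    have high: "r ^ (n - p) \<le> fact (n - p) / \<Theta> r ^ (n - p) * exp (\<Theta> r * r)"
    proof -
      have "(\<Theta> r * r) ^ (n - p) \<le> fact (n - p) * exp (\<Theta> r * r)"
        using r pos[of r] by (intro power_le_fact_exp) auto
      then show ?thesis using pos[of r] by (simp add: power_mult_distrib field_simps)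
    qed
    have split: "(\<Prod>k<n. c k) = (\<Prod>k<p. c k) * (\<Prod>k=p..<n. c k)" for c :: "nat \<Rightarrow> real"
      using prod.atLeastLessThan_concat[of 0 p n c] by (simp add: p_def atLeast0LessThan)
    have prod1: "1 \<le> (\<Prod>k<p. real (Suc k) / \<Theta> (real (Suc k) ^ 4))"
    proof (rule prod_ge_1)
      fix k
      have "\<Theta> (real (Suc k) ^ 4) \<le> real (Suc k)" by (rule order_trans[OF le1]) simp
      then show "1 \<le> real (Suc k) / \<Theta> (real (Suc k) ^ 4)" using pos by (subst le_divide_eq_1_pos) auto
    qed
    have prod2: "fact (n - p) / \<Theta> r ^ (n - p) \<le> (\<Prod>k=p..<n. real (Suc k) / \<Theta> (real (Suc k) ^ 4))"
    proof -
      have "fact (n - p) / \<Theta> r ^ (n - p) = (\<Prod>i=0..<n - p. real (Suc i) / \<Theta> r)"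
        by (simp add: prod_dividef fact_prod_Suc)
      also have "\<dots> \<le> (\<Prod>i=0..<n - p. real (Suc (i + p)) / \<Theta> (real (Suc (i + p)) ^ 4))"
      proof (intro prod_mono conjI frac_le mono)
        fix i assume "i \<in> {0..<n - p}"
        \<comment> \<open>A nonempty range means \<open>p < n\<close>, which forces
          \<open>p = j\<close>.\<close>
        then have "j \<le> Suc (i + p)" by (auto simp: p_def)
        then have "real j ^ 4 \<le> real (Suc (i + p)) ^ 4" by (intro power_mono) auto
        with rj show "r \<le> real (Suc (i + p)) ^ 4" by linarith
      qed (use r pos in \<open>auto intro: less_imp_le\<close>)
      also have "\<dots> = (\<Prod>k=p..<n. real (Suc k) / \<Theta> (real (Suc k) ^ 4))"
        using prod.shift_bounds_nat_ivl[of "\<lambda>k. real (Suc k) / \<Theta> (real (Suc k) ^ 4)" 0 p "n - p"]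
        by (simp add: p_def)
      finally show ?thesis .
    qed
    have "r ^ n = r ^ p * r ^ (n - p)" by (simp add: p_def flip: power_add)
    also have "\<dots> \<le> (C * exp (sqrt r)) * (fact (n - p) / \<Theta> r ^ (n - p) * exp (\<Theta> r * r))"
      using r C(1) by (intro mult_mono low high) auto
    also have "\<dots> = C * (1 * (fact (n - p) / \<Theta> r ^ (n - p))) * exp (\<Theta> r * r + sqrt r)"
      by (simp add: exp_add)
    also have "\<dots> \<le> C * ((\<Prod>k<p. real (Suc k) / \<Theta> (real (Suc k) ^ 4)) * (\<Prod>k=p..<n. real (Suc k) / \<Theta> (real (Suc k) ^ 4))) * exp (\<Theta> r * r + sqrt r)"
    proof (intro mult_right_mono mult_left_mono mult_mono prod1 prod2)
      show "0 \<le> fact (n - p) / \<Theta> r ^ (n - p)" using pos[of r] by (simp add: less_imp_le)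
    qed (use C(1) pos in \<open>auto intro!: prod_nonneg simp: less_imp_le\<close>)
    finally show "r ^ n \<le> C * (\<Prod>k<n. real (Suc k) / \<Theta> (real (Suc k) ^ 4)) * exp (\<Theta> r * r + sqrt r)"
      unfolding split .
  qed
qed

lemma exp_taylor_bound:
  fixes y :: real
  shows "norm (exp (\<i> * of_real y) - (\<Sum>i<k. (\<i> * of_real y) ^ i / fact i)) \<le> \<bar>y\<bar> ^ k / fact k"
proof (cases k)
  case (Suc n)
  have "norm (exp (\<i> * of_real y) - (\<Sum>i\<le>n. (\<i> * of_real y) ^ i / fact i)) \<le> \<bar>y\<bar> ^ Suc n / fact (Suc n)"
    using iexp_approx1[of y n] by simp
  then show ?thesis unfolding Suc lessThan_Suc_atMost .
qed simp

text \<open>On the line \<open>x0 + t *\<^sub>R v\<close> each formal derivative in \<open>t\<close>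
  brings down a factor \<open>\<i> * of_real (s \<xi>)\<close>, which defines \<open>F n\<close>.
  All hypotheses of \<open>taylor_majorant\<close> then reduce to the absolute moments of
  \<open>G\<close> in \<open>s\<close>, bounded through \<open>power_le_weight\<close>.\<close>

theorem fourier_quasianalytic:
  fixes G :: "'a::euclidean_space \<Rightarrow> complex" and \<Theta> :: "real \<Rightarrow> real"
  defines "h \<equiv> \<lambda>x. \<integral>\<xi>. G \<xi> * exp (2 * pi * \<i> * of_real (x \<bullet> \<xi>)) \<partial>lborel"
  assumes pos: "\<And>r. \<Theta> r > 0" and le1: "\<And>r. \<Theta> r \<le> 1"
    and mono: "\<And>r s. 0 \<le> r \<Longrightarrow> r \<le> s \<Longrightarrow> \<Theta> s \<le> \<Theta> r"
    and div: "\<not> summable (\<lambda>n. \<Theta> (real n ^ 4) / real n)"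
    and G_meas: "G \<in> borel_measurable lborel"
    and int: "integrable lborel (\<lambda>\<xi>. norm (G \<xi>) * exp (\<Theta> (norm \<xi>) * norm \<xi> + sqrt (norm \<xi>)))"
    and \<epsilon>: "\<epsilon> > 0" and vanish: "\<And>x. x \<in> ball x0 \<epsilon> \<Longrightarrow> h x = 0"
  shows "h x = 0"
proof -
  note [measurable] = G_meas
  define v where "v = x - x0"
  \<comment> \<open>Adding 1 keeps \<open>R\<close> positive when \<open>x = x0\<close>.\<close>
  define R where "R = norm v + 1"
  have R: "R > 0" by (simp add: R_def add_nonneg_pos)
  obtain C where C: "C > 0"
    "\<And>r n. r \<ge> 0 \<Longrightarrow> r ^ n \<le> C * (\<Prod>k<n. real (Suc k) / \<Theta> (real (Suc k) ^ 4)) * exp (\<Theta> r * r + sqrt r)"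
    by (rule power_le_weight[of \<Theta>]) (use pos le1 mono in auto)
  define W where "W \<xi> = norm (G \<xi>) * exp (\<Theta> (norm \<xi>) * norm \<xi> + sqrt (norm \<xi>))" for \<xi>
  have W_int: "integrable lborel W" unfolding W_def[abs_def] by (rule int)
  have W_nonneg: "W \<xi> \<ge> 0" for \<xi> by (simp add: W_def)
  define s where "s \<xi> = 2 * pi * (v \<bullet> \<xi>)" for \<xi> :: 'a
  have s_le: "\<bar>s \<xi>\<bar> \<le> 2 * pi * R * norm \<xi>" for \<xi>
  proof -
    have "\<bar>v \<bullet> \<xi>\<bar> \<le> norm v * norm \<xi>" by (rule Cauchy_Schwarz_ineq2)
    also have "\<dots> \<le> R * norm \<xi>" by (intro mult_right_mono) (auto simp: R_def)
    finally show ?thesis by (simp add: s_def abs_mult)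
  qed
  have [measurable]: "s \<in> borel_measurable borel" unfolding s_def by measurable
  define m where "m k = 2 * pi * R * (real k / \<Theta> (real k ^ 4))" for k
  \<comment> \<open>Adding 1 keeps \<open>M 0\<close> positive when \<open>W\<close> has integral
    0.\<close>
  define D where "D = C * integral\<^sup>L lborel W + 1"
  define M where "M n = D * (\<Prod>k<n. m (Suc k))" for n
  define e where "e t \<xi> = exp (2 * pi * \<i> * of_real ((x0 + t *\<^sub>R v) \<bullet> \<xi>))" for t :: real and \<xi> :: 'a
  have [measurable]: "e t \<in> borel_measurable borel" for t unfolding e_def by measurable
  have e_norm: "norm (e t \<xi>) = 1" for t \<xi> by (simp add: e_def)
  define F where "F n t = (\<integral>\<xi>. G \<xi> * (\<i> * of_real (s \<xi>)) ^ n * e t \<xi> \<partial>lborel)" for n t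
  have D1: "D > 0" unfolding D_def using C(1) W_nonneg by (intro add_nonneg_pos mult_nonneg_nonneg integral_nonneg) auto
  have moment: "norm (G \<xi>) * \<bar>s \<xi>\<bar> ^ n \<le> C * (\<Prod>k<n. m (Suc k)) * W \<xi>" for n \<xi>
  proof -
    have "\<bar>s \<xi>\<bar> ^ n \<le> (2 * pi * R * norm \<xi>) ^ n" by (intro power_mono s_le) auto
    also have "\<dots> = (2 * pi * R) ^ n * norm \<xi> ^ n" by (simp add: power_mult_distrib)
    also have "\<dots> \<le> (2 * pi * R) ^ n * (C * (\<Prod>k<n. real (Suc k) / \<Theta> (real (Suc k) ^ 4)) * exp (\<Theta> (norm \<xi>) * norm \<xi> + sqrt (norm \<xi>)))"
      using R by (intro mult_left_mono C) auto
    also have "\<dots> = C * (\<Prod>k<n. m (Suc k)) * exp (\<Theta> (norm \<xi>) * norm \<xi> + sqrt (norm \<xi>))"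
      unfolding m_def prod.distrib by (simp add: power_mult_distrib)
    finally have "norm (G \<xi>) * \<bar>s \<xi>\<bar> ^ n \<le> norm (G \<xi>) * (C * (\<Prod>k<n. m (Suc k)) * exp (\<Theta> (norm \<xi>) * norm \<xi> + sqrt (norm \<xi>)))"
      by (rule mult_left_mono) simp
    then show ?thesis by (simp add: W_def mult_ac)
  qed
  have moment_int: "integrable lborel (\<lambda>\<xi>. norm (G \<xi>) * \<bar>s \<xi>\<bar> ^ n)" for n
  proof (rule Bochner_Integration.integrable_bound[OF integrable_mult_right[OF W_int, of "C * (\<Prod>k<n. m (Suc k))"]])
    show "AE \<xi> in lborel. norm (norm (G \<xi>) * \<bar>s \<xi>\<bar> ^ n) \<le> norm (C * (\<Prod>k<n. m (Suc k)) * W \<xi>)"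
    proof (rule AE_I2)
      fix \<xi>
      have "norm (norm (G \<xi>) * \<bar>s \<xi>\<bar> ^ n) = norm (G \<xi>) * \<bar>s \<xi>\<bar> ^ n" by (simp add: abs_mult)
      also have "\<dots> \<le> norm (C * (\<Prod>k<n. m (Suc k)) * W \<xi>)" unfolding real_norm_def by (rule order_trans[OF moment abs_ge_self])
      finally show "norm (norm (G \<xi>) * \<bar>s \<xi>\<bar> ^ n) \<le> norm (C * (\<Prod>k<n. m (Suc k)) * W \<xi>)" .
    qed
  qed measurable
  have m_pos: "m (Suc k) > 0" for k using R pos by (simp add: m_def)
  have moment_le: "(\<integral>\<xi>. norm (G \<xi>) * \<bar>s \<xi>\<bar> ^ n \<partial>lborel) \<le> M n" for n
  proof -
    have "(\<integral>\<xi>. norm (G \<xi>) * \<bar>s \<xi>\<bar> ^ n \<partial>lborel) \<le> (\<integral>\<xi>. C * (\<Prod>k<n. m (Suc k)) * W \<xi> \<partial>lborel)"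
      by (intro integral_mono moment_int moment integrable_mult_right W_int)
    also have "\<dots> = C * integral\<^sup>L lborel W * (\<Prod>k<n. m (Suc k))" by simp
    also have "\<dots> \<le> M n" unfolding M_def D_def using m_pos
      by (intro mult_right_mono prod_nonneg) (auto intro: less_imp_le)
    finally show ?thesis .
  qed
  have F_int: "integrable lborel (\<lambda>\<xi>. G \<xi> * (\<i> * of_real (s \<xi>)) ^ n * e t \<xi>)" for n t
    by (rule Bochner_Integration.integrable_bound[OF moment_int[of n]])
       (auto simp: norm_mult norm_power e_norm abs_mult)
  interpret taylor_majorant F m M
  proof
    show "M 0 > 0" "M (Suc n) = M n * m (Suc n)" for n using D1 by (simp_all add: M_def)
    show "m i \<le> m j" if "1 \<le> i" "i \<le> j" for i j
      unfolding m_def using R pos that by (intro mult_left_mono frac_le mono power_mono) auto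
    show "norm (F n t) \<le> M n" for n t
    proof -
      have "norm (F n t) \<le> (\<integral>\<xi>. norm (G \<xi> * (\<i> * of_real (s \<xi>)) ^ n * e t \<xi>) \<partial>lborel)"
        unfolding F_def by (rule integral_norm_bound)
      also have "\<dots> = (\<integral>\<xi>. norm (G \<xi>) * \<bar>s \<xi>\<bar> ^ n \<partial>lborel)"
        by (simp add: norm_mult norm_power e_norm)
      finally show ?thesis using moment_le[of n] by linarith
    qed
    show "norm (F j (t + h) - (\<Sum>i<k. F (j + i) t * of_real h ^ i / fact i)) \<le> M (j + k) * \<bar>h\<bar> ^ k / fact k" for j t h k
    proof -
      \<comment> \<open>The Taylor remainder of \<open>F j\<close> is the integral of the remainder
        \<open>E\<close> of the exponential against a bounded phase and a moment weight, so the
        derivatives need no separate justification.\<close>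
      define E where "E \<xi> = exp (\<i> * of_real (h * s \<xi>)) - (\<Sum>i<k. (\<i> * of_real (h * s \<xi>)) ^ i / fact i)" for \<xi>
      have "e (t + h) \<xi> = e t \<xi> * exp (\<i> * of_real (h * s \<xi>))" for \<xi>
        by (simp add: e_def s_def algebra_simps inner_add_left flip: exp_add)
      then have e_shift: "G \<xi> * (\<i> * of_real (s \<xi>)) ^ j * e (t + h) \<xi> =
          G \<xi> * (\<i> * of_real (s \<xi>)) ^ j * e t \<xi> * exp (\<i> * of_real (h * s \<xi>))" for \<xi> by simp
      have term_eq: "G \<xi> * (\<i> * of_real (s \<xi>)) ^ (j + i) * e t \<xi> * (of_real h ^ i / fact i) =
          G \<xi> * (\<i> * of_real (s \<xi>)) ^ j * e t \<xi> * ((\<i> * of_real (h * s \<xi>)) ^ i / fact i)" for i \<xi>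
        by (simp add: power_add power_mult_distrib)
      have eq: "G \<xi> * (\<i> * of_real (s \<xi>)) ^ j * e (t + h) \<xi> - (\<Sum>i<k. G \<xi> * (\<i> * of_real (s \<xi>)) ^ (j + i) * e t \<xi> * (of_real h ^ i / fact i))
          = G \<xi> * (\<i> * of_real (s \<xi>)) ^ j * e t \<xi> * E \<xi>" for \<xi>
        unfolding term_eq e_shift E_def sum_distrib_left[symmetric] right_diff_distrib ..
      have int_i: "integrable lborel (\<lambda>\<xi>. G \<xi> * (\<i> * of_real (s \<xi>)) ^ (j + i) * e t \<xi> * (of_real h ^ i / fact i))" for i
        by (rule integrable_mult_left[OF F_int])
      have "F (j + i) t * of_real h ^ i / fact i =
          (\<integral>\<xi>. G \<xi> * (\<i> * of_real (s \<xi>)) ^ (j + i) * e t \<xi> * (of_real h ^ i / fact i) \<partial>lborel)" for i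
        unfolding F_def integral_mult_left_zero by simp
      then have "F j (t + h) - (\<Sum>i<k. F (j + i) t * of_real h ^ i / fact i)
          = F j (t + h) - (\<Sum>i<k. (\<integral>\<xi>. G \<xi> * (\<i> * of_real (s \<xi>)) ^ (j + i) * e t \<xi> * (of_real h ^ i / fact i) \<partial>lborel))"
        by (simp only:)
      also have "\<dots> = F j (t + h) - (\<integral>\<xi>. (\<Sum>i<k. G \<xi> * (\<i> * of_real (s \<xi>)) ^ (j + i) * e t \<xi> * (of_real h ^ i / fact i)) \<partial>lborel)"
        by (subst Bochner_Integration.integral_sum[OF int_i]) (rule refl)
      also have "\<dots> = (\<integral>\<xi>. G \<xi> * (\<i> * of_real (s \<xi>)) ^ j * e (t + h) \<xi> - (\<Sum>i<k. G \<xi> * (\<i> * of_real (s \<xi>)) ^ (j + i) * e t \<xi> * (of_real h ^ i / fact i)) \<partial>lborel)"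
        unfolding F_def
        by (rule Bochner_Integration.integral_diff[OF F_int Bochner_Integration.integrable_sum[OF int_i], symmetric])
      finally have "norm (F j (t + h) - (\<Sum>i<k. F (j + i) t * of_real h ^ i / fact i))
          \<le> (\<integral>\<xi>. norm (G \<xi> * (\<i> * of_real (s \<xi>)) ^ j * e t \<xi> * E \<xi>) \<partial>lborel)"
        unfolding eq by (simp only: integral_norm_bound)
      also have "\<dots> \<le> (\<integral>\<xi>. norm (G \<xi>) * \<bar>s \<xi>\<bar> ^ (j + k) * (\<bar>h\<bar> ^ k / fact k) \<partial>lborel)"
      proof (rule integral_mono')
        fix \<xi>
        have "norm (E \<xi>) \<le> \<bar>h * s \<xi>\<bar> ^ k / fact k" unfolding E_def by (rule exp_taylor_bound)
        then have "norm (G \<xi>) * \<bar>s \<xi>\<bar> ^ j * norm (E \<xi>) \<le> norm (G \<xi>) * \<bar>s \<xi>\<bar> ^ j * (\<bar>h * s \<xi>\<bar> ^ k / fact k)"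
          by (rule mult_left_mono) simp
        then show "norm (G \<xi> * (\<i> * of_real (s \<xi>)) ^ j * e t \<xi> * E \<xi>) \<le> norm (G \<xi>) * \<bar>s \<xi>\<bar> ^ (j + k) * (\<bar>h\<bar> ^ k / fact k)"
          by (simp add: norm_mult norm_power e_norm abs_mult power_mult_distrib power_add mult_ac)
      qed (auto intro!: integrable_mult_left moment_int)
      also have "\<dots> = (\<integral>\<xi>. norm (G \<xi>) * \<bar>s \<xi>\<bar> ^ (j + k) \<partial>lborel) * (\<bar>h\<bar> ^ k / fact k)" by (rule integral_mult_left_zero)
      also have "\<dots> \<le> M (j + k) * (\<bar>h\<bar> ^ k / fact k)" by (intro mult_right_mono moment_le) auto
      finally show ?thesis by simp
    qed
  qed (rule m_pos)
  have F0: "F 0 t = h (x0 + t *\<^sub>R v)" for t by (simp add: F_def h_def e_def)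
  have "F n 0 = 0" for n
  proof (rule flat_at_zero)
    show "\<epsilon> / R > 0" using \<epsilon> R by simp
    fix t assume "\<bar>t\<bar> < \<epsilon> / R"
    then have "\<bar>t\<bar> * R < \<epsilon>" using R by (simp add: field_simps)
    moreover have "\<bar>t\<bar> * norm v \<le> \<bar>t\<bar> * R" by (intro mult_left_mono) (auto simp: R_def)
    ultimately show "F 0 t = 0" unfolding F0 by (intro vanish) (simp add: dist_norm)
  qed
  moreover have "\<not> summable (\<lambda>n. 1 / m (Suc n))"
  proof
    assume "summable (\<lambda>n. 1 / m (Suc n))"
    then have "summable (\<lambda>n. 2 * pi * R * (1 / m (Suc n)))" by (rule summable_mult)
    then have "summable (\<lambda>n. \<Theta> (real (Suc n) ^ 4) / real (Suc n))" using R by (simp add: m_def)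
    then show False using div summable_Suc_iff[of "\<lambda>n. \<Theta> (real n ^ 4) / real n"] by simp
  qed
  ultimately have "F 0 1 = 0" by (rule denjoy_carleman)
  then show ?thesis by (simp add: F0 v_def)
qed

section \<open>Uniqueness\<close>

text \<open>Condensation turns the series into that of \<open>\<Theta> (2 ^ (4 * n))\<close>. By
  monotonicity four times each such term dominates a block of four consecutive terms
  \<open>\<Theta> (2 ^ k)\<close>.\<close>

lemma not_summable_fourth_powers:
  fixes \<Theta> :: "real \<Rightarrow> real"
  assumes nonneg: "\<And>r. \<Theta> r \<ge> 0" and mono: "\<And>r s. 0 \<le> r \<Longrightarrow> r \<le> s \<Longrightarrow> \<Theta> s \<le> \<Theta> r"
    and div: "\<not> summable (\<lambda>k. \<Theta> (2 ^ k))"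
  shows "\<not> summable (\<lambda>n. \<Theta> (real n ^ 4) / real n)"
proof
  assume "summable (\<lambda>n. \<Theta> (real n ^ 4) / real n)"
  moreover have "\<Theta> (real (Suc m) ^ 4) / real (Suc m) \<le> \<Theta> (real m ^ 4) / real m" if "0 < m" for m
    using that nonneg by (intro frac_le mono power_mono) auto
  ultimately have "summable (\<lambda>n. 2 ^ n * (\<Theta> (real (2 ^ n) ^ 4) / real (2 ^ n)))"
    using nonneg by (subst (asm) condensation_test) auto
  then have s: "summable (\<lambda>n. \<Theta> (2 ^ (4 * n)))" by (simp add: power_mult mult.commute[of 4])
  have "(\<Sum>k<4 * n. \<Theta> (2 ^ k)) \<le> 4 * (\<Sum>k<n. \<Theta> (2 ^ (4 * k)))" for n
  proof (induction n)
    case (Suc n)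
    have "\<Theta> (2 ^ (4 * n + i)) \<le> \<Theta> (2 ^ (4 * n))" for i
      by (intro mono power_increasing) auto
    from this[of 1] this[of 2] this[of 3] Suc.IH show ?case
      by (simp add: eval_nat_numeral)
  qed simp
  moreover have "(\<Sum>k<n. \<Theta> (2 ^ (4 * k))) \<le> (\<Sum>k. \<Theta> (2 ^ (4 * k)))" for n
    using nonneg by (intro sum_le_suminf s) auto
  ultimately have *: "(\<Sum>k<4 * n. \<Theta> (2 ^ k)) \<le> 4 * (\<Sum>k. \<Theta> (2 ^ (4 * k)))" for n
    by (meson mult_left_mono order_trans zero_le_numeral)
  have "summable (\<lambda>k. \<Theta> (2 ^ k))"
  proof (rule summableI_nonneg_bounded)
    fix n
    have "(\<Sum>k<n. \<Theta> (2 ^ k)) \<le> (\<Sum>k<4 * n. \<Theta> (2 ^ k))"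
      using nonneg by (intro sum_mono2) auto
    with * show "(\<Sum>k<n. \<Theta> (2 ^ k)) \<le> 4 * (\<Sum>k. \<Theta> (2 ^ (4 * k)))" by (rule order_trans[rotated])
  qed (rule nonneg)
  with div show False by contradiction
qed

text \<open>A zero of \<open>\<Theta>\<close> would persist at all larger radii and leave a finite
  sum. Positivity is what allows \<open>\<Theta>\<close> in the denominators of the Denjoy-Carleman
  weights.\<close>

lemma positive_if_not_summable:
  fixes \<Theta> :: "real \<Rightarrow> real"
  assumes nonneg: "\<And>r. \<Theta> r \<ge> 0" and mono: "\<And>r s. 0 \<le> r \<Longrightarrow> r \<le> s \<Longrightarrow> \<Theta> s \<le> \<Theta> r"
    and div: "\<not> summable (\<lambda>k. \<Theta> (2 ^ k))" and r: "r \<ge> 0"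
  shows "\<Theta> r > 0"
proof (rule ccontr)
  assume "\<not> \<Theta> r > 0"
  obtain n where n: "r < 2 ^ n" using real_arch_pow[of 2 r] by auto
  have "\<Theta> (2 ^ k) = 0" if "k \<ge> n" for k
  proof -
    have "(2::real) ^ n \<le> 2 ^ k" using that by (intro power_increasing) auto
    with n have "r \<le> 2 ^ k" by linarith
    from mono[OF r this] nonneg[of "2 ^ k"] \<open>\<not> \<Theta> r > 0\<close> show ?thesis by linarith
  qed
  then have "summable (\<lambda>k. \<Theta> (2 ^ k))"
    by (intro summable_finite[of "{..<n}"]) auto
  with div show False by contradiction
qed

lemma poly_fun_bound:
  assumes "poly_fun P"
  shows "\<exists>K M. K \<ge> 0 \<and> (\<forall>x. norm (P x) \<le> K * (1 + norm x) ^ M)"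
  using assms
proof induction
  case (const c)
  show ?case by (intro exI[of _ "norm c"] exI[of _ 0]) auto
next
  case (coord b)
  have "norm (complex_of_real (x \<bullet> b)) \<le> 1 * (1 + norm x) ^ 1" for x
    using Basis_le_norm[OF coord, of x] by simp
  then show ?case by (intro exI[of _ 1] exI[of _ 1]) auto
next
  case (add P Q)
  then obtain K M K' M' where K: "K \<ge> 0" "\<And>x. norm (P x) \<le> K * (1 + norm x) ^ M"
    "K' \<ge> 0" "\<And>x. norm (Q x) \<le> K' * (1 + norm x) ^ M'" by blast
  have "norm (P x + Q x) \<le> (K + K') * (1 + norm x) ^ (M + M')" for x
  proof -
    have "norm (P x + Q x) \<le> norm (P x) + norm (Q x)" by (rule norm_triangle_ineq)
    also have "\<dots> \<le> K * (1 + norm x) ^ M + K' * (1 + norm x) ^ M'" by (intro add_mono K)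
    also have "\<dots> \<le> K * (1 + norm x) ^ (M + M') + K' * (1 + norm x) ^ (M + M')"
      using K by (intro add_mono mult_left_mono power_increasing) auto
    finally show ?thesis by (simp add: distrib_right)
  qed
  then show ?case using K by (intro exI[of _ "K + K'"] exI[of _ "M + M'"]) auto
next
  case (mult P Q)
  then obtain K M K' M' where K: "K \<ge> 0" "\<And>x. norm (P x) \<le> K * (1 + norm x) ^ M"
    "K' \<ge> 0" "\<And>x. norm (Q x) \<le> K' * (1 + norm x) ^ M'" by blast
  have "norm (P x * Q x) \<le> (K * K') * (1 + norm x) ^ (M + M')" for x
  proof -
    have "norm (P x * Q x) \<le> (K * (1 + norm x) ^ M) * (K' * (1 + norm x) ^ M')"
      unfolding norm_mult using K by (intro mult_mono K) auto
    then show ?thesis by (simp add: power_add mult_ac)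
  qed
  then show ?case using K by (intro exI[of _ "K * K'"] exI[of _ "M + M'"]) auto
qed

text \<open>Restrict \<open>f\<close> to a small cube \<open>Q x\<close>. The sets over which the
  restriction integrates to 0 form a Dynkin system containing all boxes, which are stable under
  intersection and generate the Borel sets. Countably many such cubes cover the space.\<close>

lemma AE_zero_if_small_boxes:
  fixes f :: "'a::euclidean_space \<Rightarrow> complex"
  assumes int: "\<And>a b. integrable lborel (\<lambda>y. indicator (box a b) y *\<^sub>R f y)"
    and \<rho>: "\<rho> > 0"
    and zero: "\<And>a b. box a b \<noteq> {} \<Longrightarrow> (\<And>i. i \<in> Basis \<Longrightarrow> b \<bullet> i - a \<bullet> i \<le> 2 * \<rho>) \<Longrightarrow>
      (\<integral>y. indicator (box a b) y *\<^sub>R f y \<partial>lborel) = 0"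
  shows "AE x in lborel. f x = 0"
proof -
  define Q where "Q x = box (x - \<rho> *\<^sub>R One) (x + \<rho> *\<^sub>R One)" for x :: 'a
  have Q: "AE y in lborel. y \<in> Q x \<longrightarrow> f y = 0" for x
  proof -
    define F where "F y = indicator (Q x) y *\<^sub>R f y" for y
    have F_int: "integrable lborel F" unfolding F_def Q_def by (rule int)
    have F_set: "set_integrable lborel A F" if "A \<in> sets borel" for A
      unfolding set_integrable_def using that by (intro integrable_mult_indicator F_int) auto
    have F_box: "set_lebesgue_integral lborel (box a b) F = 0" for a b
    proof -
      \<comment> \<open>Intersecting with \<open>Q x\<close> yields a box that is empty or has sides
        at most \<open>2 * \<rho>\<close>, so \<open>zero\<close> covers boxes of any size.\<close>
      obtain a' b' where ab: "box a b \<inter> Q x = box a' b'" unfolding Q_def box_Int_box by blast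
      have "set_lebesgue_integral lborel (box a b) F = (\<integral>y. indicator (box a' b') y *\<^sub>R f y \<partial>lborel)"
        unfolding set_lebesgue_integral_def F_def ab[symmetric]
        by (intro Bochner_Integration.integral_cong refl) (simp add: indicator_inter_arith)
      also have "\<dots> = 0"
      proof (cases "box a' b' = {}")
        case False
        have "box a' b' \<subseteq> Q x" using ab by blast
        then have "x \<bullet> i - \<rho> \<le> a' \<bullet> i \<and> b' \<bullet> i \<le> x \<bullet> i + \<rho>" if "i \<in> Basis" for i
          using False that unfolding Q_def subset_box(4) box_ne_empty(2)
          by (auto simp: inner_diff_left inner_add_left)
        then have "b' \<bullet> i - a' \<bullet> i \<le> 2 * \<rho>" if "i \<in> Basis" for i
          using that by fastforce
        then show ?thesis by (rule zero[OF False])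
      qed simp
      finally show ?thesis .
    qed
    have F_UNIV: "set_lebesgue_integral lborel UNIV F = 0"
    proof -
      have "set_lebesgue_integral lborel UNIV F = set_lebesgue_integral lborel (Q x) F"
        unfolding set_lebesgue_integral_def F_def
        by (intro Bochner_Integration.integral_cong refl) (simp add: indicator_def)
      then show ?thesis using F_box unfolding Q_def by simp
    qed
    have "set_lebesgue_integral lborel A F = 0" if "A \<in> sets lborel" for A
    proof -
      have "Int_stable (range (\<lambda>(a, b). box a b :: 'a set))"
        by (auto simp: Int_stable_def box_Int_box)
      moreover have "range (\<lambda>(a, b). box a b :: 'a set) \<subseteq> Pow UNIV" by simp
      moreover have "A \<in> sigma_sets UNIV (range (\<lambda>(a, b). box a b))"
        using that by (simp add: borel_eq_box)
      ultimately show ?thesis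
      proof (induction rule: sigma_sets_induct_disjoint)
        case (basic A)
        then show ?case using F_box by auto
      next
        case empty
        show ?case by (simp add: set_lebesgue_integral_def)
      next
        case (compl A)
        then have A: "A \<in> sets borel" by (simp add: borel_eq_box)
        have "set_lebesgue_integral lborel (A \<union> (UNIV - A)) F = set_lebesgue_integral lborel A F + set_lebesgue_integral lborel (UNIV - A) F"
          using A by (intro set_integral_Un F_set) auto
        then show ?case using compl F_UNIV by simp
      next
        case (union A)
        then have A: "A i \<in> sets borel" for i by (auto simp: borel_eq_box)
        have "set_lebesgue_integral lborel (\<Union>i. A i) F = (\<Sum>i. set_lebesgue_integral lborel (A i) F)"
          using union A by (intro lebesgue_integral_countable_add F_set) (auto simp: disjoint_family_on_def)
        then show ?case using union by simp
      qed
    qed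
    then have "AE y in lborel. F y = 0"
      by (intro sigma_finite_measure.density_zero[OF sigma_finite_lborel F_int]) auto
    then show ?thesis by eventually_elim (auto simp: F_def)
  qed
  \<comment> \<open>Since \<open>y \<in> Q x\<close> and \<open>x \<in> Q y\<close> are equivalent,
    a centre found in \<open>Q y\<close> by density has \<open>y\<close> in its own cube.\<close>
  obtain D :: "'a set" where D: "countable D" "\<And>X. open X \<Longrightarrow> X \<noteq> {} \<Longrightarrow> \<exists>d\<in>D. d \<in> X"
    by (rule countable_dense_setE) blast
  have "AE y in lborel. \<forall>x\<in>D. y \<in> Q x \<longrightarrow> f y = 0"
    using Q D(1) by (subst AE_ball_countable) auto
  then show ?thesis
  proof eventually_elim
    case (elim y)
    have "y \<in> Q y" using \<rho> by (auto simp: Q_def mem_box inner_diff_left inner_add_left)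
    then obtain x where "x \<in> D" "x \<in> Q y" using D(2)[of "Q y"] by (auto simp: Q_def)
    then have "y \<in> Q x" by (fastforce simp: Q_def mem_box inner_diff_left inner_add_left)
    with elim \<open>x \<in> D\<close> show ?case by blast
  qed
qed

text \<open>With \<open>t\<close> the weighted modulus of \<open>g\<close>, the inequality
  \<open>t \<le> 1 + t powr q\<close> takes the place of Hoelder's inequality. The decaying factor
  makes the constant integrable and, in the other term, absorbs
  \<open>(1 + norm \<xi>) powr N\<close>.\<close>

lemma weighted_integrable_from_moment:
  fixes g :: "'a::euclidean_space \<Rightarrow> complex"
  assumes g: "g \<in> borel_measurable lborel" and \<theta>: "\<theta> \<in> borel_measurable lborel"
    and q: "1 \<le> q"
    and fin: "(\<integral>\<^sup>+\<xi>. ennreal (norm (g \<xi>) powr q * exp (q * \<theta> \<xi> * norm \<xi>) / (1 + norm \<xi>) powr N) \<partial>lborel) < \<infinity>"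
  shows "integrable lborel (\<lambda>\<xi>. norm (g \<xi>) * exp (\<theta> \<xi> * norm \<xi>) * exp (- (2 * (norm \<xi> / sqrt (1 + norm \<xi>)))))"
proof -
  note [measurable] = g \<theta>
  let ?s = "\<lambda>\<xi>::'a. norm \<xi> / sqrt (1 + norm \<xi>)"
  define A where "A \<xi> = norm (g \<xi>) powr q * exp (q * \<theta> \<xi> * norm \<xi>) / (1 + norm \<xi>) powr N" for \<xi>
  have A0: "A \<xi> \<ge> 0" for \<xi> by (simp add: A_def)
  have [measurable]: "A \<in> borel_measurable lborel" unfolding A_def[abs_def] by measurable
  have A_int: "integrable lborel A"
    using fin A0 by (intro integrableI_bounded) (auto simp: A_def[symmetric])
  obtain K where K: "K > 0"
    "\<And>x::'a. exp (- ?s x) \<le> K * (\<Prod>b\<in>Basis. 1 / (1 + (x \<bullet> b)\<^sup>2))"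
    using decay_integrable_tensor by blast
  obtain K' where K': "K' > 0" "\<And>r. r \<ge> 0 \<Longrightarrow> (1 + r) ^ nat \<lceil>N\<rceil> * exp (- (r / sqrt (1 + r))) \<le> K'"
    using poly_exp_decay by blast
  let ?W = "\<lambda>\<xi>::'a. \<Prod>b\<in>Basis. 1 / (1 + (\<xi> \<bullet> b)\<^sup>2)"
  show ?thesis
  proof (rule Bochner_Integration.integrable_bound)
    show "integrable lborel (\<lambda>\<xi>. K * ?W \<xi> + K' * A \<xi>)"
      by (intro Bochner_Integration.integrable_add integrable_mult_right integrable_inverse_quadratic_tensor A_int)
    show "AE \<xi> in lborel. norm (norm (g \<xi>) * exp (\<theta> \<xi> * norm \<xi>) * exp (- (2 * ?s \<xi>))) \<le> norm (K * ?W \<xi> + K' * A \<xi>)"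
    proof (rule AE_I2)
      fix \<xi> :: 'a
      define t where "t = norm (g \<xi>) * exp (\<theta> \<xi> * norm \<xi>)"
      have t: "t \<ge> 0" by (simp add: t_def)
      have "?s \<xi> \<ge> 0" by simp
      then have s2: "exp (- (2 * ?s \<xi>)) \<le> exp (- ?s \<xi>)" unfolding exp_le_cancel_iff by linarith
      have "t \<le> 1 + t powr q"
      proof (cases "t \<le> 1")
        case False
        then have "t powr 1 \<le> t powr q" using q by (intro powr_mono) auto
        then show ?thesis using False by simp
      qed (simp add: add_increasing2)
      then have "t * exp (- (2 * ?s \<xi>)) \<le> (1 + t powr q) * exp (- (2 * ?s \<xi>))" by (intro mult_right_mono) auto
      also have "\<dots> = exp (- (2 * ?s \<xi>)) + t powr q * exp (- (2 * ?s \<xi>))" by (simp add: distrib_right)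
      finally have split: "t * exp (- (2 * ?s \<xi>)) \<le> exp (- (2 * ?s \<xi>)) + t powr q * exp (- (2 * ?s \<xi>))" .
      have "exp (- (2 * ?s \<xi>)) \<le> K * ?W \<xi>"
      proof -
        from s2 show ?thesis using K(2)[of \<xi>] by linarith
      qed
      moreover have "t powr q * exp (- (2 * ?s \<xi>)) \<le> K' * A \<xi>"
      proof -
        have "1 + norm \<xi> > 0" by (simp add: add_pos_nonneg)
        then have n: "(1 + norm \<xi>) powr N > 0" by simp
        have "t powr q = A \<xi> * (1 + norm \<xi>) powr N"
          using n by (simp add: t_def A_def powr_mult exp_powr_real mult_ac)
        moreover have "(1 + norm \<xi>) powr N * exp (- (2 * ?s \<xi>)) \<le> K'"
        proof -
          have "(1 + norm \<xi>) powr N \<le> (1 + norm \<xi>) powr real (nat \<lceil>N\<rceil>)"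
            by (intro powr_mono) (auto intro: real_nat_ceiling_ge)
          also have "\<dots> = (1 + norm \<xi>) ^ nat \<lceil>N\<rceil>" by (rule powr_realpow) (simp add: add_pos_nonneg)
          finally have "(1 + norm \<xi>) powr N * exp (- (2 * ?s \<xi>)) \<le> (1 + norm \<xi>) ^ nat \<lceil>N\<rceil> * exp (- ?s \<xi>)"
            using s2 by (intro mult_mono) auto
          also have "\<dots> \<le> K'" by (rule K') simp
          finally show ?thesis .
        qed
        ultimately show ?thesis
          using mult_left_mono[of "(1 + norm \<xi>) powr N * exp (- (2 * ?s \<xi>))" K' "A \<xi>"] A0[of \<xi>]
          by (simp add: mult_ac)
      qed
      ultimately have "t * exp (- (2 * ?s \<xi>)) \<le> K * ?W \<xi> + K' * A \<xi>" using split by linarith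
      then show "norm (norm (g \<xi>) * exp (\<theta> \<xi> * norm \<xi>) * exp (- (2 * ?s \<xi>))) \<le> norm (K * ?W \<xi> + K' * A \<xi>)"
        using t by (simp add: t_def[symmetric] abs_mult)
    qed
  qed measurable
qed

text \<open>Of the two factors \<open>exp (- (norm \<xi> / sqrt (1 + norm \<xi>)))\<close>, one
  absorbs the polynomial and the other supplies the integrable product.\<close>

lemma weighted_integrable_from_bound:
  fixes g :: "'a::euclidean_space \<Rightarrow> complex"
  assumes g: "g \<in> borel_measurable lborel" and \<theta>: "\<theta> \<in> borel_measurable lborel"
    and P: "poly_fun P" and C: "C > 0"
    and bound: "AE \<xi> in lborel. norm (g \<xi>) \<le> C * norm (P \<xi>) * exp (- \<theta> \<xi> * norm \<xi>)"
  shows "integrable lborel (\<lambda>\<xi>. norm (g \<xi>) * exp (\<theta> \<xi> * norm \<xi>) * exp (- (2 * (norm \<xi> / sqrt (1 + norm \<xi>)))))"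
proof -
  note [measurable] = g \<theta>
  let ?s = "\<lambda>\<xi>::'a. norm \<xi> / sqrt (1 + norm \<xi>)"
  obtain L M where L: "L \<ge> 0" "\<And>x. norm (P x) \<le> L * (1 + norm x) ^ M"
    using poly_fun_bound[OF P] by blast
  obtain K where K: "K > 0"
    "\<And>x::'a. exp (- ?s x) \<le> K * (\<Prod>b\<in>Basis. 1 / (1 + (x \<bullet> b)\<^sup>2))"
    using decay_integrable_tensor by blast
  obtain K' where K': "K' > 0" "\<And>r. r \<ge> 0 \<Longrightarrow> (1 + r) ^ M * exp (- (r / sqrt (1 + r))) \<le> K'"
    using poly_exp_decay by blast
  let ?W = "\<lambda>\<xi>::'a. \<Prod>b\<in>Basis. 1 / (1 + (\<xi> \<bullet> b)\<^sup>2)"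
  show ?thesis
  proof (rule Bochner_Integration.integrable_bound)
    show "integrable lborel (\<lambda>\<xi>. C * L * K' * (K * ?W \<xi>))"
      by (intro integrable_mult_right integrable_inverse_quadratic_tensor)
    from bound show "AE \<xi> in lborel. norm (norm (g \<xi>) * exp (\<theta> \<xi> * norm \<xi>) * exp (- (2 * ?s \<xi>))) \<le> norm (C * L * K' * (K * ?W \<xi>))"
    proof eventually_elim
      case (elim \<xi>)
      have "norm (g \<xi>) * exp (\<theta> \<xi> * norm \<xi>) \<le> C * norm (P \<xi>) * exp (- \<theta> \<xi> * norm \<xi>) * exp (\<theta> \<xi> * norm \<xi>)"
        using elim by (rule mult_right_mono) simp
      also have "\<dots> = C * norm (P \<xi>)" by (simp add: exp_minus)
      also have "\<dots> \<le> C * (L * (1 + norm \<xi>) ^ M)" using C by (intro mult_left_mono L) auto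
      finally have "norm (g \<xi>) * exp (\<theta> \<xi> * norm \<xi>) * exp (- (2 * ?s \<xi>)) \<le> C * (L * (1 + norm \<xi>) ^ M) * exp (- (2 * ?s \<xi>))"
        by (rule mult_right_mono) simp
      also have "\<dots> = C * L * ((1 + norm \<xi>) ^ M * exp (- ?s \<xi>) * exp (- ?s \<xi>))"
        by (simp add: mult_ac flip: exp_add)
      also have "\<dots> \<le> C * L * (K' * (K * ?W \<xi>))"
        using C L(1) K'(1) by (intro mult_left_mono mult_mono K K') auto
      finally have "norm (g \<xi>) * exp (\<theta> \<xi> * norm \<xi>) * exp (- (2 * ?s \<xi>)) \<le> C * L * K' * (K * ?W \<xi>)" by (simp add: mult_ac)
      then show ?case
        unfolding real_norm_def by (intro order_trans[OF _ abs_ge_self]) simp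
    qed
  qed measurable
qed

lemma sqrt_le_slow: "0 \<le> r \<Longrightarrow> sqrt r \<le> 1 + r / sqrt (1 + r)"
proof -
  assume r: "0 \<le> r"
  have "sqrt r \<le> sqrt (1 + r)" by simp
  also have "\<dots> = (1 + r) / sqrt (1 + r)" using r by (simp add: real_div_sqrt)
  also have "\<dots> = 1 / sqrt (1 + r) + r / sqrt (1 + r)" by (simp add: add_divide_distrib)
  also have "1 / sqrt (1 + r) \<le> 1" using r by simp
  finally show ?thesis by simp
qed

text \<open>A Lipschitz approximation from inside to the indicator of the open interval of radius
  \<open>r\<close>, with slope \<open>k\<close> at both ends. Being Lipschitz, it can be fed to the
  averaging construction.\<close>

definition trapezoid :: "real \<Rightarrow> real \<Rightarrow> real \<Rightarrow> real" where
  "trapezoid k r t = max 0 (min 1 (k * (r - \<bar>t\<bar>)))"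

lemma trapezoid_lipschitz: "k \<ge> 0 \<Longrightarrow> \<bar>trapezoid k r x - trapezoid k r y\<bar> \<le> k * \<bar>x - y\<bar>"
proof -
  assume k: "k \<ge> 0"
  have "\<bar>trapezoid k r x - trapezoid k r y\<bar> \<le> \<bar>k * (r - \<bar>x\<bar>) - k * (r - \<bar>y\<bar>)\<bar>"
    unfolding trapezoid_def by linarith
  also have "\<dots> = k * \<bar>\<bar>y\<bar> - \<bar>x\<bar>\<bar>" using k by (simp add: abs_mult flip: right_diff_distrib)
  also have "\<dots> \<le> k * \<bar>x - y\<bar>" using k by (intro mult_left_mono) auto
  finally show ?thesis .
qed

lemma trapezoid_range: "trapezoid k r x \<in> {0..1}"
  by (auto simp: trapezoid_def)

lemma trapezoid_supp: "k \<ge> 0 \<Longrightarrow> \<bar>t\<bar> \<ge> r \<Longrightarrow> trapezoid k r t = 0"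
  using mult_nonneg_nonpos[of k "r - \<bar>t\<bar>"] by (simp add: trapezoid_def)

lemma trapezoid_tendsto: "(\<lambda>n. trapezoid (real (Suc n)) r t) \<longlonglongrightarrow> indicator {-r<..<r} t"
proof (cases "\<bar>t\<bar> < r")
  case True
  obtain n0 where n0: "1 / (r - \<bar>t\<bar>) < real n0" using reals_Archimedean2 by blast
  have "trapezoid (real (Suc n)) r t = 1" if "n \<ge> n0" for n
  proof -
    have "1 / (r - \<bar>t\<bar>) \<le> real (Suc n)" using n0 that by linarith
    then have "1 \<le> real (Suc n) * (r - \<bar>t\<bar>)" using True by (simp add: divide_le_eq)
    then show ?thesis by (simp add: trapezoid_def)
  qed
  then have "(\<lambda>n. trapezoid (real (Suc n)) r t) \<longlonglongrightarrow> 1"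
    by (intro tendsto_eventually) (auto simp: eventually_sequentially)
  then show ?thesis using True by (simp add: indicator_def abs_less_iff)
next
  case False
  then have "trapezoid (real (Suc n)) r t = 0" for n by (intro trapezoid_supp) auto
  then show ?thesis using False by (auto simp: indicator_def)
qed

theorem ingham_uniqueness:
  fixes \<theta> :: "'a::euclidean_space \<Rightarrow> real" and \<Theta> :: "real \<Rightarrow> real" and f g :: "'a \<Rightarrow> complex"
  assumes eq: "\<And>\<xi>. \<theta> \<xi> = \<Theta> (norm \<xi>)"
    and nonneg: "\<And>r. \<Theta> r \<ge> 0" and mono: "\<And>r s. 0 \<le> r \<Longrightarrow> r \<le> s \<Longrightarrow> \<Theta> s \<le> \<Theta> r"
    and even: "\<And>r. \<Theta> \<bar>r\<bar> = \<Theta> r" and div: "\<not> summable (\<lambda>k. \<Theta> (2 ^ k))"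
    and f: "Lp p f" and p: "1 \<le> p" and fg: "fourier_transform_of f g"
    and g_int: "integrable lborel (\<lambda>\<xi>. norm (g \<xi>) * exp (\<theta> \<xi> * norm \<xi>) * exp (- (2 * (norm \<xi> / sqrt (1 + norm \<xi>)))))"
    and U: "open U" "U \<noteq> {}" "AE x in lborel. x \<in> U \<longrightarrow> f x = 0"
  shows "AE x in lborel. f x = 0"
proof -
  have f_meas[measurable]: "f \<in> borel_measurable borel" using f by (simp add: Lp_def)
  have g_meas[measurable]: "g \<in> borel_measurable borel" using fg by (simp add: fourier_transform_of_def)
  have pos: "\<Theta> r > 0" for r
    using positive_if_not_summable[OF nonneg mono div, of "\<bar>r\<bar>"] even[of r] by simp
  have le0: "\<Theta> r \<le> \<Theta> 0" for r using mono[of 0 "\<bar>r\<bar>"] even[of r] by simp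
  obtain x0 e where e: "e > 0" "ball x0 e \<subseteq> U" using U(1,2) open_contains_ball by blast
  \<comment> \<open>In every coordinate the kernel lives within \<open>2 * \<rho>\<close>, so a
    shift has norm at most \<open>2 * \<rho> * DIM('a)\<close> by the l1 bound. Together with a ball
    of radius \<open>\<rho>\<close> around \<open>x0\<close> this stays below
    \<open>e\<close>.\<close>
  define \<rho> where "\<rho> = e / (4 * real DIM('a))"
  have d1: "1 \<le> real DIM('a)" using DIM_positive[where 'a = 'a] by (simp add: Suc_le_eq)
  have \<rho>: "\<rho> > 0" using e(1) d1 by (simp add: \<rho>_def)
  have \<rho>e: "3 * \<rho> * DIM('a) < e" using e(1) d1 by (simp add: \<rho>_def field_simps)
  let ?s = "\<lambda>\<xi>::'a. norm \<xi> / sqrt (1 + norm \<xi>)"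
  \<comment> \<open>Near \<open>x0\<close> the support of the kernel keeps \<open>y\<close> inside
    \<open>U\<close>, so the convolution vanishes there; quasi-analyticity extends this to every
    \<open>x\<close>.\<close>
  have conv_zero: "(\<integral>y. f y * (\<Prod>b\<in>Basis. complex_of_real (V b (x \<bullet> b - y \<bullet> b))) \<partial>lborel) = 0"
    if V: "\<And>b. smooth1 (\<lambda>t. of_real (V b t))" "\<And>b t. V b t \<in> {0..1}" "\<And>b t. \<bar>t\<bar> \<ge> 2 * \<rho> \<Longrightarrow> V b t = 0" and C: "C > 0"
      and decay: "\<And>\<xi>. norm (\<Prod>b\<in>Basis. fourier (\<lambda>t. of_real (V b t)) (\<xi> \<bullet> b)) \<le> C * exp (- (3 * slow (norm \<xi>)) * norm \<xi>)"
    for V :: "'a \<Rightarrow> real \<Rightarrow> real" and C x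
  proof -
    define \<Phi> where "\<Phi> \<xi> = (\<Prod>b\<in>Basis. fourier (\<lambda>t. of_real (V b t)) (\<xi> \<bullet> b))" for \<xi> :: 'a
    define G where "G \<xi> = g \<xi> * \<Phi> \<xi>" for \<xi>
    \<comment> \<open>The quasi-analytic theorem wants a rate at most 1. Dividing by a constant
      achieves this and preserves divergence.\<close>
    define \<Theta>' where "\<Theta>' r = \<Theta> r / (1 + \<Theta> 0)" for r
    have c: "1 + \<Theta> 0 > 0" using nonneg[of 0] by linarith
    have \<Theta>'_le: "\<Theta>' r \<le> \<Theta> r" for r
      using nonneg[of r] nonneg[of 0] mult_nonneg_nonneg[OF nonneg[of r] nonneg[of 0]] c
      by (simp add: \<Theta>'_def divide_le_eq distrib_left)
    have [measurable]: "fourier (\<lambda>t. of_real (V b t)) \<in> borel_measurable borel" for b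
      by (rule borel_measurable_continuous_onI[OF smooth1_continuous[OF smooth1_fourier[OF smooth1_continuous[OF V(1)], of "2 * \<rho>"]]])
         (simp add: V(3))
    have [measurable]: "\<Phi> \<in> borel_measurable borel" unfolding \<Phi>_def[abs_def] by measurable
    have [measurable]: "G \<in> borel_measurable borel" unfolding G_def[abs_def] by measurable
    \<comment> \<open>Monotonicity holds only on the nonnegative half-line: composing with
      \<open>max 0\<close> makes the function antitone on the whole line, and evenness recovers
      \<open>\<Theta>'\<close>.\<close>
    have [measurable]: "\<Theta>' \<in> borel_measurable borel"
    proof -
      have "(\<lambda>r. - \<Theta>' (max 0 r)) \<in> borel_measurable borel"
        using mono c by (intro borel_measurable_mono monoI) (auto simp: \<Theta>'_def divide_right_mono)
      then have m: "(\<lambda>r. \<Theta>' (max 0 r)) \<in> borel_measurable borel" by simp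
      have "(\<lambda>r. \<Theta>' (max 0 \<bar>r\<bar>)) \<in> borel_measurable borel"
        by (rule measurable_compose[OF _ m]) measurable
      then show ?thesis using even by (simp add: \<Theta>'_def[abs_def] max_def)
    qed
    have G_weight: "norm (G \<xi>) * exp (\<Theta>' (norm \<xi>) * norm \<xi> + sqrt (norm \<xi>)) \<le>
        C * exp 1 * (norm (g \<xi>) * exp (\<theta> \<xi> * norm \<xi>) * exp (- (2 * ?s \<xi>)))" for \<xi>
    proof -
      \<comment> \<open>Two of the three decay factors are passed on to the weight in
        \<open>g_int\<close>; the third meets \<open>exp (sqrt (norm \<xi>))\<close> through
        \<open>sqrt_le_slow\<close>.\<close>
      have "norm (\<Phi> \<xi>) \<le> C * exp (- (3 * ?s \<xi>))" using decay[of \<xi>] by (simp add: \<Phi>_def slow_def)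
      moreover have "exp (\<Theta>' (norm \<xi>) * norm \<xi> + sqrt (norm \<xi>)) \<le> exp (\<theta> \<xi> * norm \<xi> + (1 + ?s \<xi>))"
        using mult_right_mono[OF \<Theta>'_le, of "norm \<xi>" "norm \<xi>"] sqrt_le_slow[of "norm \<xi>"] by (simp add: eq add_mono)
      ultimately have "norm (G \<xi>) * exp (\<Theta>' (norm \<xi>) * norm \<xi> + sqrt (norm \<xi>)) \<le>
          (norm (g \<xi>) * (C * exp (- (3 * ?s \<xi>)))) * exp (\<theta> \<xi> * norm \<xi> + (1 + ?s \<xi>))"
        unfolding G_def norm_mult using C by (intro mult_mono mult_left_mono) auto
      also have "\<dots> = C * norm (g \<xi>) * (exp (- (3 * ?s \<xi>)) * exp (\<theta> \<xi> * norm \<xi> + (1 + ?s \<xi>)))" by simp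
      also have "exp (- (3 * ?s \<xi>)) * exp (\<theta> \<xi> * norm \<xi> + (1 + ?s \<xi>)) = exp 1 * (exp (\<theta> \<xi> * norm \<xi>) * exp (- (2 * ?s \<xi>)))"
        by (simp flip: exp_add)
      finally show ?thesis by (simp add: mult_ac)
    qed
    have G_int: "integrable lborel (\<lambda>\<xi>. norm (G \<xi>) * exp (\<Theta>' (norm \<xi>) * norm \<xi> + sqrt (norm \<xi>)))"
    proof (rule Bochner_Integration.integrable_bound[OF integrable_mult_right[OF g_int, of "C * exp 1"]])
      show "AE \<xi> in lborel. norm (norm (G \<xi>) * exp (\<Theta>' (norm \<xi>) * norm \<xi> + sqrt (norm \<xi>))) \<le>
          norm (C * exp 1 * (norm (g \<xi>) * exp (\<theta> \<xi> * norm \<xi>) * exp (- (2 * ?s \<xi>))))"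
        using G_weight by (intro AE_I2) (simp only: real_norm_def abs_mult abs_norm_cancel abs_exp_cancel abs_of_pos[OF C])
    qed measurable
    have "integrable lborel G"
    proof (rule Bochner_Integration.integrable_bound[OF G_int])
      show "AE \<xi> in lborel. norm (G \<xi>) \<le> norm (norm (G \<xi>) * exp (\<Theta>' (norm \<xi>) * norm \<xi> + sqrt (norm \<xi>)))"
      proof (rule AE_I2)
        fix \<xi> :: 'a
        have "1 \<le> exp (\<Theta>' (norm \<xi>) * norm \<xi> + sqrt (norm \<xi>))"
          using nonneg c by (simp add: \<Theta>'_def add_nonneg_nonneg)
        then have "norm (G \<xi>) * 1 \<le> norm (G \<xi>) * exp (\<Theta>' (norm \<xi>) * norm \<xi> + sqrt (norm \<xi>))" by (rule mult_left_mono) simp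
        then show "norm (G \<xi>) \<le> norm (norm (G \<xi>) * exp (\<Theta>' (norm \<xi>) * norm \<xi> + sqrt (norm \<xi>)))" by (simp add: abs_mult)
      qed
    qed measurable
    then have conv: "(\<integral>y. f y * (\<Prod>b\<in>Basis. complex_of_real (V b (x \<bullet> b - y \<bullet> b))) \<partial>lborel) =
        (\<integral>\<xi>. G \<xi> * exp (2 * pi * \<i> * of_real (x \<bullet> \<xi>)) \<partial>lborel)" for x :: 'a
      unfolding G_def \<Phi>_def using V(2,3) \<rho>
      by (intro convolution_eq_inverse_fourier[OF f p fg, where B = "2 * \<rho>"] V(1)) auto
    have "(\<integral>\<xi>. G \<xi> * exp (2 * pi * \<i> * of_real (x \<bullet> \<xi>)) \<partial>lborel) = 0"
    proof (rule fourier_quasianalytic[where \<Theta> = \<Theta>' and \<epsilon> = \<rho> and ?x0.0 = x0])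
      show "\<Theta>' r > 0" for r using pos c by (simp add: \<Theta>'_def)
      show "\<Theta>' r \<le> 1" for r using le0[of r] c by (simp add: \<Theta>'_def)
      show "\<Theta>' s \<le> \<Theta>' r" if "0 \<le> r" "r \<le> s" for r s using mono[OF that] c by (simp add: \<Theta>'_def divide_right_mono)
      show "\<not> summable (\<lambda>n. \<Theta>' (real n ^ 4) / real n)"
      proof
        assume "summable (\<lambda>n. \<Theta>' (real n ^ 4) / real n)"
        from summable_mult[OF this, of "1 + \<Theta> 0"] have "summable (\<lambda>n. \<Theta> (real n ^ 4) / real n)"
          using c by (simp add: \<Theta>'_def)
        then show False using not_summable_fourth_powers[OF nonneg mono div] by simp
      qed
      show "(\<integral>\<xi>. G \<xi> * exp (2 * pi * \<i> * of_real (z \<bullet> \<xi>)) \<partial>lborel) = 0" if z: "z \<in> ball x0 \<rho>" for z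
      proof -
        have "AE y in lborel. f y * (\<Prod>b\<in>Basis. complex_of_real (V b (z \<bullet> b - y \<bullet> b))) = 0"
          using U(3)
        proof eventually_elim
          case (elim y)
          show ?case
          proof (cases "y \<in> U")
            case False
            have "\<exists>b\<in>Basis. \<bar>z \<bullet> b - y \<bullet> b\<bar> \<ge> 2 * \<rho>"
            proof (rule ccontr)
              assume "\<not> ?thesis"
              then have "(\<Sum>b\<in>Basis. \<bar>(z - y) \<bullet> b\<bar>) \<le> (\<Sum>b\<in>(Basis::'a set). 2 * \<rho>)"
                by (intro sum_mono) (auto simp: inner_diff_left not_le intro: less_imp_le)
              then have "norm (z - y) \<le> 2 * \<rho> * DIM('a)" using norm_le_l1[of "z - y"] by (simp add: mult_ac)
              moreover have "dist x0 y \<le> dist x0 z + norm (z - y)" by (metis dist_norm dist_triangle)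
              moreover have "\<rho> * 1 \<le> \<rho> * DIM('a)" using \<rho> d1 by (intro mult_left_mono) auto
              then have "dist x0 z < \<rho> * DIM('a)" using z unfolding mem_ball by linarith
              ultimately have "dist x0 y < e" using \<rho>e by simp
              with e(2) False show False by auto
            qed
            then show ?thesis using V(3) by auto
          qed (use elim in simp)
        qed
        then have "(\<integral>y. f y * (\<Prod>b\<in>Basis. complex_of_real (V b (z \<bullet> b - y \<bullet> b))) \<partial>lborel) = 0"
          by (rule integral_eq_zero_AE)
        then show ?thesis unfolding conv .
      qed
    qed (use G_int \<rho> in auto)
    then show ?thesis unfolding conv .
  qed
  show ?thesis
  proof (rule AE_zero_if_small_boxes[OF _ \<rho>])
    have box_int: "integrable lborel (\<lambda>y. norm (f y) * indicator A y)" if "A \<in> sets borel" "emeasure lborel A < \<infinity>" for A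
      using that by (intro Lp_weighted_integrable[OF f p]) auto
    show "integrable lborel (\<lambda>y. indicator (box a b) y *\<^sub>R f y)" for a b
    proof (rule Bochner_Integration.integrable_bound[OF box_int[of "box a b"]])
      show "emeasure lborel (box a b) < \<infinity>" by (rule emeasure_lborel_box_finite)
    qed auto
    fix a b :: 'a
    assume ne: "box a b \<noteq> {}" and small: "\<And>i. i \<in> Basis \<Longrightarrow> b \<bullet> i - a \<bullet> i \<le> 2 * \<rho>"
    define x where "x = (1 / 2) *\<^sub>R (a + b)"
    \<comment> \<open>For basis vectors this is the half side of the box, by \<open>small\<close>.
      The minimum matters at other indices, because \<open>ingham_tensor\<close> asks for support
      within \<open>\<rho>\<close> at every index.\<close>
    define r where "r i = min \<rho> ((b \<bullet> i - a \<bullet> i) / 2)" for i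
    define good where "good n V \<longleftrightarrow> (\<forall>i. V i \<in> borel_measurable borel) \<and> (\<forall>i t. V i t \<in> {0..1}) \<and>
        (\<forall>i t. \<bar>V i t - trapezoid (real (Suc n)) (r i) t\<bar> \<le> 1 / real (Suc n)) \<and> (\<forall>i t. \<bar>t\<bar> \<ge> 2 * \<rho> \<longrightarrow> V i t = 0) \<and>
        (\<integral>y. f y * (\<Prod>i\<in>Basis. complex_of_real (V i (x \<bullet> i - y \<bullet> i))) \<partial>lborel) = 0"
      for n and V :: "'a \<Rightarrow> real \<Rightarrow> real"
    have "\<exists>V. good n V" for n
    proof -
      \<comment> \<open>The bound by \<open>\<rho>\<close> keeps the support within
        \<open>2 * \<rho>\<close>; the bound by \<open>1 / real (Suc n)\<close> gives
        \<open>V\<close> the same pointwise limit as the trapezoids.\<close>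
      define \<delta> where "\<delta> = min \<rho> (1 / real (Suc n))"
      have \<delta>: "\<delta> > 0" "\<delta> \<le> \<rho>" "\<delta> \<le> 1 / real (Suc n)" using \<rho> by (auto simp: \<delta>_def)
      obtain V :: "'a \<Rightarrow> real \<Rightarrow> real" and C where V: "\<And>i. smooth1 (\<lambda>x. of_real (V i x))"
        "\<And>i x. V i x \<in> {0..1}" "\<And>i x. \<bar>V i x - trapezoid (real (Suc n)) (r i) x\<bar> \<le> \<delta>"
        "\<And>i x. \<bar>x\<bar> \<ge> \<rho> + \<delta> \<Longrightarrow> V i x = 0" "C > 0"
        "\<And>\<xi>. norm (\<Prod>i\<in>Basis. fourier (\<lambda>x. of_real (V i x)) (\<xi> \<bullet> i)) \<le> C * exp (- (3 * slow (norm \<xi>)) * norm \<xi>)"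
      proof (rule ingham_tensor[where \<Theta> = "\<lambda>r. 3 * slow r" and u = "\<lambda>i. trapezoid (real (Suc n)) (r i)"
            and L = "real (Suc n)" and R = \<rho> and \<delta> = \<delta>])
        show "summable (\<lambda>n. 3 * slow (real n) / real n)" using summable_mult[OF slow_summable, of 3] by simp
        show "((\<lambda>r. 3 * slow r) \<longlongrightarrow> 0) at_top" by (rule tendsto_mult_right_zero[OF slow_tendsto])
        show "trapezoid (real (Suc n)) (r i) t = 0" if "\<rho> \<le> \<bar>t\<bar>" for i t
          using that by (intro trapezoid_supp) (auto simp: r_def)
        show "trapezoid (real (Suc n)) (r i) t \<in> {0..1}" for i t by (rule trapezoid_range)
      qed (use slow_pos slow_mono \<rho> \<delta> in \<open>auto intro: less_imp_le trapezoid_lipschitz simp del: of_nat_Suc\<close>)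
      have "V i \<in> borel_measurable borel" for i
      proof -
        have "continuous_on UNIV (\<lambda>t. Re (complex_of_real (V i t)))"
          by (intro continuous_intros smooth1_continuous V(1))
        then show ?thesis by (intro borel_measurable_continuous_onI) simp
      qed
      moreover have supp: "V i t = 0" if "\<bar>t\<bar> \<ge> 2 * \<rho>" for i t using that \<delta> by (intro V(4)) linarith
      moreover have "\<bar>V i t - trapezoid (real (Suc n)) (r i) t\<bar> \<le> 1 / real (Suc n)" for i t
        using V(3)[of i t] \<delta>(3) by linarith
      moreover have "(\<integral>y. f y * (\<Prod>i\<in>Basis. complex_of_real (V i (x \<bullet> i - y \<bullet> i))) \<partial>lborel) = 0"
        by (rule conv_zero[OF V(1,2) supp V(5,6)])
      ultimately have "good n V" unfolding good_def using V(2) by (intro conjI allI impI)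
      then show ?thesis by (intro exI[of _ V])
    qed
    then obtain V where "\<And>n. good n (V n)" by metis
    then have V_meas[measurable]: "\<And>n i. V n i \<in> borel_measurable borel"
      and V: "\<And>n i t. V n i t \<in> {0..1}"
        "\<And>n i t. \<bar>V n i t - trapezoid (real (Suc n)) (r i) t\<bar> \<le> 1 / real (Suc n)"
        "\<And>n i t. \<bar>t\<bar> \<ge> 2 * \<rho> \<Longrightarrow> V n i t = 0"
        "\<And>n. (\<integral>y. f y * (\<Prod>i\<in>Basis. complex_of_real (V n i (x \<bullet> i - y \<bullet> i))) \<partial>lborel) = 0"
      unfolding good_def by simp_all
    have V_lim: "(\<lambda>n. V n i t) \<longlonglongrightarrow> indicator {-r i<..<r i} t" for i t
    proof -
      have "(\<lambda>n. V n i t - trapezoid (real (Suc n)) (r i) t) \<longlonglongrightarrow> 0"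
      proof (rule Lim_null_comparison)
        show "(\<lambda>n. 1 / real (Suc n)) \<longlonglongrightarrow> 0" by real_asymp
      qed (use V(2) in auto)
      from tendsto_add[OF this trapezoid_tendsto[of "r i" t]] show ?thesis by simp
    qed
    \<comment> \<open>All the kernels vanish for \<open>y\<close> outside this cube, on which
      \<open>f\<close> is integrable.\<close>
    let ?B = "cbox (x - (2 * \<rho>) *\<^sub>R One) (x + (2 * \<rho>) *\<^sub>R One)"
    have "(\<lambda>n. \<integral>y. f y * (\<Prod>i\<in>Basis. complex_of_real (V n i (x \<bullet> i - y \<bullet> i))) \<partial>lborel) \<longlonglongrightarrow>
        (\<integral>y. f y * (\<Prod>i\<in>Basis. complex_of_real (indicator {-r i<..<r i} (x \<bullet> i - y \<bullet> i))) \<partial>lborel)"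
    proof (rule integral_dominated_convergence[where w = "\<lambda>y. norm (f y) * indicator ?B y"])
      show "integrable lborel (\<lambda>y. norm (f y) * indicator ?B y)"
        by (rule box_int[OF _ emeasure_lborel_cbox_finite]) simp
      show "AE y in lborel. (\<lambda>n. f y * (\<Prod>i\<in>Basis. complex_of_real (V n i (x \<bullet> i - y \<bullet> i)))) \<longlonglongrightarrow>
          f y * (\<Prod>i\<in>Basis. complex_of_real (indicator {-r i<..<r i} (x \<bullet> i - y \<bullet> i)))"
        by (intro AE_I2 tendsto_mult tendsto_const tendsto_prod tendsto_of_real V_lim)
      show "AE y in lborel. norm (f y * (\<Prod>i\<in>Basis. complex_of_real (V n i (x \<bullet> i - y \<bullet> i)))) \<le> norm (f y) * indicator ?B y" for n
      proof (rule AE_I2)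
        fix y
        show "norm (f y * (\<Prod>i\<in>Basis. complex_of_real (V n i (x \<bullet> i - y \<bullet> i)))) \<le> norm (f y) * indicator ?B y"
        proof (cases "y \<in> ?B")
          case True
          have "(\<Prod>i\<in>Basis. \<bar>V n i (x \<bullet> i - y \<bullet> i)\<bar>) \<le> 1"
            using V(1) by (intro prod_le_1) auto
          then have "norm (f y) * (\<Prod>i\<in>Basis. \<bar>V n i (x \<bullet> i - y \<bullet> i)\<bar>) \<le> norm (f y) * 1" by (intro mult_left_mono) auto
          then show ?thesis using True by (simp add: norm_mult flip: prod_norm)
        next
          case False
          then obtain i where i: "i \<in> Basis" "\<not> (x \<bullet> i - 2 * \<rho> \<le> y \<bullet> i \<and> y \<bullet> i \<le> x \<bullet> i + 2 * \<rho>)"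
            by (auto simp: mem_box inner_diff_left inner_add_left)
          then have "V n i (x \<bullet> i - y \<bullet> i) = 0" by (intro V(3)) linarith
          then show ?thesis using i(1) False by auto
        qed
      qed
    qed measurable
    then have "(\<integral>y. f y * (\<Prod>i\<in>Basis. complex_of_real (indicator {-r i<..<r i} (x \<bullet> i - y \<bullet> i))) \<partial>lborel) = 0"
      unfolding V(4) by (simp add: LIMSEQ_const_iff)
    moreover have "f y * (\<Prod>i\<in>Basis. complex_of_real (indicator {-r i<..<r i} (x \<bullet> i - y \<bullet> i))) = indicator (box a b) y *\<^sub>R f y" for y
    proof -
      have "x \<bullet> i - y \<bullet> i \<in> {-r i<..<r i} \<longleftrightarrow> a \<bullet> i < y \<bullet> i \<and> y \<bullet> i < b \<bullet> i" if "i \<in> Basis" for i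
      proof -
        have "r i = (b \<bullet> i - a \<bullet> i) / 2" using small[OF that] by (simp add: r_def)
        then show ?thesis by (auto simp: x_def inner_add_left field_simps)
      qed
      then have "(\<Prod>i\<in>Basis. complex_of_real (indicator {-r i<..<r i} (x \<bullet> i - y \<bullet> i))) = of_real (indicator (box a b) y)"
        by (cases "y \<in> box a b") (auto simp: mem_box indicator_def)
      then show ?thesis by (simp add: scaleR_conv_of_real)
    qed
    ultimately show "(\<integral>y. indicator (box a b) y *\<^sub>R f y \<partial>lborel) = 0" by simp
  qed
qed

theorem theorem2p1:
  fixes \<theta> :: "'a::euclidean_space \<Rightarrow> real"
  assumes nonneg: "\<And>\<xi>. \<theta> \<xi> \<ge> 0"
    and meas: "\<theta> \<in> borel_measurable lborel"
    and rad: "radially_decreasing \<theta>"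
    and lim: "(\<theta> \<longlongrightarrow> 0) at_infinity"
  defines "I \<equiv> (\<integral>\<^sup>+\<xi>\<in>{\<xi>. norm \<xi> \<ge> 1}. ennreal (\<theta> \<xi> / norm \<xi> ^ DIM('a)) \<partial>lborel)"
  shows
    "(\<forall>(f::'a \<Rightarrow> complex) g p.
        1 \<le> p \<and> p \<le> 2 \<and> Lp p f \<and> fourier_transform_of f g \<and>
        ((\<exists>q N. 1 \<le> q \<and> 0 \<le> N \<and>
            (\<integral>\<^sup>+\<xi>. ennreal (norm (g \<xi>) powr q * exp (q * \<theta> \<xi> * norm \<xi>) / (1 + norm \<xi>) powr N) \<partial>lborel) < \<infinity>)
         \<or> (\<exists>C P. C > 0 \<and> poly_fun P \<and>
            (AE \<xi> in lborel. norm (g \<xi>) \<le> C * norm (P \<xi>) * exp (- \<theta> \<xi> * norm \<xi>)))) \<and>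
        (\<exists>U. open U \<and> U \<noteq> {} \<and> (AE x in lborel. x \<in> U \<longrightarrow> f x = 0)) \<and>
        I = \<infinity>
      \<longrightarrow> (AE x in lborel. f x = 0))
   \<and>
    (I < \<infinity> \<longrightarrow>
      (\<forall>q N. 1 \<le> q \<and> 0 \<le> N \<longrightarrow>
         (\<exists>f::'a \<Rightarrow> complex. test_function f \<and> (\<exists>x. f x \<noteq> 0) \<and>
            (\<integral>\<^sup>+\<xi>. ennreal (norm (fourier f \<xi>) powr q * exp (q * \<theta> \<xi> * norm \<xi>) / (1 + norm \<xi>) powr N) \<partial>lborel) < \<infinity>))
      \<and>
      (\<exists>(f::'a \<Rightarrow> complex) C P. test_function f \<and> (\<exists>x. f x \<noteq> 0) \<and> poly_fun P \<and>
            (AE \<xi> in lborel. norm (fourier f \<xi>) \<le> C * norm (P \<xi>) * exp (- \<theta> \<xi> * norm \<xi>))))"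
proof -
  obtain b0 :: 'a where b0: "b0 \<in> Basis" using nonempty_Basis by blast
  \<comment> \<open>The profile is read off along a whole line rather than a ray, which makes it
    even and defined on all reals.\<close>
  define \<Theta> where "\<Theta> r = \<theta> (r *\<^sub>R b0)" for r
  have radial: "\<theta> x \<le> \<theta> y" if "norm y \<le> norm x" for x y
    using rad that by (simp add: radially_decreasing_def)
  have \<Theta>_nonneg: "\<Theta> r \<ge> 0" for r by (simp add: \<Theta>_def nonneg)
  have eq: "\<theta> \<xi> = \<Theta> (norm \<xi>)" for \<xi>
    unfolding \<Theta>_def using b0 by (intro antisym radial) auto
  have even: "\<Theta> \<bar>r\<bar> = \<Theta> r" for r
    unfolding \<Theta>_def using b0 by (intro antisym radial) auto
  have mono: "\<Theta> s \<le> \<Theta> r" if "0 \<le> r" "r \<le> s" for r s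
    unfolding \<Theta>_def using b0 that by (intro radial) auto
  have \<Theta>_lim: "(\<Theta> \<longlongrightarrow> 0) at_top"
    unfolding \<Theta>_def
  proof (rule filterlim_compose[OF lim])
    have "filterlim (\<lambda>r. norm (r *\<^sub>R b0)) at_top at_top"
      using b0 filterlim_abs_real by simp
    then show "filterlim (\<lambda>r. r *\<^sub>R b0) at_infinity at_top"
      by (rule filterlim_norm_at_top_imp_at_infinity)
  qed
  have I_iff: "I < \<infinity> \<longleftrightarrow> summable (\<lambda>k. \<Theta> (2 ^ k))"
    unfolding I_def by (rule dyadic_integral_test[OF meas eq \<Theta>_nonneg mono])
  show ?thesis
  proof (intro conjI impI allI)
    fix f g :: "'a \<Rightarrow> complex" and p :: real
    assume *: "1 \<le> p \<and> p \<le> 2 \<and> Lp p f \<and> fourier_transform_of f g \<and>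
        ((\<exists>q N. 1 \<le> q \<and> 0 \<le> N \<and>
            (\<integral>\<^sup>+\<xi>. ennreal (norm (g \<xi>) powr q * exp (q * \<theta> \<xi> * norm \<xi>) / (1 + norm \<xi>) powr N) \<partial>lborel) < \<infinity>)
         \<or> (\<exists>C P. C > 0 \<and> poly_fun P \<and>
            (AE \<xi> in lborel. norm (g \<xi>) \<le> C * norm (P \<xi>) * exp (- \<theta> \<xi> * norm \<xi>)))) \<and>
        (\<exists>U. open U \<and> U \<noteq> {} \<and> (AE x in lborel. x \<in> U \<longrightarrow> f x = 0)) \<and>
        I = \<infinity>"
    then have g: "g \<in> borel_measurable lborel" by (simp add: fourier_transform_of_def)
    have "integrable lborel (\<lambda>\<xi>. norm (g \<xi>) * exp (\<theta> \<xi> * norm \<xi>) * exp (- (2 * (norm \<xi> / sqrt (1 + norm \<xi>)))))"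
      using * weighted_integrable_from_moment[OF g meas] weighted_integrable_from_bound[OF g meas] by blast
    moreover have "\<not> summable (\<lambda>k. \<Theta> (2 ^ k))" using * I_iff by simp
    moreover obtain U where "open U" "U \<noteq> {}" "AE x in lborel. x \<in> U \<longrightarrow> f x = 0" using * by blast
    ultimately show "AE x in lborel. f x = 0"
      using * by (intro ingham_uniqueness[OF eq \<Theta>_nonneg mono even]) auto
  next
    assume "I < \<infinity>"
    then have summ: "summable (\<lambda>k. \<Theta> (2 ^ k))" using I_iff by simp
    obtain f :: "'a \<Rightarrow> complex" and C where f: "test_function f" "f 0 \<noteq> 0" "C > 0"
      "\<And>\<xi>. norm (fourier f \<xi>) \<le> C * exp (- \<theta> \<xi> * norm \<xi>) * exp (- (norm \<xi> / sqrt (1 + norm \<xi>)))"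
      by (rule ingham_existence[OF eq \<Theta>_nonneg mono \<Theta>_lim summ]) (auto intro: that)
    show "\<exists>f::'a \<Rightarrow> complex. test_function f \<and> (\<exists>x. f x \<noteq> 0) \<and>
        (\<integral>\<^sup>+\<xi>. ennreal (norm (fourier f \<xi>) powr q * exp (q * \<theta> \<xi> * norm \<xi>) / (1 + norm \<xi>) powr N) \<partial>lborel) < \<infinity>"
      if "1 \<le> q \<and> 0 \<le> N" for q N
      using f ingham_weight_finite[OF f(3) _ _ f(4)] that by blast
    have "norm (fourier f \<xi>) \<le> C * norm (1::complex) * exp (- \<theta> \<xi> * norm \<xi>)" for \<xi>
    proof -
      have "C * exp (- \<theta> \<xi> * norm \<xi>) * exp (- (norm \<xi> / sqrt (1 + norm \<xi>))) \<le> C * exp (- \<theta> \<xi> * norm \<xi>) * 1"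
        using f(3) by (intro mult_left_mono) auto
      with f(4)[of \<xi>] show ?thesis by simp
    qed
    then show "\<exists>(f::'a \<Rightarrow> complex) C P. test_function f \<and> (\<exists>x. f x \<noteq> 0) \<and> poly_fun P \<and>
        (AE \<xi> in lborel. norm (fourier f \<xi>) \<le> C * norm (P \<xi>) * exp (- \<theta> \<xi> * norm \<xi>))"
      using f by (intro exI[of _ f] exI[of _ C] exI[of _ "\<lambda>_. 1"]) (auto intro: poly_fun.const)
  qed
qed

end
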